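(* Assume that $\mu\in\mathfrak{M}_x(\mathcal{G})$ is definable, invariantly supported and idempotent. Then $(S(\mu),* )$, with the subspace topology from $S_x(\mathcal{G})$, is a compact Hausdorff semigroup which is left-continuous, i.e. the map $S(\mu)\to S(\mu)$, $p\mapsto p*q$, is continuous for each $q\in S(\mu)$.
   Context: Setting: $T$ is a first-order theory in a language $\mathcal{L}$ expanding a group, $\mathcal{G}$ is a sufficiently saturated (monster) model of $T$, and "small" means small relative to the saturation of $\mathcal{G}$. The variable $x$ (and $y$ in convolutions) is a singleton variable of the sort on which the group is defined. Keisler measures: for $A\subseteq\mathcal{G}$, $\mathcal{L}_x(A)$ is the Boolean algebra of formulas in $x$ with parameters from $A$ (up to equivalence), $S_x(A)$ is the space of types over $A$, and $\mathfrak{M}_x(A)$ is the set of Keisler measures over $A$, i.e. finitely additive probability measures on $\mathcal{L}_x(A)$; each is identified with the corresponding regular Borel probability measure on $S_x(A)$. $\mu|_A$ denotes restriction. The support of $\mu\in\mathfrak{M}_x(A)$ is $S(\mu)=\{p\in S_x(A):\mu(\varphi(x))>0 \text{ for all }\varphi(x)\in p\}$. $\mu\in\mathfrak{M}_x(\mathcal{G})$ is definable if there is a small $M\prec\mathcal{G}$ such that for every $\mathcal{L}(M)$-formula $\varphi(x;y)$ ($y$ any finite tuple of variables), $\mu(\varphi(x;b))$ depends only on $\mathrm{tp}(b/M)$ and the map $S_y(M)\to[0,1]$, $\mathrm{tp}(b/M)\mapsto\mu(\varphi(x;b))$ is continuous. $\mu$ is invariantly supported if there is a small $M\prec\mathcal{G}$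 such that every $p\in S(\mu)$ is $M$-invariant. Convolution: for $\mu,\nu\in\mathfrak{M}_x(\mathcal{G})$ let $\nu_y$ be $\nu$ viewed as a measure in the variable $y$. The pair $(\mu,\nu)$ is $*$-Borel if for every $\varphi(x,\bar c)\in\mathcal{L}_x(\mathcal{G})$ there is a small $N\prec\mathcal{G}$ containing $\bar c$ such that for every $q\in S(\nu_y|_N)$ the value $F(q):=\mu(\varphi(x\cdot d,\bar c))$ is the same for all $d\models q$ in $\mathcal{G}$, and $F:S(\nu_y|_N)\to[0,1]$ is Borel. Then $(\mu*\nu)(\varphi(x,\bar c)):=\int_{S(\nu_y|_N)}F\,d\nu_N$, where $\nu_N$ is the Borel measure $\nu_y|_N$ restricted to its support (this does not depend on $N$). $\mu$ is idempotent if $(\mu,\mu)$ is $*$-Borel and $\mu*\mu=\mu$. Product of types: if $p,q\in S_x(\mathcal{G})$ are invariant over a small model $M$, then $p*q:=\mathrm{tp}(a\cdot b/\mathcal{G})$, where (in a larger monster model) $b\models q$ and $a$ realizes the restriction to $\mathcal{G}b$ of the unique $M$-invariant extension of $p$. *)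

theory Defs
  imports "HOL-Analysis.Analysis" "HOL-Algebra.Group"
begin

unbundle cardinal_syntax

section \<open>Many-sorted first-order logic with parameters\<close>

text \<open>
  A variable is a pair of a sort and an index. The symbols of a language are the arguments at
  which the two maps are defined; constants are function symbols with an empty argument list.
\<close>

type_synonym 's var = "'s \<times> nat"

record ('s, 'f, 'r) lang =
  funs :: "'f \<Rightarrow> ('s list \<times> 's) option"
  rels :: "'r \<Rightarrow> 's list option"

text \<open>
  The constructor \<open>Par\<close> is the constant naming an element of a structure, so that formulas with
  parameters from a set are syntactic objects and do not change when the structure is enlarged.
\<close>

datatype ('s, 'f, 'm) tm =
  Var "'s var" | Par 'm | Fn 'f "('s, 'f, 'm) tm list"

datatype ('s, 'f, 'r, 'm) fm =
  Fls
| Eq "('s, 'f, 'm) tm" "('s, 'f, 'm) tm"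
| Rel 'r "('s, 'f, 'm) tm list"
| Neg "('s, 'f, 'r, 'm) fm"
| Conj "('s, 'f, 'r, 'm) fm" "('s, 'f, 'r, 'm) fm"
| Ex "'s var" "('s, 'f, 'r, 'm) fm"

abbreviation Disj :: "('s, 'f, 'r, 'm) fm \<Rightarrow> ('s, 'f, 'r, 'm) fm \<Rightarrow> ('s, 'f, 'r, 'm) fm" where
  "Disj \<phi> \<psi> \<equiv> Neg (Conj (Neg \<phi>) (Neg \<psi>))"

primrec tm_vars :: "('s, 'f, 'm) tm \<Rightarrow> 's var set" where
  "tm_vars (Var v) = {v}"
| "tm_vars (Par a) = {}"
| "tm_vars (Fn f ts) = \<Union> (set (map tm_vars ts))"

primrec tm_params :: "('s, 'f, 'm) tm \<Rightarrow> 'm set" where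
  "tm_params (Var v) = {}"
| "tm_params (Par a) = {a}"
| "tm_params (Fn f ts) = \<Union> (set (map tm_params ts))"

primrec free_vars :: "('s, 'f, 'r, 'm) fm \<Rightarrow> 's var set" where
  "free_vars Fls = {}"
| "free_vars (Eq t u) = tm_vars t \<union> tm_vars u"
| "free_vars (Rel r ts) = \<Union> (tm_vars ` set ts)"
| "free_vars (Neg \<phi>) = free_vars \<phi>"
| "free_vars (Conj \<phi> \<psi>) = free_vars \<phi> \<union> free_vars \<psi>"
| "free_vars (Ex v \<phi>) = free_vars \<phi> - {v}"

primrec params :: "('s, 'f, 'r, 'm) fm \<Rightarrow> 'm set" where
  "params Fls = {}"
| "params (Eq t u) = tm_params t \<union> tm_params u"
| "params (Rel r ts) = \<Union> (tm_params ` set ts)"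
| "params (Neg \<phi>) = params \<phi>"
| "params (Conj \<phi> \<psi>) = params \<phi> \<union> params \<psi>"
| "params (Ex v \<phi>) = params \<phi>"

text \<open>
  Substitution does not rename bound variables. It is only ever used for replacing variables by
  parameters and for replacing a variable \<open>x\<close> by a term whose only variable is \<open>x\<close>; in both cases
  no variable can be captured.
\<close>

primrec tm_subst :: "('s var \<Rightarrow> ('s, 'f, 'm) tm) \<Rightarrow> ('s, 'f, 'm) tm \<Rightarrow> ('s, 'f, 'm) tm" where
  "tm_subst \<theta> (Var v) = \<theta> v"
| "tm_subst \<theta> (Par a) = Par a"
| "tm_subst \<theta> (Fn f ts) = Fn f (map (tm_subst \<theta>) ts)"

primrec subst :: "('s var \<Rightarrow> ('s, 'f, 'm) tm) \<Rightarrow> ('s, 'f, 'r, 'm) fm \<Rightarrow> ('s, 'f, 'r, 'm) fm" where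
  "subst \<theta> Fls = Fls"
| "subst \<theta> (Eq t u) = Eq (tm_subst \<theta> t) (tm_subst \<theta> u)"
| "subst \<theta> (Rel r ts) = Rel r (map (tm_subst \<theta>) ts)"
| "subst \<theta> (Neg \<phi>) = Neg (subst \<theta> \<phi>)"
| "subst \<theta> (Conj \<phi> \<psi>) = Conj (subst \<theta> \<phi>) (subst \<theta> \<psi>)"
| "subst \<theta> (Ex v \<phi>) = Ex v (subst (\<theta>(v := Var v)) \<phi>)"

text \<open>\<open>inst Y b \<phi>\<close> is \<open>\<phi>(x; b)\<close> for \<open>\<phi>(x; y)\<close> and the finite tuple of variables \<open>y\<close> listing \<open>Y\<close>.\<close>

definition inst :: "'s var set \<Rightarrow> ('s var \<Rightarrow> 'm) \<Rightarrow> ('s, 'f, 'r, 'm) fm \<Rightarrow> ('s, 'f, 'r, 'm) fm" where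
  "inst Y b \<phi> = subst (\<lambda>v. if v \<in> Y then Par (b v) else Var v) \<phi>"

text \<open>\<open>translate mul x d \<phi>\<close> is \<open>\<phi>(x \<cdot> d)\<close>.\<close>

definition translate :: "'f \<Rightarrow> 's var \<Rightarrow> 'm \<Rightarrow> ('s, 'f, 'r, 'm) fm \<Rightarrow> ('s, 'f, 'r, 'm) fm" where
  "translate mul x d \<phi> = subst (Var(x := Fn mul [Var x, Par d])) \<phi>"

text \<open>
  The sorts of a structure are the (hence disjoint) fibres of \<open>srt\<close> on the universe; values of the
  fields outside the universe are irrelevant.
\<close>

record ('s, 'f, 'r, 'm) fo_struct =
  univ :: "'m set"
  srt :: "'m \<Rightarrow> 's"
  fint :: "'f \<Rightarrow> 'm list \<Rightarrow> 'm"
  rint :: "'r \<Rightarrow> 'm list \<Rightarrow> bool"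

definition sort_univ :: "('s, 'f, 'r, 'm) fo_struct \<Rightarrow> 's \<Rightarrow> 'm set" where
  "sort_univ \<MM> s = {a \<in> univ \<MM>. srt \<MM> a = s}"

definition fo_structure :: "('s, 'f, 'r) lang \<Rightarrow> ('s, 'f, 'r, 'm) fo_struct \<Rightarrow> bool" where
  "fo_structure L \<MM> \<longleftrightarrow>
     (\<forall>s. sort_univ \<MM> s \<noteq> {}) \<and>
     (\<forall>f ss s as. funs L f = Some (ss, s) \<and> list_all2 (\<lambda>a s. a \<in> sort_univ \<MM> s) as ss
        \<longrightarrow> fint \<MM> f as \<in> sort_univ \<MM> s)"

primrec eval :: "('s, 'f, 'r, 'm) fo_struct \<Rightarrow> ('s var \<Rightarrow> 'm) \<Rightarrow> ('s, 'f, 'm) tm \<Rightarrow> 'm" where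
  "eval \<MM> \<rho> (Var v) = \<rho> v"
| "eval \<MM> \<rho> (Par a) = a"
| "eval \<MM> \<rho> (Fn f ts) = fint \<MM> f (map (eval \<MM> \<rho>) ts)"

primrec sat :: "('s, 'f, 'r, 'm) fo_struct \<Rightarrow> ('s var \<Rightarrow> 'm) \<Rightarrow> ('s, 'f, 'r, 'm) fm \<Rightarrow> bool" where
  "sat \<MM> \<rho> Fls \<longleftrightarrow> False"
| "sat \<MM> \<rho> (Eq t u) \<longleftrightarrow> eval \<MM> \<rho> t = eval \<MM> \<rho> u"
| "sat \<MM> \<rho> (Rel r ts) \<longleftrightarrow> rint \<MM> r (map (eval \<MM> \<rho>) ts)"
| "sat \<MM> \<rho> (Neg \<phi>) \<longleftrightarrow> \<not> sat \<MM> \<rho> \<phi>"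
| "sat \<MM> \<rho> (Conj \<phi> \<psi>) \<longleftrightarrow> sat \<MM> \<rho> \<phi> \<and> sat \<MM> \<rho> \<psi>"
| "sat \<MM> \<rho> (Ex v \<phi>) \<longleftrightarrow> (\<exists>a \<in> sort_univ \<MM> (fst v). sat \<MM> (\<rho>(v := a)) \<phi>)"

inductive has_sort :: "('s, 'f, 'r) lang \<Rightarrow> ('s, 'f, 'r, 'm) fo_struct \<Rightarrow> ('s, 'f, 'm) tm \<Rightarrow> 's \<Rightarrow> bool"
  for L \<MM> where
  "has_sort L \<MM> (Var v) (fst v)"
| "has_sort L \<MM> (Par a) (srt \<MM> a)"
| "funs L f = Some (ss, s) \<Longrightarrow> list_all2 (has_sort L \<MM>) ts ss \<Longrightarrow> has_sort L \<MM> (Fn f ts) s"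

primrec wf_fm :: "('s, 'f, 'r) lang \<Rightarrow> ('s, 'f, 'r, 'm) fo_struct \<Rightarrow> ('s, 'f, 'r, 'm) fm \<Rightarrow> bool" where
  "wf_fm L \<MM> Fls \<longleftrightarrow> True"
| "wf_fm L \<MM> (Eq t u) \<longleftrightarrow> (\<exists>s. has_sort L \<MM> t s \<and> has_sort L \<MM> u s)"
| "wf_fm L \<MM> (Rel r ts) \<longleftrightarrow> (\<exists>ss. rels L r = Some ss \<and> list_all2 (has_sort L \<MM>) ts ss)"
| "wf_fm L \<MM> (Neg \<phi>) \<longleftrightarrow> wf_fm L \<MM> \<phi>"
| "wf_fm L \<MM> (Conj \<phi> \<psi>) \<longleftrightarrow> wf_fm L \<MM> \<phi> \<and> wf_fm L \<MM> \<psi>"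
| "wf_fm L \<MM> (Ex v \<phi>) \<longleftrightarrow> wf_fm L \<MM> \<phi>"

text \<open>
  \<open>formulas L \<MM> A Y\<close> is the set of formulas in the variables \<open>Y\<close> with parameters from \<open>A\<close>. The
  structure only serves to determine the sorts of the parameters.
\<close>

definition formulas ::
  "('s, 'f, 'r) lang \<Rightarrow> ('s, 'f, 'r, 'm) fo_struct \<Rightarrow> 'm set \<Rightarrow> 's var set \<Rightarrow> ('s, 'f, 'r, 'm) fm set"
  where "formulas L \<MM> A Y = {\<phi>. wf_fm L \<MM> \<phi> \<and> params \<phi> \<subseteq> A \<and> free_vars \<phi> \<subseteq> Y}"

definition assigns :: "('s, 'f, 'r, 'm) fo_struct \<Rightarrow> 's var set \<Rightarrow> ('s var \<Rightarrow> 'm) \<Rightarrow> bool" where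
  "assigns \<MM> Y b \<longleftrightarrow> (\<forall>v \<in> Y. b v \<in> sort_univ \<MM> (fst v))"

definition model ::
  "('s, 'f, 'r) lang \<Rightarrow> ('s, 'f, 'r, 'm) fm set \<Rightarrow> ('s, 'f, 'r, 'm) fo_struct \<Rightarrow> bool" where
  "model L T \<MM> \<longleftrightarrow> fo_structure L \<MM> \<and> (\<forall>\<phi> \<in> T. \<forall>\<rho>. assigns \<MM> UNIV \<rho> \<longrightarrow> sat \<MM> \<rho> \<phi>)"

definition elementary ::
  "('s, 'f, 'r) lang \<Rightarrow> ('s, 'f, 'r, 'm) fo_struct \<Rightarrow> ('s, 'f, 'r, 'm) fo_struct \<Rightarrow> bool" where
  "elementary L \<MM> \<NN> \<longleftrightarrow>
     fo_structure L \<MM> \<and> fo_structure L \<NN> \<and> univ \<MM> \<subseteq> univ \<NN> \<and>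
     (\<forall>a \<in> univ \<MM>. srt \<MM> a = srt \<NN> a) \<and>
     (\<forall>\<phi> \<in> formulas L \<MM> {} UNIV. \<forall>\<rho>. assigns \<MM> UNIV \<rho> \<longrightarrow> (sat \<MM> \<rho> \<phi> \<longleftrightarrow> sat \<NN> \<rho> \<phi>))"

abbreviation submodel :: "('s, 'f, 'r) lang \<Rightarrow> ('s, 'f, 'r, 'm) fo_struct \<Rightarrow> 'm set \<Rightarrow> bool" where
  "submodel L \<MM> M \<equiv> elementary L (\<MM>\<lparr>univ := M\<rparr>) \<MM>"

section \<open>Types and saturation\<close>

definition tp ::
  "('s, 'f, 'r) lang \<Rightarrow> ('s, 'f, 'r, 'm) fo_struct \<Rightarrow> 'm set \<Rightarrow> 's var set \<Rightarrow> ('s var \<Rightarrow> 'm)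
     \<Rightarrow> ('s, 'f, 'r, 'm) fm set" where
  "tp L \<MM> A Y b = {\<phi> \<in> formulas L \<MM> A Y. sat \<MM> b \<phi>}"

text \<open>Consistency with the elementary diagram over \<open>A\<close> is finite satisfiability in \<open>\<MM>\<close>.\<close>

definition type_space ::
  "('s, 'f, 'r) lang \<Rightarrow> ('s, 'f, 'r, 'm) fo_struct \<Rightarrow> 'm set \<Rightarrow> 's var set
     \<Rightarrow> ('s, 'f, 'r, 'm) fm set set" where
  "type_space L \<MM> A Y =
     {p. p \<subseteq> formulas L \<MM> A Y \<and>
         (\<forall>\<Phi>. finite \<Phi> \<and> \<Phi> \<subseteq> p \<longrightarrow> (\<exists>b. assigns \<MM> Y b \<and> (\<forall>\<phi> \<in> \<Phi>. sat \<MM> b \<phi>))) \<and>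
         (\<forall>\<phi> \<in> formulas L \<MM> A Y. \<phi> \<in> p \<or> Neg \<phi> \<in> p)}"

definition type_top ::
  "('s, 'f, 'r) lang \<Rightarrow> ('s, 'f, 'r, 'm) fo_struct \<Rightarrow> 'm set \<Rightarrow> 's var set
     \<Rightarrow> ('s, 'f, 'r, 'm) fm set topology" where
  "type_top L \<MM> A Y =
     topology_generated_by ((\<lambda>\<phi>. {p \<in> type_space L \<MM> A Y. \<phi> \<in> p}) ` formulas L \<MM> A Y)"

definition realizes ::
  "('s, 'f, 'r, 'm) fo_struct \<Rightarrow> 's var \<Rightarrow> ('s, 'f, 'r, 'm) fm set \<Rightarrow> 'm \<Rightarrow> bool" where
  "realizes \<MM> x p d \<longleftrightarrow> d \<in> sort_univ \<MM> (fst x) \<and> (\<forall>\<phi> \<in> p. sat \<MM> (\<lambda>_. d) \<phi>)"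

definition small :: "'k rel \<Rightarrow> 'm set \<Rightarrow> bool" where
  "small \<kappa> A \<longleftrightarrow> |A| <o \<kappa>"

definition saturated ::
  "('s, 'f, 'r) lang \<Rightarrow> 'k rel \<Rightarrow> ('s, 'f, 'r, 'm) fo_struct \<Rightarrow> bool" where
  "saturated L \<kappa> \<MM> \<longleftrightarrow>
     (\<forall>A v. A \<subseteq> univ \<MM> \<and> small \<kappa> A \<longrightarrow> (\<forall>p \<in> type_space L \<MM> A {v}. \<exists>d. realizes \<MM> v p d))"

text \<open>
  ``Sufficiently saturated'': \<open>\<kappa>\<close>-saturated for an uncountable cardinal \<open>\<kappa>\<close> larger than the number
  of sorts and symbols of the language.
\<close>

definition monster ::
  "('s, 'f, 'r) lang \<Rightarrow> 'k rel \<Rightarrow> ('s, 'f, 'r, 'm) fo_struct \<Rightarrow> bool" where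
  "monster L \<kappa> \<MM> \<longleftrightarrow>
     fo_structure L \<MM> \<and> Card_order \<kappa> \<and> natLeq <o \<kappa> \<and> |UNIV :: 's set| <o \<kappa> \<and>
     |dom (funs L)| <o \<kappa> \<and> |dom (rels L)| <o \<kappa> \<and> saturated L \<kappa> \<MM>"

text \<open>The group lives on the sort of the variable \<open>x\<close>, with multiplication symbol \<open>mul\<close>.\<close>

definition group_on :: "'f \<Rightarrow> 's var \<Rightarrow> ('s, 'f, 'r, 'm) fo_struct \<Rightarrow> bool" where
  "group_on mul x \<MM> \<longleftrightarrow>
     (\<exists>e. group \<lparr>carrier = sort_univ \<MM> (fst x), monoid.mult = (\<lambda>a b. fint \<MM> mul [a, b]), one = e\<rparr>)"

definition expands_group ::
  "('s, 'f, 'r) lang \<Rightarrow> 'f \<Rightarrow> 's var \<Rightarrow> ('s, 'f, 'r, 'm) fm set \<Rightarrow> bool" where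
  "expands_group L mul x T \<longleftrightarrow>
     funs L mul = Some ([fst x, fst x], fst x) \<and>
     (\<forall>\<MM> :: ('s, 'f, 'r, 'm) fo_struct. model L T \<MM> \<longrightarrow> group_on mul x \<MM>)"

definition invariant ::
  "('s, 'f, 'r) lang \<Rightarrow> ('s, 'f, 'r, 'm) fo_struct \<Rightarrow> 's var \<Rightarrow> 'm set \<Rightarrow> ('s, 'f, 'r, 'm) fm set \<Rightarrow> bool"
  where "invariant L \<MM> x M p \<longleftrightarrow>
     (\<forall>Y b b'. \<forall>\<phi> \<in> formulas L \<MM> {} (insert x Y).
        finite Y \<and> x \<notin> Y \<and> assigns \<MM> Y b \<and> assigns \<MM> Y b' \<and> tp L \<MM> M Y b = tp L \<MM> M Y b'
        \<longrightarrow> (inst Y b \<phi> \<in> p \<longleftrightarrow> inst Y b' \<phi> \<in> p))"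

text \<open>
  The product of types invariant over a small model: here \<open>\<HH>\<close> is a larger monster model, and \<open>p'\<close>
  is the invariant extension of \<open>p\<close> to it. The resulting type does not depend on \<open>M\<close>, \<open>a\<close>, \<open>b\<close>.
\<close>

definition type_prod ::
  "('s, 'f, 'r) lang \<Rightarrow> 'f \<Rightarrow> 's var \<Rightarrow> 'k rel \<Rightarrow> ('s, 'f, 'r, 'm) fo_struct \<Rightarrow> ('s, 'f, 'r, 'm) fo_struct
     \<Rightarrow> ('s, 'f, 'r, 'm) fm set \<Rightarrow> ('s, 'f, 'r, 'm) fm set \<Rightarrow> ('s, 'f, 'r, 'm) fm set" where
  "type_prod L mul x \<kappa> \<GG> \<HH> p q =
     (THE r. \<exists>M p' a b.
        submodel L \<GG> M \<and> small \<kappa> M \<and> invariant L \<GG> x M p \<and> invariant L \<GG> x M q \<and>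
        p' \<in> type_space L \<HH> (univ \<HH>) {x} \<and> p \<subseteq> p' \<and> invariant L \<HH> x M p' \<and>
        realizes \<HH> x q b \<and> realizes \<HH> x (p' \<inter> formulas L \<HH> (insert b (univ \<GG>)) {x}) a \<and>
        r = tp L \<HH> (univ \<GG>) {x} (\<lambda>_. fint \<HH> mul [a, b]))"

section \<open>Keisler measures\<close>

text \<open>
  A measure on the algebra of formulas up to equivalence is a function on formulas that respects
  equivalence. Only the values on \<open>formulas L \<GG> A {x}\<close> matter, so the restriction of \<open>\<mu>\<close> to a smaller
  parameter set is represented by \<open>\<mu>\<close> itself.
\<close>

definition keisler ::
  "('s, 'f, 'r) lang \<Rightarrow> ('s, 'f, 'r, 'm) fo_struct \<Rightarrow> 's var \<Rightarrow> 'm set \<Rightarrow> (('s, 'f, 'r, 'm) fm \<Rightarrow> real)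
     \<Rightarrow> bool" where
  "keisler L \<GG> x A \<mu> \<longleftrightarrow>
     (\<forall>\<phi> \<in> formulas L \<GG> A {x}. 0 \<le> \<mu> \<phi>) \<and>
     \<mu> (Neg Fls) = 1 \<and>
     (\<forall>\<phi> \<in> formulas L \<GG> A {x}. \<forall>\<psi> \<in> formulas L \<GG> A {x}.
        (\<forall>b. assigns \<GG> {x} b \<longrightarrow> (sat \<GG> b \<phi> \<longleftrightarrow> sat \<GG> b \<psi>)) \<longrightarrow> \<mu> \<phi> = \<mu> \<psi>) \<and>
     (\<forall>\<phi> \<in> formulas L \<GG> A {x}. \<forall>\<psi> \<in> formulas L \<GG> A {x}.
        (\<forall>b. assigns \<GG> {x} b \<longrightarrow> \<not> (sat \<GG> b \<phi> \<and> sat \<GG> b \<psi>)) \<longrightarrow> \<mu> (Disj \<phi> \<psi>) = \<mu> \<phi> + \<mu> \<psi>)"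

definition support ::
  "('s, 'f, 'r) lang \<Rightarrow> ('s, 'f, 'r, 'm) fo_struct \<Rightarrow> 's var \<Rightarrow> 'm set \<Rightarrow> (('s, 'f, 'r, 'm) fm \<Rightarrow> real)
     \<Rightarrow> ('s, 'f, 'r, 'm) fm set set" where
  "support L \<GG> x A \<mu> = {p \<in> type_space L \<GG> A {x}. \<forall>\<phi> \<in> p. \<mu> \<phi> > 0}"

definition borel_of :: "'a topology \<Rightarrow> 'a measure" where
  "borel_of X = sigma (topspace X) {U. openin X U}"

definition regular_borel_prob :: "'a topology \<Rightarrow> 'a measure \<Rightarrow> bool" where
  "regular_borel_prob X m \<longleftrightarrow>
     sets m = sets (borel_of X) \<and> emeasure m (space m) = 1 \<and>
     (\<forall>B \<in> sets m.
        emeasure m B = (INF U \<in> {U. openin X U \<and> B \<subseteq> U}. emeasure m U) \<and>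
        emeasure m B = (SUP K \<in> {K. compactin X K \<and> K \<subseteq> B}. emeasure m K))"

definition type_measure ::
  "('s, 'f, 'r) lang \<Rightarrow> ('s, 'f, 'r, 'm) fo_struct \<Rightarrow> 's var \<Rightarrow> 'm set \<Rightarrow> (('s, 'f, 'r, 'm) fm \<Rightarrow> real)
     \<Rightarrow> ('s, 'f, 'r, 'm) fm set measure" where
  "type_measure L \<GG> x A \<mu> =
     (THE m. regular_borel_prob (type_top L \<GG> A {x}) m \<and>
        (\<forall>\<phi> \<in> formulas L \<GG> A {x}. measure m {p \<in> type_space L \<GG> A {x}. \<phi> \<in> p} = \<mu> \<phi>))"

text \<open>
  The map \<open>tp(b/M) \<mapsto> \<mu>(\<phi>(x; b))\<close> is well defined and continuous. It is defined on all of the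
  type space because, by saturation, every type over \<open>M\<close> in finitely many variables is realized.
\<close>

definition definable ::
  "('s, 'f, 'r) lang \<Rightarrow> 's var \<Rightarrow> 'k rel \<Rightarrow> ('s, 'f, 'r, 'm) fo_struct \<Rightarrow> (('s, 'f, 'r, 'm) fm \<Rightarrow> real)
     \<Rightarrow> bool" where
  "definable L x \<kappa> \<GG> \<mu> \<longleftrightarrow>
     (\<exists>M. submodel L \<GG> M \<and> small \<kappa> M \<and>
        (\<forall>Y. finite Y \<and> x \<notin> Y \<longrightarrow> (\<forall>\<phi> \<in> formulas L \<GG> M (insert x Y).
           \<exists>f. continuous_map (type_top L \<GG> M Y) (top_of_set {0..1}) f \<and>
               (\<forall>b. assigns \<GG> Y b \<longrightarrow> \<mu> (inst Y b \<phi>) = f (tp L \<GG> M Y b)))))"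

definition invariantly_supported ::
  "('s, 'f, 'r) lang \<Rightarrow> 's var \<Rightarrow> 'k rel \<Rightarrow> ('s, 'f, 'r, 'm) fo_struct \<Rightarrow> (('s, 'f, 'r, 'm) fm \<Rightarrow> real)
     \<Rightarrow> bool" where
  "invariantly_supported L x \<kappa> \<GG> \<mu> \<longleftrightarrow>
     (\<exists>M. submodel L \<GG> M \<and> small \<kappa> M \<and>
        (\<forall>p \<in> support L \<GG> x (univ \<GG>) \<mu>. invariant L \<GG> x M p))"

section \<open>Convolution\<close>

text \<open>
  The integrand \<open>F(q) = \<mu>(\<phi>(x \<cdot> d))\<close>, where \<open>d\<close> realizes \<open>q\<close> in \<open>\<GG>\<close>. Since \<open>d\<close> is substituted as a
  parameter, the variable of \<open>q\<close> plays no role and may again be \<open>x\<close> rather than a copy \<open>y\<close> of it.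
\<close>

definition conv_integrand ::
  "'f \<Rightarrow> 's var \<Rightarrow> ('s, 'f, 'r, 'm) fo_struct \<Rightarrow> (('s, 'f, 'r, 'm) fm \<Rightarrow> real) \<Rightarrow> ('s, 'f, 'r, 'm) fm
     \<Rightarrow> ('s, 'f, 'r, 'm) fm set \<Rightarrow> real" where
  "conv_integrand mul x \<GG> \<mu> \<phi> q = \<mu> (translate mul x (SOME d. realizes \<GG> x q d) \<phi>)"

definition conv_base ::
  "('s, 'f, 'r) lang \<Rightarrow> 'f \<Rightarrow> 's var \<Rightarrow> 'k rel \<Rightarrow> ('s, 'f, 'r, 'm) fo_struct
     \<Rightarrow> (('s, 'f, 'r, 'm) fm \<Rightarrow> real) \<Rightarrow> (('s, 'f, 'r, 'm) fm \<Rightarrow> real) \<Rightarrow> ('s, 'f, 'r, 'm) fm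
     \<Rightarrow> 'm set \<Rightarrow> bool" where
  "conv_base L mul x \<kappa> \<GG> \<mu> \<nu> \<phi> N \<longleftrightarrow>
     submodel L \<GG> N \<and> small \<kappa> N \<and> params \<phi> \<subseteq> N \<and>
     (\<forall>q \<in> support L \<GG> x N \<nu>. \<forall>d d'. realizes \<GG> x q d \<and> realizes \<GG> x q d'
        \<longrightarrow> \<mu> (translate mul x d \<phi>) = \<mu> (translate mul x d' \<phi>)) \<and>
     conv_integrand mul x \<GG> \<mu> \<phi>
       \<in> borel_measurable (borel_of (subtopology (type_top L \<GG> N {x}) (support L \<GG> x N \<nu>)))"

definition star_Borel ::
  "('s, 'f, 'r) lang \<Rightarrow> 'f \<Rightarrow> 's var \<Rightarrow> 'k rel \<Rightarrow> ('s, 'f, 'r, 'm) fo_struct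
     \<Rightarrow> (('s, 'f, 'r, 'm) fm \<Rightarrow> real) \<Rightarrow> (('s, 'f, 'r, 'm) fm \<Rightarrow> real) \<Rightarrow> bool" where
  "star_Borel L mul x \<kappa> \<GG> \<mu> \<nu> \<longleftrightarrow>
     (\<forall>\<phi> \<in> formulas L \<GG> (univ \<GG>) {x}. \<exists>N. conv_base L mul x \<kappa> \<GG> \<mu> \<nu> \<phi> N)"

text \<open>The value of the integral does not depend on the choice of \<open>N\<close>.\<close>

definition convolution ::
  "('s, 'f, 'r) lang \<Rightarrow> 'f \<Rightarrow> 's var \<Rightarrow> 'k rel \<Rightarrow> ('s, 'f, 'r, 'm) fo_struct
     \<Rightarrow> (('s, 'f, 'r, 'm) fm \<Rightarrow> real) \<Rightarrow> (('s, 'f, 'r, 'm) fm \<Rightarrow> real) \<Rightarrow> ('s, 'f, 'r, 'm) fm \<Rightarrow> real"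
  where "convolution L mul x \<kappa> \<GG> \<mu> \<nu> \<phi> =
     (let N = (SOME N. conv_base L mul x \<kappa> \<GG> \<mu> \<nu> \<phi> N)
      in \<integral>q. conv_integrand mul x \<GG> \<mu> \<phi> q
           \<partial>(restrict_space (type_measure L \<GG> x N \<nu>) (support L \<GG> x N \<nu>)))"

definition star_idempotent ::
  "('s, 'f, 'r) lang \<Rightarrow> 'f \<Rightarrow> 's var \<Rightarrow> 'k rel \<Rightarrow> ('s, 'f, 'r, 'm) fo_struct
     \<Rightarrow> (('s, 'f, 'r, 'm) fm \<Rightarrow> real) \<Rightarrow> bool" where
  "star_idempotent L mul x \<kappa> \<GG> \<mu> \<longleftrightarrow>
     star_Borel L mul x \<kappa> \<GG> \<mu> \<mu> \<and>
     (\<forall>\<phi> \<in> formulas L \<GG> (univ \<GG>) {x}. convolution L mul x \<kappa> \<GG> \<mu> \<mu> \<phi> = \<mu> \<phi>)"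

end

theory Submission
  imports Defs
begin

text \<open>
  Membership in a product of types can be decided inside \<open>\<GG>\<close>. Let \<open>p\<close> and \<open>q\<close> be invariant over a small
  model \<open>M\<close>, and let \<open>d\<close> be an element of \<open>\<GG>\<close> that realizes \<open>q\<close> over \<open>M\<close> and the parameters of \<open>\<phi>\<close>.
  Then \<open>\<phi>\<close> belongs to \<open>p * q\<close> iff \<open>\<phi>(x \<cdot> d)\<close> belongs to \<open>p\<close> (\<open>product_iff\<close>). Everything about the
  product follows from this equivalence.

  \<^item> Since \<open>d\<close> depends on \<open>q\<close> and \<open>\<phi>\<close> but not on \<open>p\<close>, the preimage of a basic clopen set under
    \<open>p \<mapsto> p * q\<close> is again a basic clopen set (\<open>product_left_continuous\<close>).

  \<^item> If \<open>d\<close> realizes \<open>r\<close>, and \<open>e\<close> realizes \<open>q\<close> over a set containing \<open>d\<close>, then \<open>e \<cdot> d\<close> realizes \<open>q * r\<close>.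
    Hence \<open>(p * q) * r\<close> and \<open>p * (q * r)\<close> both ask whether \<open>\<phi>(x \<cdot> e \<cdot> d)\<close> belongs to \<open>p\<close>
    (\<open>product_assoc\<close>).

  \<^item> Let \<open>p\<close> and \<open>q\<close> be in the support of \<open>\<mu>\<close>, and let \<open>\<phi>\<close> belong to \<open>p * q\<close>. Then \<open>\<mu>(\<phi>(x \<cdot> d)) > 0\<close>,
    so the integrand that defines \<open>(\<mu> * \<mu>)(\<phi>)\<close> is positive at the restriction of \<open>q\<close>. As \<open>\<mu>\<close> is
    definable, the integrand stays above a positive constant near that point (\<open>integrand_nbhd\<close>),
    on a set of positive measure because the point lies in the support. Therefore
    \<open>\<mu>(\<phi>) = (\<mu> * \<mu>)(\<phi>) > 0\<close>, and \<open>p * q\<close> is in the support (\<open>support_closed_under_product\<close>).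

  The support is closed in a Stone space, hence compact Hausdorff. Invariant support provides one
  model \<open>M\<close> over which all types in the support, and so all their products, are invariant.

  Two objects in these arguments have to be constructed. The first is the invariant extension of \<open>p\<close>
  to \<open>\<HH>\<close>: finitely many parameters of \<open>\<HH>\<close> are moved into \<open>\<GG>\<close> by a partial elementary map over \<open>M\<close>,
  and invariance of \<open>p\<close> makes the choice of the map irrelevant (\<open>inv_ext_iff\<close>). The second is the
  regular Borel measure attached to a Keisler measure (\<open>regular_extension_unique\<close>), without which
  the integral has no meaning.
\<close>


section \<open>Substitution, renaming of parameters, and their semantics\<close>

text \<open>
  Terms contain no binders, so a single simultaneous substitution covers replacing variables,
  replacing parameters by terms, and renaming parameters.
\<close>

primrec tm_gsubst ::
  "('s var \<Rightarrow> ('s, 'f, 'm) tm) \<Rightarrow> ('m \<Rightarrow> ('s, 'f, 'm) tm) \<Rightarrow> ('s, 'f, 'm) tm \<Rightarrow> ('s, 'f, 'm) tm" where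
  "tm_gsubst \<theta> \<pi> (Var v) = \<theta> v"
| "tm_gsubst \<theta> \<pi> (Par a) = \<pi> a"
| "tm_gsubst \<theta> \<pi> (Fn f ts) = Fn f (map (tm_gsubst \<theta> \<pi>) ts)"

abbreviation ren_tm :: "('m \<Rightarrow> 'm) \<Rightarrow> ('s, 'f, 'm) tm \<Rightarrow> ('s, 'f, 'm) tm" where
  "ren_tm \<sigma> \<equiv> tm_gsubst Var (\<lambda>a. Par (\<sigma> a))"

primrec ren :: "('m \<Rightarrow> 'm) \<Rightarrow> ('s, 'f, 'r, 'm) fm \<Rightarrow> ('s, 'f, 'r, 'm) fm" where
  "ren \<sigma> Fls = Fls"
| "ren \<sigma> (Eq t u) = Eq (ren_tm \<sigma> t) (ren_tm \<sigma> u)"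
| "ren \<sigma> (Rel r ts) = Rel r (map (ren_tm \<sigma>) ts)"
| "ren \<sigma> (Neg \<phi>) = Neg (ren \<sigma> \<phi>)"
| "ren \<sigma> (Conj \<phi> \<psi>) = Conj (ren \<sigma> \<phi>) (ren \<sigma> \<psi>)"
| "ren \<sigma> (Ex v \<phi>) = Ex v (ren \<sigma> \<phi>)"

lemma finite_tm_vars [simp]: "finite (tm_vars t)"
  by (induction t) auto

lemma finite_tm_params [simp]: "finite (tm_params t)"
  by (induction t) auto

lemma finite_free_vars [simp]: "finite (free_vars \<phi>)"
  by (induction \<phi>) auto

lemma finite_params [simp]: "finite (params \<phi>)"
  by (induction \<phi>) auto

lemma tm_subst_eq_gsubst: "tm_subst \<theta> t = tm_gsubst \<theta> Par t"
  by (induction t) auto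

lemma tm_vars_gsubst:
  "tm_vars (tm_gsubst \<theta> \<pi> t) = (\<Union>v\<in>tm_vars t. tm_vars (\<theta> v)) \<union> (\<Union>a\<in>tm_params t. tm_vars (\<pi> a))"
  by (induction t) auto

lemma tm_params_gsubst:
  "tm_params (tm_gsubst \<theta> \<pi> t) = (\<Union>v\<in>tm_vars t. tm_params (\<theta> v)) \<union> (\<Union>a\<in>tm_params t. tm_params (\<pi> a))"
  by (induction t) auto

lemma tm_gsubst_cong:
  assumes "\<And>v. v \<in> tm_vars t \<Longrightarrow> \<theta> v = \<theta>' v" "\<And>a. a \<in> tm_params t \<Longrightarrow> \<pi> a = \<pi>' a"
  shows "tm_gsubst \<theta> \<pi> t = tm_gsubst \<theta>' \<pi>' t"
  using assms by (induction t) (simp_all, blast)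

lemma tm_gsubst_gsubst:
  "tm_gsubst \<theta>' \<pi>' (tm_gsubst \<theta> \<pi> t)
     = tm_gsubst (\<lambda>v. tm_gsubst \<theta>' \<pi>' (\<theta> v)) (\<lambda>a. tm_gsubst \<theta>' \<pi>' (\<pi> a)) t"
  by (induction t) auto

lemma tm_gsubst_id [simp]: "tm_gsubst Var Par t = t"
  by (induction t) (auto intro: map_idI)

text \<open>
  A parameter denotes itself. Replacing parameters by terms therefore amounts, semantically, to
  renaming them to the values of these terms.
\<close>

lemma eval_gsubst:
  "eval \<MM> \<rho> (tm_gsubst \<theta> \<pi> t) = eval \<MM> (\<lambda>u. eval \<MM> \<rho> (\<theta> u)) (ren_tm (\<lambda>a. eval \<MM> \<rho> (\<pi> a)) t)"
proof (induction t)
  case (Fn f ts)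
  then have "map (eval \<MM> \<rho> \<circ> tm_gsubst \<theta> \<pi>) ts =
    map (eval \<MM> (\<lambda>u. eval \<MM> \<rho> (\<theta> u)) \<circ> ren_tm (\<lambda>a. eval \<MM> \<rho> (\<pi> a))) ts"
    by (intro map_cong) auto
  then show ?case by (simp del: map_eq_conv)
qed auto

lemma eval_ren_gsubst:
  "eval \<MM> \<rho> (ren_tm \<sigma> (tm_gsubst \<theta> \<pi> t))
     = eval \<MM> (\<lambda>u. eval \<MM> \<rho> (ren_tm \<sigma> (\<theta> u))) (ren_tm (\<lambda>a. eval \<MM> \<rho> (ren_tm \<sigma> (\<pi> a))) t)"
  unfolding tm_gsubst_gsubst by (rule eval_gsubst)

lemma eval_subst: "eval \<MM> \<rho> (tm_subst \<theta> t) = eval \<MM> (\<lambda>u. eval \<MM> \<rho> (\<theta> u)) t"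
  unfolding tm_subst_eq_gsubst by (subst eval_gsubst) simp

lemma eval_cong:
  assumes "\<And>v. v \<in> tm_vars t \<Longrightarrow> \<rho> v = \<rho>' v"
  shows "eval \<MM> \<rho> t = eval \<MM> \<rho>' t"
  using assms
proof (induction t)
  case (Fn f ts)
  then have "map (eval \<MM> \<rho>) ts = map (eval \<MM> \<rho>') ts"
    by (intro map_cong) auto
  then show ?case by (simp del: map_eq_conv)
qed auto

lemma sat_cong:
  assumes "\<And>v. v \<in> free_vars \<phi> \<Longrightarrow> \<rho> v = \<rho>' v"
  shows "sat \<MM> \<rho> \<phi> = sat \<MM> \<rho>' \<phi>"
  using assms
proof (induction \<phi> arbitrary: \<rho> \<rho>')
  case (Eq t u)
  then have "eval \<MM> \<rho> t = eval \<MM> \<rho>' t" "eval \<MM> \<rho> u = eval \<MM> \<rho>' u"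
    by (auto intro!: eval_cong)
  then show ?case by simp
next
  case (Rel r ts)
  then have "map (eval \<MM> \<rho>) ts = map (eval \<MM> \<rho>') ts"
    by (intro map_cong eval_cong) auto
  then show ?case by (simp del: map_eq_conv)
next
  case (Conj \<phi> \<psi>)
  have "sat \<MM> \<rho> \<phi> = sat \<MM> \<rho>' \<phi>" "sat \<MM> \<rho> \<psi> = sat \<MM> \<rho>' \<psi>"
    by (rule Conj.IH; use Conj.prems in auto)+
  then show ?case by simp
next
  case (Ex v \<phi>)
  have "sat \<MM> (\<rho>(v := a)) \<phi> = sat \<MM> (\<rho>'(v := a)) \<phi>" for a
    using Ex.prems by (intro Ex.IH) auto
  then show ?case by simp
next
  case (Neg \<phi>)
  then show ?case by (metis free_vars.simps(4) sat.simps(4))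
qed auto

lemma sat_sentence:
  assumes "free_vars \<phi> = {}"
  shows "sat \<MM> \<rho> \<phi> = sat \<MM> \<rho>' \<phi>"
  using assms by (intro sat_cong) auto

lemma params_ren: "params (ren \<sigma> \<phi>) = \<sigma> ` params \<phi>"
  by (induction \<phi>) (auto simp: tm_params_gsubst image_Un image_UN)

lemma free_vars_ren [simp]: "free_vars (ren \<sigma> \<phi>) = free_vars \<phi>"
  by (induction \<phi>) (auto simp: tm_vars_gsubst)

lemma ren_cong:
  assumes "\<And>a. a \<in> params \<phi> \<Longrightarrow> \<sigma> a = \<sigma>' a"
  shows "ren \<sigma> \<phi> = ren \<sigma>' \<phi>"
  using assms by (induction \<phi>) (auto intro!: tm_gsubst_cong)

lemma ren_ident:
  assumes "\<And>a. a \<in> params \<phi> \<Longrightarrow> \<sigma> a = a"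
  shows "ren \<sigma> \<phi> = \<phi>"
proof -
  have "ren (\<lambda>a. a) \<phi> = \<phi>"
    by (induction \<phi>) (auto intro: map_idI)
  then show ?thesis using ren_cong[of \<phi> \<sigma> "\<lambda>a. a"] assms by simp
qed

lemma ren_ren: "ren \<sigma> (ren \<tau> \<phi>) = ren (\<lambda>a. \<sigma> (\<tau> a)) \<phi>"
  by (induction \<phi>) (auto simp: tm_gsubst_gsubst)

lemma has_sort_gsubst:
  assumes "has_sort L \<MM> t s"
    and "\<And>v. v \<in> tm_vars t \<Longrightarrow> has_sort L \<NN> (\<theta> v) (fst v)"
    and "\<And>a. a \<in> tm_params t \<Longrightarrow> has_sort L \<NN> (\<pi> a) (srt \<MM> a)"
  shows "has_sort L \<NN> (tm_gsubst \<theta> \<pi> t) s"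
  using assms
proof (induction rule: has_sort.induct)
  case (3 f ss s ts)
  have "list_all2 (has_sort L \<NN>) (map (tm_gsubst \<theta> \<pi>) ts) ss"
    unfolding list_all2_map1
  proof (rule list_all2_all_nthI)
    show "length ts = length ss" using 3(2) by (simp add: list_all2_conv_all_nth)
    fix i assume i: "i < length ts"
    then have "ts ! i \<in> set ts" by simp
    have "has_sort L \<NN> (tm_gsubst \<theta> \<pi> (ts ! i)) (ss ! i)"
      if "\<And>v. v \<in> tm_vars (ts ! i) \<Longrightarrow> has_sort L \<NN> (\<theta> v) (fst v)"
        "\<And>a. a \<in> tm_params (ts ! i) \<Longrightarrow> has_sort L \<NN> (\<pi> a) (srt \<MM> a)"
      using list_all2_nthD[OF 3(2) i] that by blast
    then show "has_sort L \<NN> (tm_gsubst \<theta> \<pi> (ts ! i)) (ss ! i)"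
      using \<open>ts ! i \<in> set ts\<close> 3(3,4) by simp blast
  qed
  then show ?case using 3(1) by (auto intro: has_sort.intros)
qed auto

lemma has_sort_Var [intro]: "s = fst v \<Longrightarrow> has_sort L \<MM> (Var v) s"
  and has_sort_Par [intro]: "s = srt \<MM> a \<Longrightarrow> has_sort L \<MM> (Par a) s"
  by (auto intro: has_sort.intros)

text \<open>
  Capture-free substitution only matters up to equivalence, so it is not defined as a function:
  induction on the formula produces a suitable formula, with a fresh bound variable in the
  quantifier step. The semantic equation holds in all structures at once and is stable under
  renaming the parameters of the result; this uniformity is what allows formulas to be carried
  between a structure and an elementary extension.
\<close>

lemma capture_free_substitution:
  fixes L :: "('s, 'f, 'r) lang" and \<phi> :: "('s, 'f, 'r, 'm) fm"
  assumes "wf_fm L \<MM> \<phi>"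
    and \<theta>: "\<And>v. v \<in> free_vars \<phi> \<Longrightarrow>
      has_sort L \<NN> (\<theta> v) (fst v) \<and> tm_params (\<theta> v) \<subseteq> P \<and> tm_vars (\<theta> v) \<subseteq> V"
    and \<pi>: "\<And>a. a \<in> params \<phi> \<Longrightarrow>
      has_sort L \<NN> (\<pi> a) (srt \<MM> a) \<and> tm_params (\<pi> a) \<subseteq> P \<and> tm_vars (\<pi> a) \<subseteq> V"
  obtains \<phi>' where "\<phi>' \<in> formulas L \<NN> P V"
    "\<And>(\<AA> :: ('s, 'f, 'r, 'm) fo_struct) \<sigma> \<rho>. sat \<AA> \<rho> (ren \<sigma> \<phi>') \<longleftrightarrow>
       sat \<AA> (\<lambda>u. eval \<AA> \<rho> (ren_tm \<sigma> (\<theta> u))) (ren (\<lambda>a. eval \<AA> \<rho> (ren_tm \<sigma> (\<pi> a))) \<phi>)"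
proof -
  define Ps where "Ps \<theta> \<phi> = (\<Union>v\<in>free_vars \<phi>. tm_params (\<theta> v)) \<union> (\<Union>a\<in>params \<phi>. tm_params (\<pi> a))"
    for \<theta> :: "'s var \<Rightarrow> ('s, 'f, 'm) tm" and \<phi> :: "('s, 'f, 'r, 'm) fm"
  define Vs where "Vs \<theta> \<phi> = (\<Union>v\<in>free_vars \<phi>. tm_vars (\<theta> v)) \<union> (\<Union>a\<in>params \<phi>. tm_vars (\<pi> a))"
    for \<theta> :: "'s var \<Rightarrow> ('s, 'f, 'm) tm" and \<phi> :: "('s, 'f, 'r, 'm) fm"
  define good where "good \<theta> \<phi> \<phi>' \<longleftrightarrow> wf_fm L \<NN> \<phi>' \<and> params \<phi>' \<subseteq> Ps \<theta> \<phi> \<and> free_vars \<phi>' \<subseteq> Vs \<theta> \<phi> \<and>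
    (\<forall>(\<AA> :: ('s, 'f, 'r, 'm) fo_struct) \<sigma> \<rho>. sat \<AA> \<rho> (ren \<sigma> \<phi>') \<longleftrightarrow>
       sat \<AA> (\<lambda>u. eval \<AA> \<rho> (ren_tm \<sigma> (\<theta> u))) (ren (\<lambda>a. eval \<AA> \<rho> (ren_tm \<sigma> (\<pi> a))) \<phi>))"
    for \<theta> and \<phi> \<phi>' :: "('s, 'f, 'r, 'm) fm"
  have "\<exists>\<phi>'. good \<theta> \<phi> \<phi>'"
    using assms(1) conjunct1[OF \<theta>] conjunct1[OF \<pi>]
  proof (induction \<phi> arbitrary: \<theta>)
    case Fls
    show ?case by (rule exI[of _ Fls]) (simp add: good_def)
  next
    case (Eq t u)
    then obtain s where "has_sort L \<MM> t s" "has_sort L \<MM> u s" by auto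
    then have "has_sort L \<NN> (tm_gsubst \<theta> \<pi> t) s" "has_sort L \<NN> (tm_gsubst \<theta> \<pi> u) s"
      using Eq.prems(2,3) by (auto intro!: has_sort_gsubst[of L \<MM>])
    then show ?case
      by (intro exI[of _ "Eq (tm_gsubst \<theta> \<pi> t) (tm_gsubst \<theta> \<pi> u)"])
        (auto simp: good_def Ps_def Vs_def tm_params_gsubst tm_vars_gsubst eval_ren_gsubst)
  next
    case (Rel r ts)
    then obtain ss where ss: "rels L r = Some ss" "list_all2 (has_sort L \<MM>) ts ss" by auto
    have "list_all2 (has_sort L \<NN>) (map (tm_gsubst \<theta> \<pi>) ts) ss"
      unfolding list_all2_map1
    proof (rule list_all2_all_nthI)
      show "length ts = length ss" using ss(2) by (simp add: list_all2_conv_all_nth)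
      fix i assume i: "i < length ts"
      then have "ts ! i \<in> set ts" by simp
      show "has_sort L \<NN> (tm_gsubst \<theta> \<pi> (ts ! i)) (ss ! i)"
      proof (rule has_sort_gsubst)
        show "has_sort L \<MM> (ts ! i) (ss ! i)"
          using ss(2) i by (simp add: list_all2_conv_all_nth)
      qed (use Rel(2,3) \<open>ts ! i \<in> set ts\<close> in \<open>simp, blast\<close>)+
    qed
    moreover have "map (eval \<AA> \<rho>) (map (ren_tm \<sigma>) (map (tm_gsubst \<theta> \<pi>) ts)) =
      map (eval \<AA> (\<lambda>u. eval \<AA> \<rho> (ren_tm \<sigma> (\<theta> u)))) (map (ren_tm (\<lambda>a. eval \<AA> \<rho> (ren_tm \<sigma> (\<pi> a)))) ts)"
      for \<AA> :: "('s, 'f, 'r, 'm) fo_struct" and \<sigma> \<rho>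
      by (simp add: eval_ren_gsubst)
    ultimately show ?case
      using ss by (intro exI[of _ "Rel r (map (tm_gsubst \<theta> \<pi>) ts)"])
        (auto simp: good_def Ps_def Vs_def tm_params_gsubst tm_vars_gsubst simp del: map_map map_eq_conv)
  next
    case (Neg \<phi>)
    have "\<exists>\<phi>'. good \<theta> \<phi> \<phi>'"
      by (rule Neg.IH) (use Neg.prems in simp_all)
    then obtain \<phi>' where "good \<theta> \<phi> \<phi>'" ..
    moreover have "Ps \<theta> (Neg \<phi>) = Ps \<theta> \<phi>" "Vs \<theta> (Neg \<phi>) = Vs \<theta> \<phi>" by (simp_all add: Ps_def Vs_def)
    ultimately show ?case by (intro exI[of _ "Neg \<phi>'"]) (simp add: good_def)
  next
    case (Conj \<phi> \<psi>)
    have "\<exists>\<phi>'. good \<theta> \<phi> \<phi>'"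
      by (rule Conj.IH(1)) (use Conj.prems in simp_all)
    then obtain \<phi>' where 1: "good \<theta> \<phi> \<phi>'" ..
    have "\<exists>\<phi>'. good \<theta> \<psi> \<phi>'"
      by (rule Conj.IH(2)) (use Conj.prems in simp_all)
    then obtain \<psi>' where 2: "good \<theta> \<psi> \<psi>'" ..
    have "Ps \<theta> (Conj \<phi> \<psi>) = Ps \<theta> \<phi> \<union> Ps \<theta> \<psi>" "Vs \<theta> (Conj \<phi> \<psi>) = Vs \<theta> \<phi> \<union> Vs \<theta> \<psi>"
      unfolding Ps_def Vs_def by auto
    then show ?case using 1 2 by (intro exI[of _ "Conj \<phi>' \<psi>'"]) (simp add: good_def le_supI1 le_supI2)
  next
    case (Ex v \<phi>)
    \<comment> \<open>The bound variable is renamed to one that no substituted term mentions.\<close>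
    define B where "B = (\<Union>u\<in>free_vars \<phi>. tm_vars (\<theta> u)) \<union> (\<Union>a\<in>params \<phi>. tm_vars (\<pi> a))"
    have "finite (snd ` B)" by (simp add: B_def)
    then obtain n where n: "n \<notin> snd ` B" using ex_new_if_finite infinite_UNIV_nat by blast
    define w where "w = (fst v, n)"
    have w: "w \<notin> B" "fst w = fst v" using n by (auto simp: w_def image_iff)
    define \<theta>' where "\<theta>' = \<theta>(v := Var w)"
    have "\<exists>\<phi>'. good \<theta>' \<phi> \<phi>'"
    proof (rule Ex.IH)
      show "has_sort L \<NN> (\<theta>' u) (fst u)" if "u \<in> free_vars \<phi>" for u
        using Ex.prems(2)[of u] that w(2) by (cases "u = v") (simp_all add: \<theta>'_def has_sort_Var)
    qed (use Ex.prems in simp_all)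
    then obtain \<phi>' where \<phi>': "good \<theta>' \<phi> \<phi>'" ..
    then have wf: "wf_fm L \<NN> \<phi>'" and sub: "params \<phi>' \<subseteq> Ps \<theta>' \<phi>" "free_vars \<phi>' \<subseteq> Vs \<theta>' \<phi>"
      by (simp_all only: good_def)
    from \<phi>' have sem: "sat \<AA> \<rho> (ren \<sigma> \<phi>') \<longleftrightarrow>
        sat \<AA> (\<lambda>u. eval \<AA> \<rho> (ren_tm \<sigma> (\<theta>' u))) (ren (\<lambda>a. eval \<AA> \<rho> (ren_tm \<sigma> (\<pi> a))) \<phi>)"
      for \<AA> :: "('s, 'f, 'r, 'm) fo_struct" and \<sigma> \<rho>
      by (simp only: good_def)
    have "sat \<AA> (\<rho>(w := c)) (ren \<sigma> \<phi>') \<longleftrightarrow>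
        sat \<AA> ((\<lambda>u. eval \<AA> \<rho> (ren_tm \<sigma> (\<theta> u)))(v := c)) (ren (\<lambda>a. eval \<AA> \<rho> (ren_tm \<sigma> (\<pi> a))) \<phi>)"
      for \<AA> :: "('s, 'f, 'r, 'm) fo_struct" and \<sigma> \<rho> c
    proof -
      have 1: "ren (\<lambda>a. eval \<AA> (\<rho>(w := c)) (ren_tm \<sigma> (\<pi> a))) \<phi> = ren (\<lambda>a. eval \<AA> \<rho> (ren_tm \<sigma> (\<pi> a))) \<phi>"
        using w by (intro ren_cong eval_cong) (auto simp: B_def tm_vars_gsubst)
      have 2: "eval \<AA> (\<rho>(w := c)) (ren_tm \<sigma> (\<theta>' u)) = ((\<lambda>u. eval \<AA> \<rho> (ren_tm \<sigma> (\<theta> u)))(v := c)) u"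
        if "u \<in> free_vars \<phi>" for u
      proof (cases "u = v")
        case False
        have "eval \<AA> (\<rho>(w := c)) (ren_tm \<sigma> (\<theta> u)) = eval \<AA> \<rho> (ren_tm \<sigma> (\<theta> u))"
          using w that by (intro eval_cong) (auto simp: B_def tm_vars_gsubst)
        then show ?thesis using False by (simp add: \<theta>'_def)
      qed (simp add: \<theta>'_def)
      have "sat \<AA> (\<rho>(w := c)) (ren \<sigma> \<phi>') \<longleftrightarrow> sat \<AA> (\<lambda>u. eval \<AA> (\<rho>(w := c)) (ren_tm \<sigma> (\<theta>' u)))
          (ren (\<lambda>a. eval \<AA> (\<rho>(w := c)) (ren_tm \<sigma> (\<pi> a))) \<phi>)"
        by (rule sem)
      also have "\<dots> \<longleftrightarrow> sat \<AA> ((\<lambda>u. eval \<AA> \<rho> (ren_tm \<sigma> (\<theta> u)))(v := c)) (ren (\<lambda>a. eval \<AA> \<rho> (ren_tm \<sigma> (\<pi> a))) \<phi>)"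
        unfolding 1 by (rule sat_cong) (simp only: free_vars_ren 2)
      finally show ?thesis .
    qed
    then have "sat \<AA> \<rho> (ren \<sigma> (Ex w \<phi>')) \<longleftrightarrow>
        sat \<AA> (\<lambda>u. eval \<AA> \<rho> (ren_tm \<sigma> (\<theta> u))) (ren (\<lambda>a. eval \<AA> \<rho> (ren_tm \<sigma> (\<pi> a))) (Ex v \<phi>))"
      for \<AA> :: "('s, 'f, 'r, 'm) fo_struct" and \<sigma> \<rho>
      by (simp only: ren.simps sat.simps w(2))
    moreover have "Ps \<theta>' \<phi> \<subseteq> Ps \<theta> (Ex v \<phi>)" "Vs \<theta>' \<phi> - {w} \<subseteq> Vs \<theta> (Ex v \<phi>)"
      unfolding Ps_def Vs_def \<theta>'_def by (auto split: if_splits)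
    then have "params \<phi>' \<subseteq> Ps \<theta> (Ex v \<phi>)" "free_vars \<phi>' - {w} \<subseteq> Vs \<theta> (Ex v \<phi>)"
      using sub by blast+
    ultimately show ?case
      using wf by (intro exI[of _ "Ex w \<phi>'"]) (simp only: good_def wf_fm.simps params.simps free_vars.simps simp_thms)
  qed
  then obtain \<phi>' where "good \<theta> \<phi> \<phi>'" ..
  moreover have "Ps \<theta> \<phi> \<subseteq> P" "Vs \<theta> \<phi> \<subseteq> V"
    unfolding Ps_def Vs_def using \<theta> \<pi> by (intro Un_least UN_least; simp)+
  ultimately show thesis
    by (intro that[of \<phi>']) (simp only: good_def formulas_def, blast, simp only: good_def)
qed

text \<open>
  In \<open>inst\<close> and \<open>translate\<close> the term replacing a variable \<open>u\<close> mentions no variable other than \<open>u\<close>, so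
  nothing is captured.
\<close>

lemma sat_subst:
  assumes "\<And>u. tm_vars (\<theta> u) \<subseteq> {u}"
  shows "sat \<MM> \<rho> (subst \<theta> \<phi>) = sat \<MM> (\<lambda>u. eval \<MM> \<rho> (\<theta> u)) \<phi>"
  using assms
proof (induction \<phi> arbitrary: \<theta> \<rho>)
  case (Eq t u)
  then show ?case by (simp add: eval_subst)
next
  case (Rel r ts)
  then show ?case by (simp add: eval_subst comp_def)
next
  case (Ex v \<phi>)
  have "sat \<MM> (\<rho>(v := a)) (subst (\<theta>(v := Var v)) \<phi>) = sat \<MM> ((\<lambda>u. eval \<MM> \<rho> (\<theta> u))(v := a)) \<phi>" for a
  proof -
    have "eval \<MM> (\<rho>(v := a)) ((\<theta>(v := Var v)) u) = ((\<lambda>u. eval \<MM> \<rho> (\<theta> u))(v := a)) u" for u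
    proof (cases "u = v")
      case False
      have "eval \<MM> (\<rho>(v := a)) (\<theta> u) = eval \<MM> \<rho> (\<theta> u)"
        by (rule eval_cong) (use Ex.prems[of u] False in auto)
      then show ?thesis using False by simp
    qed simp
    moreover have "sat \<MM> (\<rho>(v := a)) (subst (\<theta>(v := Var v)) \<phi>)
        = sat \<MM> (\<lambda>u. eval \<MM> (\<rho>(v := a)) ((\<theta>(v := Var v)) u)) \<phi>"
      by (rule Ex.IH) (use Ex.prems in simp)
    ultimately show ?thesis by presburger
  qed
  then show ?case by simp
qed simp_all

lemma has_sort_subst:
  assumes "has_sort L \<MM> t s" "\<And>v. has_sort L \<MM> (\<theta> v) (fst v)"
  shows "has_sort L \<MM> (tm_subst \<theta> t) s"
  unfolding tm_subst_eq_gsubst by (rule has_sort_gsubst[OF assms(1)]) (auto simp: assms(2))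

lemma wf_subst:
  assumes "wf_fm L \<MM> \<phi>" "\<And>v. has_sort L \<MM> (\<theta> v) (fst v)"
  shows "wf_fm L \<MM> (subst \<theta> \<phi>)"
  using assms
proof (induction \<phi> arbitrary: \<theta>)
  case (Eq t u)
  then obtain s where "has_sort L \<MM> t s" "has_sort L \<MM> u s" by auto
  then have "has_sort L \<MM> (tm_subst \<theta> t) s" "has_sort L \<MM> (tm_subst \<theta> u) s"
    using Eq(2) by (simp_all add: has_sort_subst)
  then show ?case by auto
next
  case (Rel r ts)
  then obtain ss where "rels L r = Some ss" "list_all2 (has_sort L \<MM>) ts ss" by auto
  moreover have "list_all2 (has_sort L \<MM>) (map (tm_subst \<theta>) ts) ss"
    unfolding list_all2_map1
    by (rule list_all2_mono[OF calculation(2)]) (rule has_sort_subst, use Rel(2) in simp_all)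
  ultimately show ?case by simp
next
  case (Ex v \<phi>)
  have "has_sort L \<MM> ((\<theta>(v := Var v)) u) (fst u)" for u
    using Ex.prems(2)[of u] by (cases "u = v") (simp_all add: has_sort_Var)
  then have "wf_fm L \<MM> (subst (\<theta>(v := Var v)) \<phi>)"
    using Ex.prems(1) by (intro Ex.IH) simp_all
  then show ?case by simp
qed simp_all

lemma params_subst: "params (subst \<theta> \<phi>) \<subseteq> params \<phi> \<union> (\<Union>v\<in>free_vars \<phi>. tm_params (\<theta> v))"
proof (induction \<phi> arbitrary: \<theta>)
  case (Eq t u)
  show ?case by (auto simp: tm_subst_eq_gsubst tm_params_gsubst)
next
  case (Rel r ts)
  show ?case by (auto simp: tm_subst_eq_gsubst tm_params_gsubst)
next
  case (Neg \<phi>)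
  show ?case using Neg.IH[of \<theta>] by simp
next
  case (Conj \<phi> \<psi>)
  show ?case unfolding subst.simps params.simps free_vars.simps
    by (intro Un_least order_trans[OF Conj.IH(1)] order_trans[OF Conj.IH(2)]) auto
next
  case (Ex v \<phi>)
  have "params (subst (\<theta>(v := Var v)) \<phi>) \<subseteq> params \<phi> \<union> (\<Union>u\<in>free_vars \<phi> - {v}. tm_params (\<theta> u))"
    using Ex.IH[of "\<theta>(v := Var v)"] by (rule order_trans) (auto split: if_splits)
  then show ?case by simp
qed simp

lemma free_vars_subst: "free_vars (subst \<theta> \<phi>) \<subseteq> (\<Union>v\<in>free_vars \<phi>. tm_vars (\<theta> v))"
proof (induction \<phi> arbitrary: \<theta>)
  case (Eq t u)
  show ?case by (auto simp: tm_subst_eq_gsubst tm_vars_gsubst)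
next
  case (Rel r ts)
  show ?case by (auto simp: tm_subst_eq_gsubst tm_vars_gsubst)
next
  case (Neg \<phi>)
  show ?case using Neg.IH[of \<theta>] by simp
next
  case (Conj \<phi> \<psi>)
  show ?case unfolding subst.simps params.simps free_vars.simps
    by (intro Un_least order_trans[OF Conj.IH(1)] order_trans[OF Conj.IH(2)]) auto
next
  case (Ex v \<phi>)
  have "free_vars (subst (\<theta>(v := Var v)) \<phi>) \<subseteq> (\<Union>u\<in>free_vars \<phi>. tm_vars ((\<theta>(v := Var v)) u))"
    by (rule Ex.IH)
  also have "\<dots> \<subseteq> insert v (\<Union>u\<in>free_vars \<phi> - {v}. tm_vars (\<theta> u))"
    by (auto split: if_splits)
  finally show ?case by auto
qed simp

lemma tm_subst_cong:
  assumes "\<forall>v\<in>tm_vars t. \<theta> v = \<theta>' v"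
  shows "tm_subst \<theta> t = tm_subst \<theta>' t"
  unfolding tm_subst_eq_gsubst by (rule tm_gsubst_cong) (use assms in blast, simp)

lemma subst_cong:
  assumes "\<forall>v\<in>free_vars \<phi>. \<theta> v = \<theta>' v"
  shows "subst \<theta> \<phi> = subst \<theta>' \<phi>"
  using assms
proof (induction \<phi> arbitrary: \<theta> \<theta>')
  case (Eq t u)
  then have "tm_subst \<theta> t = tm_subst \<theta>' t" "tm_subst \<theta> u = tm_subst \<theta>' u"
    by (auto intro!: tm_subst_cong)
  then show ?case by simp
next
  case (Rel r ts)
  then have "\<forall>t\<in>set ts. tm_subst \<theta> t = tm_subst \<theta>' t"
    by (intro ballI tm_subst_cong) auto
  then show ?case by simp
next
  case (Neg \<phi>)
  have "subst \<theta> \<phi> = subst \<theta>' \<phi>" by (rule Neg.IH) (use Neg.prems in simp)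
  then show ?case by simp
next
  case (Conj \<phi> \<psi>)
  have "subst \<theta> \<phi> = subst \<theta>' \<phi>" by (rule Conj.IH(1)) (use Conj.prems in simp)
  moreover have "subst \<theta> \<psi> = subst \<theta>' \<psi>" by (rule Conj.IH(2)) (use Conj.prems in simp)
  ultimately show ?case by simp
next
  case (Ex v \<phi>)
  have "subst (\<theta>(v := Var v)) \<phi> = subst (\<theta>'(v := Var v)) \<phi>"
    by (rule Ex.IH) (use Ex.prems in simp)
  then show ?case by simp
qed simp

lemma ren_subst: "ren \<sigma> (subst \<theta> \<phi>) = subst (\<lambda>v. ren_tm \<sigma> (\<theta> v)) (ren \<sigma> \<phi>)"
proof (induction \<phi> arbitrary: \<theta>)
  case (Ex v \<phi>)
  have "(\<lambda>u. ren_tm \<sigma> ((\<theta>(v := Var v)) u)) = (\<lambda>u. ren_tm \<sigma> (\<theta> u))(v := Var v)" by auto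
  then show ?case using Ex[of "\<theta>(v := Var v)"] by (simp del: fun_upd_apply)
qed (auto simp: tm_subst_eq_gsubst tm_gsubst_gsubst)

lemma sat_inst: "sat \<MM> \<rho> (inst Y b \<phi>) = sat \<MM> (\<lambda>v. if v \<in> Y then b v else \<rho> v) \<phi>"
  unfolding inst_def by (subst sat_subst) (auto intro!: sat_cong)

lemma ren_inst: "ren \<sigma> (inst Y b \<phi>) = inst Y (\<lambda>v. \<sigma> (b v)) (ren \<sigma> \<phi>)"
  unfolding inst_def ren_subst by (rule arg_cong[where f = "\<lambda>\<theta>. subst \<theta> (ren \<sigma> \<phi>)"]) auto

lemma inst_cong: "(\<And>v. v \<in> Y \<Longrightarrow> b v = b' v) \<Longrightarrow> inst Y b \<phi> = inst Y b' \<phi>"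
  unfolding inst_def by (intro subst_cong) auto

lemma inst_formulas:
  assumes "\<phi> \<in> formulas L \<MM> A (V \<union> Y)" "assigns \<MM> Y b" "b ` Y \<subseteq> A"
  shows "inst Y b \<phi> \<in> formulas L \<MM> A V"
proof -
  have "has_sort L \<MM> (if v \<in> Y then Par (b v) else Var v) (fst v)" for v
    using assms(2) by (auto simp: assigns_def sort_univ_def)
  then have "wf_fm L \<MM> (inst Y b \<phi>)"
    unfolding inst_def using assms(1) by (intro wf_subst) (auto simp: formulas_def)
  moreover have "params (inst Y b \<phi>) \<subseteq> A"
    unfolding inst_def by (rule order_trans[OF params_subst])
      (use assms in \<open>auto simp: formulas_def split: if_splits\<close>)
  moreover have "free_vars (inst Y b \<phi>) \<subseteq> V"
    unfolding inst_def by (rule order_trans[OF free_vars_subst])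
      (use assms in \<open>auto simp: formulas_def split: if_splits\<close>)
  ultimately show ?thesis by (simp add: formulas_def)
qed

lemma sat_translate: "sat \<MM> \<rho> (translate mul x d \<phi>) = sat \<MM> (\<rho>(x := fint \<MM> mul [\<rho> x, d])) \<phi>"
  unfolding translate_def by (subst sat_subst) (auto intro!: sat_cong)

lemma translate_formulas:
  assumes "funs L mul = Some ([fst x, fst x], fst x)" "\<phi> \<in> formulas L \<MM> A {x}" "srt \<MM> d = fst x"
  shows "translate mul x d \<phi> \<in> formulas L \<MM> (insert d (params \<phi>)) {x}"
proof -
  have "has_sort L \<MM> ((Var(x := Fn mul [Var x, Par d])) v) (fst v)" for v
    using assms(1,3) by (auto intro!: has_sort.intros(3) simp: has_sort_Var has_sort_Par)
  then have "wf_fm L \<MM> (translate mul x d \<phi>)"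
    unfolding translate_def using assms(2) by (intro wf_subst) (auto simp: formulas_def)
  moreover have "params (translate mul x d \<phi>) \<subseteq> insert d (params \<phi>)"
    unfolding translate_def by (rule order_trans[OF params_subst]) (auto split: if_splits)
  moreover have "free_vars (translate mul x d \<phi>) \<subseteq> {x}"
    unfolding translate_def by (rule order_trans[OF free_vars_subst])
      (use assms(2) in \<open>auto simp: formulas_def split: if_splits\<close>)
  ultimately show ?thesis by (simp add: formulas_def)
qed

lemma ren_translate: "ren \<sigma> (translate mul x d \<phi>) = translate mul x (\<sigma> d) (ren \<sigma> \<phi>)"
  unfolding translate_def ren_subst by (rule arg_cong[where f = "\<lambda>\<theta>. subst \<theta> (ren \<sigma> \<phi>)"]) auto

lemma has_sort_ren:
  assumes "has_sort L \<MM> t s" "\<forall>a\<in>tm_params t. srt \<NN> (\<sigma> a) = srt \<MM> a"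
  shows "has_sort L \<NN> (ren_tm \<sigma> t) s"
  by (rule has_sort_gsubst[OF assms(1)]) (use assms(2) in \<open>auto intro!: has_sort_Par has_sort_Var\<close>)

lemma wf_ren:
  assumes "wf_fm L \<MM> \<phi>" "\<forall>a\<in>params \<phi>. srt \<NN> (\<sigma> a) = srt \<MM> a"
  shows "wf_fm L \<NN> (ren \<sigma> \<phi>)"
  using assms
proof (induction \<phi>)
  case (Eq t u)
  then obtain s where "has_sort L \<MM> t s" "has_sort L \<MM> u s" by auto
  then have "has_sort L \<NN> (ren_tm \<sigma> t) s" "has_sort L \<NN> (ren_tm \<sigma> u) s"
    using Eq(2) by (simp_all add: has_sort_ren)
  then show ?case by auto
next
  case (Rel r ts)
  then obtain ss where ss: "rels L r = Some ss" "list_all2 (has_sort L \<MM>) ts ss" by auto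
  have "list_all2 (has_sort L \<NN>) (map (ren_tm \<sigma>) ts) ss"
    unfolding list_all2_map1
    by (rule list.rel_mono_strong[OF ss(2)]) (rule has_sort_ren, use Rel(2) in auto)
  then show ?case using ss(1) by simp
qed simp_all

lemma ren_formulas:
  assumes "\<phi> \<in> formulas L \<MM> A V" "\<And>a. a \<in> A \<Longrightarrow> srt \<NN> (\<sigma> a) = srt \<MM> a"
  shows "ren \<sigma> \<phi> \<in> formulas L \<NN> (\<sigma> ` A) V"
  using assms by (auto simp: formulas_def params_ren intro!: wf_ren[of L \<MM>])

text \<open>Indices above all those occurring in \<open>B\<close> leave infinitely many variables in every sort.\<close>

lemma fresh_names:
  assumes "finite (C :: 'm set)" "finite (B :: 's var set)"
  obtains \<nu> :: "'m \<Rightarrow> 's var" where "inj_on \<nu> C" "\<And>a. a \<in> C \<Longrightarrow> \<nu> a \<notin> B" "\<And>a. fst (\<nu> a) = s a"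
proof -
  obtain f :: "'m \<Rightarrow> nat" where f: "inj_on f C"
    using finite_imp_inj_to_nat_seg[OF assms(1)] by blast
  obtain n where n: "\<And>k. k \<in> snd ` B \<Longrightarrow> k < n"
    using assms(2) finite_nat_set_iff_bounded[of "snd ` B"] by auto
  define \<nu> where "\<nu> a = (s a, n + f a)" for a
  have "\<nu> a \<notin> B" for a
  proof
    assume "\<nu> a \<in> B"
    then have "n + f a < n" using n[of "n + f a"] by (force simp: \<nu>_def)
    then show False by simp
  qed
  then show thesis using f by (intro that[of \<nu>]) (auto simp: \<nu>_def inj_on_def)
qed

section \<open>Type spaces are Stone spaces\<close>

lemma formulas_mono: "A \<subseteq> B \<Longrightarrow> Y \<subseteq> Z \<Longrightarrow> formulas L \<MM> A Y \<subseteq> formulas L \<MM> B Z"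
  by (auto simp: formulas_def)

lemma formulas_Neg [simp]: "Neg \<phi> \<in> formulas L \<MM> A Y \<longleftrightarrow> \<phi> \<in> formulas L \<MM> A Y"
  by (simp add: formulas_def)

lemma formulas_Conj [simp]:
  "Conj \<phi> \<psi> \<in> formulas L \<MM> A Y \<longleftrightarrow> \<phi> \<in> formulas L \<MM> A Y \<and> \<psi> \<in> formulas L \<MM> A Y"
  by (auto simp: formulas_def)

lemma formulas_Fls [simp]: "Fls \<in> formulas L \<MM> A Y"
  by (simp add: formulas_def)

text \<open>
  The arbitrary renaming is there so that a finite part of a type can be moved along a partial
  elementary map as a single formula.
\<close>

lemma finite_conjunction_ren:
  assumes "finite \<Phi>" "\<Phi> \<subseteq> formulas L \<MM> A Y"
  obtains \<phi> where "\<phi> \<in> formulas L \<MM> A Y"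
    "\<And>\<AA> \<sigma> \<rho>. sat \<AA> \<rho> (ren \<sigma> \<phi>) \<longleftrightarrow> (\<forall>\<psi>\<in>\<Phi>. sat \<AA> \<rho> (ren \<sigma> \<psi>))"
proof -
  have "\<exists>\<phi>\<in>formulas L \<MM> A Y. \<forall>\<AA> \<sigma> \<rho>. sat \<AA> \<rho> (ren \<sigma> \<phi>) \<longleftrightarrow> (\<forall>\<psi>\<in>\<Phi>. sat \<AA> \<rho> (ren \<sigma> \<psi>))"
    using assms
  proof (induction rule: finite_induct)
    case empty
    show ?case by (rule bexI[of _ "Neg Fls"]) simp_all
  next
    case (insert \<psi> \<Phi>)
    then obtain \<phi> where "\<phi> \<in> formulas L \<MM> A Y"
      "\<forall>\<AA> \<sigma> \<rho>. sat \<AA> \<rho> (ren \<sigma> \<phi>) \<longleftrightarrow> (\<forall>\<psi>\<in>\<Phi>. sat \<AA> \<rho> (ren \<sigma> \<psi>))" by blast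
    then show ?case using insert.prems by (intro bexI[of _ "Conj \<psi> \<phi>"]) simp_all
  qed
  then show thesis using that by blast
qed

lemma finite_conjunction:
  assumes "finite \<Phi>" "\<Phi> \<subseteq> formulas L \<MM> A Y"
  obtains \<phi> where "\<phi> \<in> formulas L \<MM> A Y" "\<And>\<AA> \<rho>. sat \<AA> \<rho> \<phi> \<longleftrightarrow> (\<forall>\<psi>\<in>\<Phi>. sat \<AA> \<rho> \<psi>)"
proof -
  obtain \<phi> where \<phi>: "\<phi> \<in> formulas L \<MM> A Y"
    "\<And>\<AA> \<sigma> \<rho>. sat \<AA> \<rho> (ren \<sigma> \<phi>) \<longleftrightarrow> (\<forall>\<psi>\<in>\<Phi>. sat \<AA> \<rho> (ren \<sigma> \<psi>))"
    using finite_conjunction_ren[OF assms] by metis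
  have "sat \<AA> \<rho> \<phi> \<longleftrightarrow> (\<forall>\<psi>\<in>\<Phi>. sat \<AA> \<rho> \<psi>)" for \<AA> \<rho>
    using \<phi>(2)[of \<AA> \<rho> "\<lambda>a. a"] by (simp add: ren_ident)
  with \<phi>(1) show thesis by (rule that)
qed

definition fin_sat :: "('s, 'f, 'r, 'm) fo_struct \<Rightarrow> 's var set \<Rightarrow> ('s, 'f, 'r, 'm) fm set \<Rightarrow> bool" where
  "fin_sat \<MM> Y \<Sigma> \<longleftrightarrow>
     (\<forall>\<Phi>. finite \<Phi> \<and> \<Phi> \<subseteq> \<Sigma> \<longrightarrow> (\<exists>b. assigns \<MM> Y b \<and> (\<forall>\<phi>\<in>\<Phi>. sat \<MM> b \<phi>)))"

lemma type_space_iff: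
  "p \<in> type_space L \<MM> A Y \<longleftrightarrow>
     p \<subseteq> formulas L \<MM> A Y \<and> fin_sat \<MM> Y p \<and> (\<forall>\<phi>\<in>formulas L \<MM> A Y. \<phi> \<in> p \<or> Neg \<phi> \<in> p)"
  by (simp add: type_space_def fin_sat_def)

lemma type_space_formulas: "p \<in> type_space L \<MM> A Y \<Longrightarrow> \<phi> \<in> p \<Longrightarrow> \<phi> \<in> formulas L \<MM> A Y"
  by (auto simp: type_space_iff)

lemma type_complete: "p \<in> type_space L \<MM> A Y \<Longrightarrow> \<phi> \<in> formulas L \<MM> A Y \<Longrightarrow> \<phi> \<in> p \<or> Neg \<phi> \<in> p"
  by (simp add: type_space_iff)

lemma type_fin_sat: "p \<in> type_space L \<MM> A Y \<Longrightarrow> fin_sat \<MM> Y p"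
  by (simp add: type_space_iff)

lemma fin_satD:
  "fin_sat \<MM> Y \<Sigma> \<Longrightarrow> finite \<Phi> \<Longrightarrow> \<Phi> \<subseteq> \<Sigma> \<Longrightarrow> \<exists>b. assigns \<MM> Y b \<and> (\<forall>\<phi>\<in>\<Phi>. sat \<MM> b \<phi>)"
  by (simp add: fin_sat_def)

text \<open>
  Otherwise \<open>Neg \<phi>\<close> would belong to \<open>p\<close> and contradict the finite set \<open>\<Phi>\<close>.
\<close>

lemma type_closed:
  assumes p: "p \<in> type_space L \<MM> A Y" and \<Phi>: "finite \<Phi>" "\<Phi> \<subseteq> p" and \<phi>: "\<phi> \<in> formulas L \<MM> A Y"
    and imp: "\<And>b. assigns \<MM> Y b \<Longrightarrow> \<forall>\<psi>\<in>\<Phi>. sat \<MM> b \<psi> \<Longrightarrow> sat \<MM> b \<phi>"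
  shows "\<phi> \<in> p"
proof (rule ccontr)
  assume "\<phi> \<notin> p"
  then have "Neg \<phi> \<in> p" using type_complete[OF p \<phi>] by simp
  with \<Phi> have "finite (insert (Neg \<phi>) \<Phi>)" "insert (Neg \<phi>) \<Phi> \<subseteq> p" by auto
  then obtain b where "assigns \<MM> Y b" "\<forall>\<psi>\<in>insert (Neg \<phi>) \<Phi>. sat \<MM> b \<psi>"
    using fin_satD[OF type_fin_sat[OF p]] by blast
  then show False using imp[of b] by simp
qed

lemma type_Neg:
  assumes p: "p \<in> type_space L \<MM> A Y" and \<phi>: "\<phi> \<in> formulas L \<MM> A Y"
  shows "Neg \<phi> \<in> p \<longleftrightarrow> \<phi> \<notin> p"
proof
  assume 1: "Neg \<phi> \<in> p"
  show "\<phi> \<notin> p"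
  proof
    assume "\<phi> \<in> p"
    with 1 have "Fls \<in> p" by (intro type_closed[OF p, of "{\<phi>, Neg \<phi>}"]) simp_all
    then show False using fin_satD[OF type_fin_sat[OF p], of "{Fls}"] by simp
  qed
next
  assume "\<phi> \<notin> p"
  then show "Neg \<phi> \<in> p" using type_complete[OF p \<phi>] by simp
qed

lemma type_Conj:
  assumes p: "p \<in> type_space L \<MM> A Y" and \<phi>: "\<phi> \<in> formulas L \<MM> A Y" "\<psi> \<in> formulas L \<MM> A Y"
  shows "Conj \<phi> \<psi> \<in> p \<longleftrightarrow> \<phi> \<in> p \<and> \<psi> \<in> p"
proof (intro iffI conjI)
  assume *: "Conj \<phi> \<psi> \<in> p"
  show "\<phi> \<in> p" by (rule type_closed[OF p, of "{Conj \<phi> \<psi>}"]) (simp_all add: \<phi> *)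
  show "\<psi> \<in> p" by (rule type_closed[OF p, of "{Conj \<phi> \<psi>}"]) (simp_all add: \<phi> *)
next
  assume *: "\<phi> \<in> p \<and> \<psi> \<in> p"
  show "Conj \<phi> \<psi> \<in> p" by (rule type_closed[OF p, of "{\<phi>, \<psi>}"]) (simp_all add: \<phi> *)
qed

lemma type_cong:
  assumes p: "p \<in> type_space L \<MM> A Y" and \<phi>: "\<phi> \<in> formulas L \<MM> A Y" "\<psi> \<in> formulas L \<MM> A Y"
    and eq: "\<And>b. assigns \<MM> Y b \<Longrightarrow> sat \<MM> b \<phi> \<longleftrightarrow> sat \<MM> b \<psi>"
  shows "\<phi> \<in> p \<longleftrightarrow> \<psi> \<in> p"
proof
  assume *: "\<phi> \<in> p"
  show "\<psi> \<in> p" by (rule type_closed[OF p, of "{\<phi>}"]) (simp_all add: \<phi> eq *)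
next
  assume *: "\<psi> \<in> p"
  show "\<phi> \<in> p" by (rule type_closed[OF p, of "{\<psi>}"]) (simp_all add: \<phi> eq *)
qed

lemma fin_sat_subset: "fin_sat \<MM> Y \<Sigma> \<Longrightarrow> \<Sigma>' \<subseteq> \<Sigma> \<Longrightarrow> fin_sat \<MM> Y \<Sigma>'"
  unfolding fin_sat_def by blast

lemma type_restrict:
  assumes "p \<in> type_space L \<MM> A Y" "B \<subseteq> A"
  shows "p \<inter> formulas L \<MM> B Y \<in> type_space L \<MM> B Y"
proof -
  have p: "fin_sat \<MM> Y p" "\<forall>\<phi>\<in>formulas L \<MM> A Y. \<phi> \<in> p \<or> Neg \<phi> \<in> p"
    using assms(1) by (simp_all add: type_space_iff)
  have "fin_sat \<MM> Y (p \<inter> formulas L \<MM> B Y)" using p(1) by (rule fin_sat_subset) blast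
  moreover have "\<phi> \<in> p \<inter> formulas L \<MM> B Y \<or> Neg \<phi> \<in> p \<inter> formulas L \<MM> B Y" if "\<phi> \<in> formulas L \<MM> B Y" for \<phi>
    using p(2) that subsetD[OF formulas_mono[OF assms(2) order_refl] that] by auto
  ultimately show ?thesis unfolding type_space_iff by blast
qed

lemma tp_type_space:
  assumes "assigns \<MM> Y b"
  shows "tp L \<MM> A Y b \<in> type_space L \<MM> A Y"
proof -
  have "fin_sat \<MM> Y (tp L \<MM> A Y b)"
    unfolding fin_sat_def tp_def using assms by blast
  then show ?thesis by (auto simp: type_space_iff tp_def)
qed

lemma type_eqI:
  assumes "p \<in> type_space L \<MM> A Y" "q \<in> type_space L \<MM> A Y" "p \<subseteq> q"
  shows "p = q"
proof -
  have "\<phi> \<in> p" if "\<phi> \<in> q" for \<phi>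
  proof (rule ccontr)
    assume "\<phi> \<notin> p"
    have \<phi>: "\<phi> \<in> formulas L \<MM> A Y" using assms(2) that by (rule type_space_formulas)
    then have "Neg \<phi> \<in> p" using type_Neg[OF assms(1)] \<open>\<phi> \<notin> p\<close> by simp
    then have "Neg \<phi> \<in> q" using assms(3) by (rule subsetD[rotated])
    then show False using type_Neg[OF assms(2) \<phi>] that by simp
  qed
  then show ?thesis using assms(3) by (intro equalityI subsetI) auto
qed

text \<open>
  A maximal finitely satisfiable set is complete: if neither \<open>\<phi>\<close> nor its negation could be added,
  each would be refuted by a finite part of the set, and nothing could satisfy both parts.
\<close>

lemma lindenbaum:
  assumes "\<Sigma> \<subseteq> formulas L \<MM> A Y" "fin_sat \<MM> Y \<Sigma>"
  obtains p where "p \<in> type_space L \<MM> A Y" "\<Sigma> \<subseteq> p"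
proof -
  define \<C> where "\<C> = {\<Sigma>'. \<Sigma> \<subseteq> \<Sigma>' \<and> \<Sigma>' \<subseteq> formulas L \<MM> A Y \<and> fin_sat \<MM> Y \<Sigma>'}"
  have "\<exists>p\<in>\<C>. \<forall>q\<in>\<C>. p \<subseteq> q \<longrightarrow> q = p"
  proof (rule subset_Zorn_nonempty)
    show "\<C> \<noteq> {}" using assms unfolding \<C>_def by blast
    fix \<K> assume \<K>: "\<K> \<noteq> {}" "subset.chain \<C> \<K>"
    then have sub: "\<K> \<subseteq> \<C>" by (simp add: subset.chain_def)
    have "fin_sat \<MM> Y (\<Union>\<K>)"
      unfolding fin_sat_def
    proof (intro allI impI)
      fix \<Phi> assume "finite \<Phi> \<and> \<Phi> \<subseteq> \<Union>\<K>"
      then obtain K where K: "K \<in> \<K>" "\<Phi> \<subseteq> K"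
        using \<K> finite_subset_Union_chain by metis
      then have "fin_sat \<MM> Y K" using sub unfolding \<C>_def by blast
      then show "\<exists>b. assigns \<MM> Y b \<and> (\<forall>\<phi>\<in>\<Phi>. sat \<MM> b \<phi>)"
        using K \<open>finite \<Phi> \<and> \<Phi> \<subseteq> \<Union>\<K>\<close> unfolding fin_sat_def by blast
    qed
    moreover have "\<Sigma> \<subseteq> \<Union>\<K>" "\<Union>\<K> \<subseteq> formulas L \<MM> A Y"
      using \<K>(1) sub unfolding \<C>_def by blast+
    ultimately show "\<Union>\<K> \<in> \<C>" unfolding \<C>_def by blast
  qed
  then obtain p where p: "p \<in> \<C>" "\<And>q. q \<in> \<C> \<Longrightarrow> p \<subseteq> q \<Longrightarrow> q = p" by blast
  then have p': "\<Sigma> \<subseteq> p" "p \<subseteq> formulas L \<MM> A Y" "fin_sat \<MM> Y p" unfolding \<C>_def by blast+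
  have blocked: "\<exists>\<Phi>. finite \<Phi> \<and> \<Phi> \<subseteq> p \<and> (\<forall>b. assigns \<MM> Y b \<longrightarrow> (\<forall>\<psi>\<in>\<Phi>. sat \<MM> b \<psi>) \<longrightarrow> \<not> sat \<MM> b \<phi>)"
    if \<phi>: "\<phi> \<in> formulas L \<MM> A Y" "\<phi> \<notin> p" for \<phi>
  proof -
    have "insert \<phi> p \<notin> \<C>" using p(2)[of "insert \<phi> p"] \<phi> by blast
    then have "\<not> fin_sat \<MM> Y (insert \<phi> p)" using p' \<phi> unfolding \<C>_def by blast
    then obtain \<Phi> where \<Phi>: "finite \<Phi>" "\<Phi> \<subseteq> insert \<phi> p" "\<And>b. assigns \<MM> Y b \<Longrightarrow> \<not> (\<forall>\<psi>\<in>\<Phi>. sat \<MM> b \<psi>)"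
      unfolding fin_sat_def by blast
    then have "finite (\<Phi> - {\<phi>})" "\<Phi> - {\<phi>} \<subseteq> p" by auto
    moreover have "\<not> sat \<MM> b \<phi>" if "assigns \<MM> Y b" "\<forall>\<psi>\<in>\<Phi> - {\<phi>}. sat \<MM> b \<psi>" for b
      using \<Phi>(3)[OF that(1)] that(2) by blast
    ultimately show ?thesis by blast
  qed
  have "\<phi> \<in> p \<or> Neg \<phi> \<in> p" if \<phi>: "\<phi> \<in> formulas L \<MM> A Y" for \<phi>
  proof (rule ccontr)
    assume "\<not> (\<phi> \<in> p \<or> Neg \<phi> \<in> p)"
    then have n: "\<phi> \<notin> p" "Neg \<phi> \<notin> p" by auto
    obtain \<Phi>1 where 1: "finite \<Phi>1" "\<Phi>1 \<subseteq> p"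
      "\<And>b. assigns \<MM> Y b \<Longrightarrow> \<forall>\<psi>\<in>\<Phi>1. sat \<MM> b \<psi> \<Longrightarrow> \<not> sat \<MM> b \<phi>"
      using blocked[OF \<phi> n(1)] by blast
    have "Neg \<phi> \<in> formulas L \<MM> A Y" using \<phi> by simp
    then obtain \<Phi>2 where 2: "finite \<Phi>2" "\<Phi>2 \<subseteq> p"
      "\<And>b. assigns \<MM> Y b \<Longrightarrow> \<forall>\<psi>\<in>\<Phi>2. sat \<MM> b \<psi> \<Longrightarrow> \<not> sat \<MM> b (Neg \<phi>)"
      using blocked[OF _ n(2)] by blast
    have "finite (\<Phi>1 \<union> \<Phi>2) \<and> \<Phi>1 \<union> \<Phi>2 \<subseteq> p" using 1 2 by blast
    then obtain b where b: "assigns \<MM> Y b" "\<forall>\<psi>\<in>\<Phi>1 \<union> \<Phi>2. sat \<MM> b \<psi>"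
      using p'(3) unfolding fin_sat_def by blast
    show False using 1(3)[OF b(1)] 2(3)[OF b(1)] b(2) by simp
  qed
  then have "p \<in> type_space L \<MM> A Y" using p' by (simp add: type_space_iff)
  with p'(1) show thesis by (rule that[rotated])
qed

abbreviation type_nbhd ::
  "('s, 'f, 'r) lang \<Rightarrow> ('s, 'f, 'r, 'm) fo_struct \<Rightarrow> 'm set \<Rightarrow> 's var set \<Rightarrow> ('s, 'f, 'r, 'm) fm
     \<Rightarrow> ('s, 'f, 'r, 'm) fm set set" where
  "type_nbhd L \<MM> A Y \<phi> \<equiv> {p \<in> type_space L \<MM> A Y. \<phi> \<in> p}"

lemma topspace_type_top [simp]: "topspace (type_top L \<MM> A Y) = type_space L \<MM> A Y"
proof -
  have "type_space L \<MM> A Y \<subseteq> type_nbhd L \<MM> A Y Fls \<union> type_nbhd L \<MM> A Y (Neg Fls)"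
  proof
    fix p assume p: "p \<in> type_space L \<MM> A Y"
    then have "Fls \<in> p \<or> Neg Fls \<in> p"
      using formulas_Fls[of L \<MM> A Y] unfolding type_space_iff by blast
    with p show "p \<in> type_nbhd L \<MM> A Y Fls \<union> type_nbhd L \<MM> A Y (Neg Fls)" by simp
  qed
  moreover have "Fls \<in> formulas L \<MM> A Y" "Neg Fls \<in> formulas L \<MM> A Y" by simp_all
  ultimately show ?thesis
    unfolding type_top_def topology_generated_by_topspace by blast
qed

lemma openin_type_nbhd: "\<phi> \<in> formulas L \<MM> A Y \<Longrightarrow> openin (type_top L \<MM> A Y) (type_nbhd L \<MM> A Y \<phi>)"
  unfolding type_top_def by (rule topology_generated_by_Basis) blast

text \<open>
  Types are closed under conjunction, so the generating sets already form a base.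
\<close>

lemma type_top_base:
  assumes "openin (type_top L \<MM> A Y) U" "p \<in> U"
  obtains \<phi> where "\<phi> \<in> formulas L \<MM> A Y" "\<phi> \<in> p" "type_nbhd L \<MM> A Y \<phi> \<subseteq> U"
proof -
  have "generate_topology_on (type_nbhd L \<MM> A Y ` formulas L \<MM> A Y) U"
    using assms(1) unfolding type_top_def openin_topology_generated_by_iff .
  then have "\<forall>p\<in>U. \<exists>\<phi>\<in>formulas L \<MM> A Y. p \<in> type_nbhd L \<MM> A Y \<phi> \<and> type_nbhd L \<MM> A Y \<phi> \<subseteq> U"
  proof induction
    case (Int a b)
    show ?case
    proof
      fix p assume p: "p \<in> a \<inter> b"
      obtain \<phi> where \<phi>: "\<phi> \<in> formulas L \<MM> A Y" "p \<in> type_nbhd L \<MM> A Y \<phi>" "type_nbhd L \<MM> A Y \<phi> \<subseteq> a"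
        using Int.IH(1) p by blast
      obtain \<psi> where \<psi>: "\<psi> \<in> formulas L \<MM> A Y" "p \<in> type_nbhd L \<MM> A Y \<psi>" "type_nbhd L \<MM> A Y \<psi> \<subseteq> b"
        using Int.IH(2) p by blast
      have "type_nbhd L \<MM> A Y (Conj \<phi> \<psi>) = type_nbhd L \<MM> A Y \<phi> \<inter> type_nbhd L \<MM> A Y \<psi>"
        using type_Conj \<phi>(1) \<psi>(1) by blast
      then have "Conj \<phi> \<psi> \<in> formulas L \<MM> A Y \<and> p \<in> type_nbhd L \<MM> A Y (Conj \<phi> \<psi>)
          \<and> type_nbhd L \<MM> A Y (Conj \<phi> \<psi>) \<subseteq> a \<inter> b"
        using \<phi> \<psi> by auto
      then show "\<exists>\<phi>\<in>formulas L \<MM> A Y. p \<in> type_nbhd L \<MM> A Y \<phi> \<and> type_nbhd L \<MM> A Y \<phi> \<subseteq> a \<inter> b" by blast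
    qed
  next
    case (UN K)
    show ?case
    proof
      fix p assume "p \<in> \<Union>K"
      then obtain k where k: "k \<in> K" "p \<in> k" by blast
      then obtain \<phi> where "\<phi> \<in> formulas L \<MM> A Y" "p \<in> type_nbhd L \<MM> A Y \<phi>" "type_nbhd L \<MM> A Y \<phi> \<subseteq> k"
        using UN.IH by blast
      with k(1) show "\<exists>\<phi>\<in>formulas L \<MM> A Y. p \<in> type_nbhd L \<MM> A Y \<phi> \<and> type_nbhd L \<MM> A Y \<phi> \<subseteq> \<Union>K" by blast
    qed
  qed blast+
  then show thesis using assms(2) that by blast
qed

text \<open>
  Points have types, and every finite part of a type is satisfied by a point. So an inclusion
  between basic sets can be tested on points.
\<close>

lemma type_nbhd_subset_iff:
  assumes "\<phi> \<in> formulas L \<MM> A Y" "\<psi> \<in> formulas L \<MM> A Y"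
  shows "type_nbhd L \<MM> A Y \<phi> \<subseteq> type_nbhd L \<MM> A Y \<psi> \<longleftrightarrow> (\<forall>b. assigns \<MM> Y b \<longrightarrow> sat \<MM> b \<phi> \<longrightarrow> sat \<MM> b \<psi>)"
proof
  assume sub: "type_nbhd L \<MM> A Y \<phi> \<subseteq> type_nbhd L \<MM> A Y \<psi>"
  show "\<forall>b. assigns \<MM> Y b \<longrightarrow> sat \<MM> b \<phi> \<longrightarrow> sat \<MM> b \<psi>"
  proof (intro allI impI)
    fix b assume "assigns \<MM> Y b" "sat \<MM> b \<phi>"
    then have "tp L \<MM> A Y b \<in> type_nbhd L \<MM> A Y \<phi>" using assms tp_type_space by (auto simp: tp_def)
    then have "tp L \<MM> A Y b \<in> type_nbhd L \<MM> A Y \<psi>" using sub by blast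
    then show "sat \<MM> b \<psi>" by (simp add: tp_def)
  qed
next
  assume *: "\<forall>b. assigns \<MM> Y b \<longrightarrow> sat \<MM> b \<phi> \<longrightarrow> sat \<MM> b \<psi>"
  show "type_nbhd L \<MM> A Y \<phi> \<subseteq> type_nbhd L \<MM> A Y \<psi>"
  proof
    fix p assume p: "p \<in> type_nbhd L \<MM> A Y \<phi>"
    then have "\<psi> \<in> p" using type_closed[of p L \<MM> A Y "{\<phi>}" \<psi>] assms * by simp
    with p show "p \<in> type_nbhd L \<MM> A Y \<psi>" by simp
  qed
qed

lemma type_nbhd_Neg:
  "\<phi> \<in> formulas L \<MM> A Y \<Longrightarrow> type_nbhd L \<MM> A Y (Neg \<phi>) = type_space L \<MM> A Y - type_nbhd L \<MM> A Y \<phi>"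
  using type_Neg by blast

lemma type_nbhd_Conj:
  "\<phi> \<in> formulas L \<MM> A Y \<Longrightarrow> \<psi> \<in> formulas L \<MM> A Y \<Longrightarrow>
    type_nbhd L \<MM> A Y (Conj \<phi> \<psi>) = type_nbhd L \<MM> A Y \<phi> \<inter> type_nbhd L \<MM> A Y \<psi>"
  using type_Conj by blast

lemma Hausdorff_type_top: "Hausdorff_space (type_top L \<MM> A Y)"
  unfolding Hausdorff_space_def
proof (intro allI impI)
  fix p q assume *: "p \<in> topspace (type_top L \<MM> A Y) \<and> q \<in> topspace (type_top L \<MM> A Y) \<and> p \<noteq> q"
  then have pq: "p \<in> type_space L \<MM> A Y" "q \<in> type_space L \<MM> A Y" by simp_all
  with * obtain \<phi> where "\<phi> \<in> p" "\<phi> \<notin> q" using type_eqI by blast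
  have "\<phi> \<in> formulas L \<MM> A Y" using pq(1) \<open>\<phi> \<in> p\<close> by (rule type_space_formulas)
  then have \<phi>: "\<phi> \<in> formulas L \<MM> A Y" "Neg \<phi> \<in> formulas L \<MM> A Y" "Neg \<phi> \<in> q"
    using type_Neg[OF pq(2)] \<open>\<phi> \<notin> q\<close> by simp_all
  then have "type_nbhd L \<MM> A Y \<phi> \<inter> type_nbhd L \<MM> A Y (Neg \<phi>) = {}" by (subst type_nbhd_Neg) auto
  then show "\<exists>U V. openin (type_top L \<MM> A Y) U \<and> openin (type_top L \<MM> A Y) V \<and> p \<in> U \<and> q \<in> V \<and> disjnt U V"
    using openin_type_nbhd[OF \<phi>(1)] openin_type_nbhd[OF \<phi>(2)] \<open>\<phi> \<in> p\<close> \<phi>(3) pq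
    by (intro exI[of _ "type_nbhd L \<MM> A Y \<phi>"] exI[of _ "type_nbhd L \<MM> A Y (Neg \<phi>)"]) (simp add: disjnt_def)
qed

text \<open>
  If no finite part of an open cover sufficed, the negations of the formulas defining basic subsets
  of its members would be finitely satisfiable, and a complete type containing them would be
  uncovered.
\<close>

lemma compact_type_top: "compact_space (type_top L \<MM> A Y)"
  unfolding compact_space_alt topspace_type_top
proof (intro allI impI)
  fix \<U> assume \<U>: "(\<forall>U\<in>\<U>. openin (type_top L \<MM> A Y) U) \<and> type_space L \<MM> A Y \<subseteq> \<Union>\<U>"
  define \<Sigma> where "\<Sigma> = {Neg \<phi> |\<phi>. \<phi> \<in> formulas L \<MM> A Y \<and> (\<exists>U\<in>\<U>. type_nbhd L \<MM> A Y \<phi> \<subseteq> U)}"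
  have "\<not> fin_sat \<MM> Y \<Sigma>"
  proof
    assume fs: "fin_sat \<MM> Y \<Sigma>"
    have "\<Sigma> \<subseteq> formulas L \<MM> A Y" by (auto simp: \<Sigma>_def)
    then obtain p where p: "p \<in> type_space L \<MM> A Y" "\<Sigma> \<subseteq> p" using lindenbaum fs by blast
    then obtain U where U: "U \<in> \<U>" "p \<in> U" using \<U> by blast
    then obtain \<phi> where \<phi>: "\<phi> \<in> formulas L \<MM> A Y" "\<phi> \<in> p" "type_nbhd L \<MM> A Y \<phi> \<subseteq> U"
      using \<U> type_top_base by blast
    then have "Neg \<phi> \<in> p" using U(1) p(2) unfolding \<Sigma>_def by blast
    then show False using type_Neg[OF p(1) \<phi>(1)] \<phi>(2) by simp
  qed
  then obtain \<Phi> where \<Phi>: "finite \<Phi>" "\<Phi> \<subseteq> \<Sigma>" "\<And>b. assigns \<MM> Y b \<Longrightarrow> \<not> (\<forall>\<phi>\<in>\<Phi>. sat \<MM> b \<phi>)"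
    unfolding fin_sat_def by blast
  have "\<forall>\<psi>\<in>\<Phi>. \<exists>U. U \<in> \<U> \<and> (\<exists>\<phi>. \<psi> = Neg \<phi> \<and> \<phi> \<in> formulas L \<MM> A Y \<and> type_nbhd L \<MM> A Y \<phi> \<subseteq> U)"
    using \<Phi>(2) unfolding \<Sigma>_def by blast
  from bchoice[OF this] obtain u where
    u: "\<forall>\<psi>\<in>\<Phi>. u \<psi> \<in> \<U> \<and> (\<exists>\<phi>. \<psi> = Neg \<phi> \<and> \<phi> \<in> formulas L \<MM> A Y \<and> type_nbhd L \<MM> A Y \<phi> \<subseteq> u \<psi>)" ..
  have "type_space L \<MM> A Y \<subseteq> \<Union>(u ` \<Phi>)"
  proof
    fix p assume p: "p \<in> type_space L \<MM> A Y"
    then have "\<not> \<Phi> \<subseteq> p" using fin_satD[OF type_fin_sat \<Phi>(1)] \<Phi>(3) by blast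
    then obtain \<psi> where "\<psi> \<in> \<Phi>" "\<psi> \<notin> p" by blast
    moreover obtain \<phi> where \<phi>: "\<psi> = Neg \<phi>" "\<phi> \<in> formulas L \<MM> A Y" "type_nbhd L \<MM> A Y \<phi> \<subseteq> u \<psi>"
      using u \<open>\<psi> \<in> \<Phi>\<close> by blast
    ultimately have "\<phi> \<in> p" using type_Neg[OF p] by blast
    then show "p \<in> \<Union>(u ` \<Phi>)" using \<phi>(3) p \<open>\<psi> \<in> \<Phi>\<close> by blast
  qed
  then show "\<exists>\<F>. finite \<F> \<and> \<F> \<subseteq> \<U> \<and> type_space L \<MM> A Y \<subseteq> \<Union>\<F>"
    using u \<Phi>(1) by (intro exI[of _ "u ` \<Phi>"]) auto
qed

section \<open>Saturation and smallness\<close>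

lemma small_Un:
  assumes "Card_order \<kappa>" "natLeq <o \<kappa>" "small \<kappa> A" "small \<kappa> B"
  shows "small \<kappa> (A \<union> B)"
proof -
  have "\<not> finite (Field \<kappa>)"
  proof
    assume "finite (Field \<kappa>)"
    then have "|Field \<kappa>| <o natLeq" by (simp add: finite_iff_ordLess_natLeq)
    then have "|Field \<kappa>| <o \<kappa>" using assms(2) ordLess_transitive by blast
    then show False using card_of_Field_ordIso[OF assms(1)] not_ordLess_ordIso by blast
  qed
  then show ?thesis
    using assms card_of_Un_ordLess_infinite_Field unfolding small_def by blast
qed

lemma small_finite:
  assumes "natLeq <o \<kappa>" "finite A"
  shows "small \<kappa> A"
  using assms finite_iff_ordLess_natLeq ordLess_transitive unfolding small_def by blast

lemma small_Un_finite:
  "monster L \<kappa> \<MM> \<Longrightarrow> small \<kappa> A \<Longrightarrow> finite B \<Longrightarrow> small \<kappa> (A \<union> B)"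
  by (simp add: monster_def small_Un small_finite)

lemma saturated_realizes:
  assumes "saturated L \<kappa> \<MM>" "A \<subseteq> univ \<MM>" "small \<kappa> A" "\<Sigma> \<subseteq> formulas L \<MM> A {v}" "fin_sat \<MM> {v} \<Sigma>"
  obtains d where "realizes \<MM> v \<Sigma> d"
proof -
  obtain p where p: "p \<in> type_space L \<MM> A {v}" "\<Sigma> \<subseteq> p" using lindenbaum assms(4,5) by blast
  then obtain d where "realizes \<MM> v p d" using assms(1-3) unfolding saturated_def by blast
  then have "realizes \<MM> v \<Sigma> d" using p(2) unfolding realizes_def by blast
  then show thesis by (rule that)
qed

lemma realizes_iff:
  assumes "p \<in> type_space L \<MM> A {v}" "realizes \<MM> v p d" "\<phi> \<in> formulas L \<MM> A {v}"
  shows "\<phi> \<in> p \<longleftrightarrow> sat \<MM> (\<lambda>_. d) \<phi>"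
proof (cases "\<phi> \<in> p")
  case False
  then have "Neg \<phi> \<in> p" using type_Neg assms by blast
  then show ?thesis using assms(2) False unfolding realizes_def by force
qed (use assms(2) in \<open>auto simp: realizes_def\<close>)

section \<open>Regular Borel measures on Stone spaces\<close>

lemma open_subset_Pow: "{U. openin X U} \<subseteq> Pow (topspace X)"
  using openin_subset by auto

lemma space_borel_of: "space (borel_of X) = topspace X"
  by (simp add: borel_of_def open_subset_Pow)

lemma sets_borel_of: "sets (borel_of X) = sigma_sets (topspace X) {U. openin X U}"
  by (simp add: borel_of_def open_subset_Pow)

text \<open>
  A finitely additive probability on a Boolean algebra of clopen sets that is a base of a compact
  space extends uniquely to a regular Borel measure. The space need not be second countable, so the
  Borel sets are in general not generated by the clopen algebra, and the extension theorem for
  premeasures on algebras does not reach them. Therefore the outer measure is built from open covers.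
\<close>

locale clopen_content =
  fixes X :: "'a topology" and \<B> :: "'a set set" and \<nu> :: "'a set \<Rightarrow> real"
  assumes compact: "compact_space X"
    and algebra: "algebra (topspace X) \<B>"
    and clopen_open: "B \<in> \<B> \<Longrightarrow> openin X B"
    and base: "openin X U \<Longrightarrow> p \<in> U \<Longrightarrow> \<exists>B\<in>\<B>. p \<in> B \<and> B \<subseteq> U"
    and nonneg: "B \<in> \<B> \<Longrightarrow> 0 \<le> \<nu> B"
    and additive: "B \<in> \<B> \<Longrightarrow> C \<in> \<B> \<Longrightarrow> B \<inter> C = {} \<Longrightarrow> \<nu> (B \<union> C) = \<nu> B + \<nu> C"
    and total: "\<nu> (topspace X) = 1"
begin

sublocale alg: algebra "topspace X" \<B>
  by (rule algebra)

lemma content_empty: "\<nu> {} = 0"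
  using additive[of "{}" "{}"] by simp

lemma content_mono: "B \<in> \<B> \<Longrightarrow> C \<in> \<B> \<Longrightarrow> B \<subseteq> C \<Longrightarrow> \<nu> B \<le> \<nu> C"
  using additive[of B "C - B"] nonneg[of "C - B"] alg.Diff[of C B] by (simp add: Un_absorb1)

lemma content_Un: "B \<in> \<B> \<Longrightarrow> C \<in> \<B> \<Longrightarrow> \<nu> (B \<union> C) \<le> \<nu> B + \<nu> C"
  using additive[of B "C - B"] content_mono[of "C - B" C] alg.Diff[of C B] by simp

lemma content_UN_le:
  assumes "finite I" "\<And>i. i \<in> I \<Longrightarrow> F i \<in> \<B>"
  shows "\<nu> (\<Union>i\<in>I. F i) \<le> (\<Sum>i\<in>I. \<nu> (F i))"
  using assms
proof (induction rule: finite_induct)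
  case (insert i I)
  have "(\<Union>j\<in>I. F j) \<in> \<B>" using insert by (intro alg.finite_UN) auto
  then have "\<nu> (F i \<union> (\<Union>j\<in>I. F j)) \<le> \<nu> (F i) + \<nu> (\<Union>j\<in>I. F j)"
    using insert.prems by (intro content_Un) auto
  then show ?case using insert by simp
qed (simp add: content_empty)

lemma clopen_compact: "B \<in> \<B> \<Longrightarrow> compactin X B"
proof (rule closedin_compact_space[OF compact])
  assume B: "B \<in> \<B>"
  then have "openin X (topspace X - B)" by (intro clopen_open) auto
  then show "closedin X B" using B alg.sets_into_space by (simp add: closedin_def)
qed

lemma compact_clopen_between:
  assumes "compactin X K" "openin X U" "K \<subseteq> U"
  obtains B where "B \<in> \<B>" "K \<subseteq> B" "B \<subseteq> U"
proof -
  define \<D> where "\<D> = {D \<in> \<B>. D \<subseteq> U}"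
  have \<D>: "openin X D" if "D \<in> \<D>" for D using that clopen_open by (simp add: \<D>_def)
  have "K \<subseteq> \<Union>\<D>"
  proof
    fix p assume "p \<in> K"
    then obtain B where "B \<in> \<B>" "p \<in> B" "B \<subseteq> U" using base[OF assms(2), of p] assms(3) by blast
    then show "p \<in> \<Union>\<D>" unfolding \<D>_def by blast
  qed
  then have "\<exists>\<F>. finite \<F> \<and> \<F> \<subseteq> \<D> \<and> K \<subseteq> \<Union>\<F>" by (intro compactinD[OF assms(1)] \<D>)
  then obtain \<F> where \<F>: "finite \<F>" "\<F> \<subseteq> \<D>" "K \<subseteq> \<Union>\<F>" by (elim exE conjE)
  have "\<Union>\<F> \<in> \<B>" using \<F> by (intro alg.finite_Union) (auto simp: \<D>_def)
  moreover have "\<Union>\<F> \<subseteq> U" using \<F>(2) by (auto simp: \<D>_def)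
  ultimately show thesis using \<F>(3) by (intro that)
qed

text \<open>
  Cover \<open>B\<close> by finitely many basic sets, each assigned to some \<open>U i\<close> containing it; \<open>C i\<close> is the union
  of those assigned to \<open>i\<close>.
\<close>

lemma clopen_subset_UN:
  fixes U :: "nat \<Rightarrow> 'a set"
  assumes B: "B \<in> \<B>" and U: "\<And>i. openin X (U i)" and sub: "B \<subseteq> (\<Union>i. U i)"
  obtains n C where "\<And>i. C i \<in> \<B>" "\<And>i. C i \<subseteq> U i" "B \<subseteq> (\<Union>i<n. C i)"
proof -
  define \<D> where "\<D> = {D \<in> \<B>. \<exists>i. D \<subseteq> U i}"
  have \<D>: "openin X D" if "D \<in> \<D>" for D using that clopen_open by (simp add: \<D>_def)
  have "B \<subseteq> \<Union>\<D>"
  proof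
    fix p assume "p \<in> B"
    then obtain i where "p \<in> U i" using sub by blast
    then obtain D where "D \<in> \<B>" "p \<in> D" "D \<subseteq> U i" using base[OF U] by blast
    then show "p \<in> \<Union>\<D>" unfolding \<D>_def by blast
  qed
  then have "\<exists>\<F>. finite \<F> \<and> \<F> \<subseteq> \<D> \<and> B \<subseteq> \<Union>\<F>" by (intro compactinD[OF clopen_compact[OF B]] \<D>)
  then obtain \<F> where \<F>: "finite \<F>" "\<F> \<subseteq> \<D>" "B \<subseteq> \<Union>\<F>" by (elim exE conjE)
  have "\<forall>D\<in>\<F>. \<exists>i. D \<subseteq> U i" using \<F>(2) by (auto simp: \<D>_def)
  from bchoice[OF this] obtain idx where idx: "\<forall>D\<in>\<F>. D \<subseteq> U (idx D)" ..
  define C where "C i = \<Union>{D \<in> \<F>. idx D = i}" for i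
  obtain n where n: "\<forall>i\<in>idx ` \<F>. i < n"
    using \<F>(1) finite_nat_set_iff_bounded by (metis finite_imageI)
  show thesis
  proof (rule that[of C n])
    fix i
    show "C i \<in> \<B>" unfolding C_def using \<F> by (intro alg.finite_Union) (auto simp: \<D>_def)
    show "C i \<subseteq> U i" unfolding C_def using idx by auto
    show "B \<subseteq> (\<Union>i<n. C i)" using \<F>(3) n by (auto simp: C_def) blast
  qed
qed

definition open_content :: "'a set \<Rightarrow> ennreal" where
  "open_content U = (SUP B\<in>{B\<in>\<B>. B \<subseteq> U}. ennreal (\<nu> B))"

definition outer :: "'a set \<Rightarrow> ennreal" where
  "outer E = (INF U\<in>{U. openin X U \<and> E \<subseteq> U}. open_content U)"

lemma open_content_mono: "U \<subseteq> V \<Longrightarrow> open_content U \<le> open_content V"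
  unfolding open_content_def by (rule SUP_subset_mono) auto

lemma open_content_upper: "B \<in> \<B> \<Longrightarrow> B \<subseteq> U \<Longrightarrow> ennreal (\<nu> B) \<le> open_content U"
  unfolding open_content_def by (rule SUP_upper) simp

lemma open_content_clopen: "B \<in> \<B> \<Longrightarrow> open_content B = ennreal (\<nu> B)"
proof (rule antisym)
  assume B: "B \<in> \<B>"
  show "open_content B \<le> ennreal (\<nu> B)"
    unfolding open_content_def by (rule SUP_least) (auto intro!: ennreal_leI content_mono B)
qed (rule open_content_upper, auto)

lemma open_content_UN:
  fixes U :: "nat \<Rightarrow> 'a set"
  assumes "\<And>i. openin X (U i)"
  shows "open_content (\<Union>i. U i) \<le> (\<Sum>i. open_content (U i))"
  unfolding open_content_def[of "\<Union>i. U i"]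
proof (rule SUP_least)
  fix B assume "B \<in> {B \<in> \<B>. B \<subseteq> (\<Union>i. U i)}"
  then have B: "B \<in> \<B>" "B \<subseteq> (\<Union>i. U i)" by simp_all
  obtain n C where C: "\<And>i. C i \<in> \<B>" "\<And>i. C i \<subseteq> U i" "B \<subseteq> (\<Union>i<n::nat. C i)"
    by (rule clopen_subset_UN[OF B(1) assms B(2)]) (rule that)
  have "(\<Union>i<n. C i) \<in> \<B>" using C(1) by (intro alg.finite_UN) auto
  then have "\<nu> B \<le> \<nu> (\<Union>i<n. C i)" by (rule content_mono[OF B(1) _ C(3)])
  also have "\<dots> \<le> (\<Sum>i<n. \<nu> (C i))" by (rule content_UN_le) (auto simp: C(1))
  finally have "ennreal (\<nu> B) \<le> (\<Sum>i<n. ennreal (\<nu> (C i)))"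
    by (subst sum_ennreal) (auto intro!: ennreal_leI nonneg C(1))
  also have "\<dots> \<le> (\<Sum>i<n. open_content (U i))"
    by (intro sum_mono open_content_upper C)
  also have "\<dots> \<le> (\<Sum>i. open_content (U i))"
    by (rule sum_le_suminf) auto
  finally show "ennreal (\<nu> B) \<le> (\<Sum>i. open_content (U i))" .
qed

lemma outer_mono: "E \<subseteq> F \<Longrightarrow> outer E \<le> outer F"
  unfolding outer_def by (rule INF_superset_mono) auto

lemma outer_le: "openin X U \<Longrightarrow> E \<subseteq> U \<Longrightarrow> outer E \<le> open_content U"
  unfolding outer_def by (rule INF_lower) simp

lemma outer_open: "openin X U \<Longrightarrow> outer U = open_content U"
  by (rule antisym[OF outer_le]) (auto simp: outer_def intro!: INF_greatest open_content_mono)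

lemma outer_clopen: "B \<in> \<B> \<Longrightarrow> outer B = ennreal (\<nu> B)"
  by (simp add: outer_open clopen_open open_content_clopen)

lemma outer_close:
  assumes "outer E < e"
  obtains U where "openin X U" "E \<subseteq> U" "open_content U < e"
  using assms unfolding outer_def INF_less_iff by blast

lemma outer_countably_subadditive: "countably_subadditive (Pow (topspace X)) outer"
  unfolding countably_subadditive_def
proof (intro allI impI)
  fix A :: "nat \<Rightarrow> 'a set"
  show "outer (\<Union>i. A i) \<le> (\<Sum>n. outer (A n))"
  proof (rule ennreal_le_epsilon)
    fix e :: real assume "0 < e" "(\<Sum>n. outer (A n)) < top_class.top"
    then have *: "outer (A n) < outer (A n) + e * (1/2)^Suc n" for n
      by (auto simp add: less_top dest!: ennreal_suminf_lessD)
    have "\<exists>U. openin X U \<and> A n \<subseteq> U \<and> open_content U < outer (A n) + e * (1/2)^Suc n" for n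
      using outer_close[OF *] by metis
    then obtain U where U: "\<And>n. openin X (U n)" "\<And>n. A n \<subseteq> U n"
      "\<And>n. open_content (U n) < outer (A n) + e * (1/2)^Suc n" by metis
    \<comment> \<open>The errors allowed for the sets \<open>A n\<close> add up to \<open>e\<close>.\<close>
    have "outer (\<Union>i. A i) \<le> open_content (\<Union>i. U i)"
      using U(1,2) by (intro outer_le) auto
    also have "\<dots> \<le> (\<Sum>i. open_content (U i))" by (rule open_content_UN[OF U(1)])
    also have "\<dots> \<le> (\<Sum>n. outer (A n) + e * (1/2) ^ Suc n)"
      by (intro suminf_le allI less_imp_le U(3)) auto
    also have "\<dots> = (\<Sum>n. outer (A n)) + (\<Sum>n. ennreal e * ennreal ((1/2) ^ Suc n))"
      using \<open>0 < e\<close> by (subst suminf_add[symmetric])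
                       (auto simp del: ennreal_suminf_cmult simp add: ennreal_mult[symmetric])
    also have "\<dots> = (\<Sum>n. outer (A n)) + e"
      unfolding ennreal_suminf_cmult
      by (subst suminf_ennreal_eq[OF zero_le_power power_half_series]) auto
    finally show "outer (\<Union>i. A i) \<le> (\<Sum>n. outer (A n)) + e" .
  qed
qed

lemma outer_measure_space_outer: "outer_measure_space (Pow (topspace X)) outer"
proof -
  have "outer {} = 0" using outer_clopen[of "{}"] content_empty by simp
  then show ?thesis
    using outer_countably_subadditive
    by (auto simp: outer_measure_space_def positive_def increasing_def intro: outer_mono)
qed

text \<open>
  Half of the Caratheodory condition for \<open>V\<close>, tested on an open set \<open>U\<close>. A clopen \<open>B\<close> inside \<open>U \<inter> V\<close>
  leaves the open set \<open>U - B\<close>, which contains \<open>U - V\<close>; now let \<open>B\<close> exhaust the content of \<open>U \<inter> V\<close>.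
\<close>

lemma open_content_split:
  assumes U: "openin X U" and V: "openin X V"
  shows "open_content (U \<inter> V) + outer (U - V) \<le> open_content U"
proof -
  have ne: "{B \<in> \<B>. B \<subseteq> W} \<noteq> {}" for W by blast
  have "ennreal (\<nu> B) + outer (U - V) \<le> open_content U" if B: "B \<in> \<B>" "B \<subseteq> U \<inter> V" for B
  proof -
    have "openin X (topspace X - B)" using B by (intro clopen_open) auto
    then have "openin X (U \<inter> (topspace X - B))" using U by (rule openin_Int[rotated])
    then have "outer (U - V) \<le> open_content (U \<inter> (topspace X - B))"
      using B openin_subset[OF U] by (intro outer_le) auto
    then have "ennreal (\<nu> B) + outer (U - V) \<le> ennreal (\<nu> B) + open_content (U \<inter> (topspace X - B))"
      by (rule add_left_mono)
    also have "\<dots> = (SUP C\<in>{C\<in>\<B>. C \<subseteq> U \<inter> (topspace X - B)}. ennreal (\<nu> B) + ennreal (\<nu> C))"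
      unfolding open_content_def by (rule ennreal_SUP_add_right[OF ne])
    also have "\<dots> \<le> open_content U"
    proof (rule SUP_least)
      fix C assume C: "C \<in> {C\<in>\<B>. C \<subseteq> U \<inter> (topspace X - B)}"
      then have "\<nu> (B \<union> C) = \<nu> B + \<nu> C" using B by (intro additive) auto
      then have "ennreal (\<nu> B) + ennreal (\<nu> C) = ennreal (\<nu> (B \<union> C))"
        using B C nonneg by (simp add: ennreal_plus)
      also have "\<dots> \<le> open_content U" using B C by (intro open_content_upper) auto
      finally show "ennreal (\<nu> B) + ennreal (\<nu> C) \<le> open_content U" .
    qed
    finally show ?thesis .
  qed
  then have "(SUP B\<in>{B\<in>\<B>. B \<subseteq> U \<inter> V}. ennreal (\<nu> B) + outer (U - V)) \<le> open_content U"
    by (intro SUP_least) auto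
  then show ?thesis
    unfolding open_content_def[of "U \<inter> V"] ennreal_SUP_add_left[OF ne] .
qed

text \<open>
  Open test sets suffice, because the outer measure of any set is an infimum over open supersets.
\<close>

lemma open_in_lambda_system:
  assumes V: "openin X V"
  shows "V \<in> lambda_system (topspace X) (Pow (topspace X)) outer"
proof -
  interpret P: sigma_algebra "topspace X" "Pow (topspace X)" by (rule sigma_algebra_Pow)
  have pos: "positive (Pow (topspace X)) outer" and sub: "subadditive (Pow (topspace X)) outer"
    using outer_measure_space_outer P.countably_subadditive_subadditive
    by (auto simp: outer_measure_space_def)
  have "outer (E \<inter> V) + outer (E - V) = outer E" if E: "E \<subseteq> topspace X" for E
  proof (rule antisym)
    show "outer (E \<inter> V) + outer (E - V) \<le> outer E"
      unfolding outer_def[of E]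
    proof (rule INF_greatest)
      fix U assume U: "U \<in> {U. openin X U \<and> E \<subseteq> U}"
      then have "outer (E \<inter> V) + outer (E - V) \<le> outer (U \<inter> V) + outer (U - V)"
        by (intro add_mono outer_mono) auto
      also have "\<dots> \<le> open_content U"
        using U V open_content_split[of U V] outer_open[of "U \<inter> V"] openin_Int[of X U V] by auto
      finally show "outer (E \<inter> V) + outer (E - V) \<le> open_content U" .
    qed
    have "outer ((E \<inter> V) \<union> (E - V)) \<le> outer (E \<inter> V) + outer (E - V)"
      using E by (intro subadditiveD[OF sub]) auto
    then show "outer E \<le> outer (E \<inter> V) + outer (E - V)" by (simp add: Int_Diff_Un)
  qed
  then show ?thesis
    unfolding P.lambda_system_eq using openin_subset[OF V] by auto
qed

definition ext :: "'a measure" where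
  "ext = measure_of (topspace X) {U. openin X U} outer"

lemma sets_ext: "sets ext = sets (borel_of X)"
  by (simp add: ext_def borel_of_def open_subset_Pow)

lemma space_ext [simp]: "space ext = topspace X"
  by (simp add: ext_def open_subset_Pow)

lemma open_sets_ext: "openin X U \<Longrightarrow> U \<in> sets ext"
  by (simp add: ext_def open_subset_Pow sigma_sets.Basic)

lemma emeasure_ext: "E \<in> sets ext \<Longrightarrow> emeasure ext E = outer E"
proof -
  assume E: "E \<in> sets ext"
  let ?ls = "lambda_system (topspace X) (Pow (topspace X)) outer"
  have ms: "measure_space (topspace X) ?ls outer"
    by (rule sigma_algebra.caratheodory_lemma[OF sigma_algebra_Pow outer_measure_space_outer])
  have "sigma_sets (topspace X) {U. openin X U} \<subseteq> ?ls"
    by (rule sigma_algebra.sigma_sets_subset) (use ms in \<open>auto simp: measure_space_def open_in_lambda_system\<close>)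
  then have "measure_space (topspace X) (sigma_sets (topspace X) {U. openin X U}) outer"
    by (rule measure_down[OF ms sigma_algebra_sigma_sets[OF open_subset_Pow]])
  then show "emeasure ext E = outer E"
    using E by (intro emeasure_measure_of[OF ext_def open_subset_Pow])
      (simp_all add: measure_space_def ext_def sets_measure_of[OF open_subset_Pow])
qed

lemma emeasure_ext_total: "emeasure ext (topspace X) = 1"
  using outer_clopen[OF alg.top] emeasure_ext[OF open_sets_ext[OF openin_topspace]] total by simp

lemma finite_measure_ext: "finite_measure ext"
  by (rule finite_measureI) (simp add: emeasure_ext_total)

text \<open>
  Outer regularity holds by construction. Inner regularity is outer regularity of the complement,
  because complements of open sets are compact.
\<close>

lemma regular_ext: "regular_borel_prob X ext"
  unfolding regular_borel_prob_def
proof (intro conjI ballI)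
  interpret finite_measure ext by (rule finite_measure_ext)
  show "sets ext = sets (borel_of X)" by (rule sets_ext)
  show "emeasure ext (space ext) = 1" by (simp add: emeasure_ext_total)
  fix E assume E: "E \<in> sets ext"
  show "emeasure ext E = (INF U\<in>{U. openin X U \<and> E \<subseteq> U}. emeasure ext U)"
    unfolding emeasure_ext[OF E] outer_def[of E]
    by (rule INF_cong) (auto simp: emeasure_ext open_sets_ext outer_open)
  show "emeasure ext E = (SUP K\<in>{K. compactin X K \<and> K \<subseteq> E}. emeasure ext K)"
  proof (rule antisym)
    show "emeasure ext E \<le> (SUP K\<in>{K. compactin X K \<and> K \<subseteq> E}. emeasure ext K)"
    proof (rule ennreal_le_epsilon)
      fix e :: real assume e: "0 < e"
      have E': "topspace X - E \<in> sets ext" using sets.compl_sets[OF E] by simp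
      have "outer (topspace X - E) < outer (topspace X - E) + e"
        using e emeasure_ext[OF E'] emeasure_finite[of "topspace X - E"] by (simp add: less_top)
      then obtain U where U: "openin X U" "topspace X - E \<subseteq> U" "open_content U < outer (topspace X - E) + e"
        by (rule outer_close)
      define K where "K = topspace X - U"
      have K: "K \<in> sets ext" "K \<subseteq> E"
        using sets.compl_sets[OF open_sets_ext[OF U(1)]] U(2) by (auto simp: K_def)
      have "compactin X K"
        using U(1) by (intro closedin_compact_space[OF compact]) (simp add: K_def closedin_diff)
      then have SUP: "emeasure ext K \<le> (SUP K\<in>{K. compactin X K \<and> K \<subseteq> E}. emeasure ext K)"
        using K(2) by (intro SUP_upper) simp
      have "E - K = U - (topspace X - E)"
        using openin_subset[OF U(1)] sets.sets_into_space[OF E] by (auto simp: K_def)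
      then have "measure ext (E - K) = measure ext U - measure ext (topspace X - E)"
        using finite_measure_Diff[OF open_sets_ext[OF U(1)] E' U(2)] by simp
      moreover have "emeasure ext U < emeasure ext (topspace X - E) + e"
        using U by (simp add: emeasure_ext open_sets_ext E' outer_open)
      then have "measure ext U < measure ext (topspace X - E) + e"
        using e by (simp add: emeasure_eq_measure ennreal_plus[symmetric] ennreal_less_iff del: ennreal_plus)
      ultimately have "measure ext E \<le> measure ext K + e"
        using finite_measure_Diff[OF E K(1,2)] by simp
      then have "emeasure ext E \<le> emeasure ext K + e"
        using e by (simp add: emeasure_eq_measure ennreal_plus[symmetric] ennreal_leI del: ennreal_plus)
      also have "\<dots> \<le> (SUP K\<in>{K. compactin X K \<and> K \<subseteq> E}. emeasure ext K) + e"
        by (rule add_right_mono[OF SUP])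
      finally show "emeasure ext E \<le> (SUP K\<in>{K. compactin X K \<and> K \<subseteq> E}. emeasure ext K) + e" .
    qed
    show "(SUP K\<in>{K. compactin X K \<and> K \<subseteq> E}. emeasure ext K) \<le> emeasure ext E"
      by (rule SUP_least) (auto intro: emeasure_mono[OF _ E])
  qed
qed

lemma measure_ext_clopen: "B \<in> \<B> \<Longrightarrow> measure ext B = \<nu> B"
  using outer_clopen[of B] emeasure_ext[OF open_sets_ext[OF clopen_open]] nonneg[of B]
  by (simp add: measure_def)

text \<open>
  By inner regularity the measure of \<open>U\<close> is approximated on compact subsets, and a clopen set fits
  between such a subset and \<open>U\<close>. So the values on open sets, and by outer regularity the whole
  measure, are determined by \<open>\<nu>\<close>.
\<close>

lemma regular_extension_open:
  assumes m: "regular_borel_prob X m" "\<And>B. B \<in> \<B> \<Longrightarrow> measure m B = \<nu> B" and U: "openin X U"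
  shows "emeasure m U = open_content U"
proof -
  have sets: "sets m = sets (borel_of X)" and one: "emeasure m (space m) = 1"
    using m(1) by (auto simp: regular_borel_prob_def)
  interpret finite_measure m by (rule finite_measureI) (simp add: one)
  have open_sets: "V \<in> sets m" if "openin X V" for V
    unfolding sets borel_of_def using that by (simp add: open_subset_Pow sigma_sets.Basic)
  have em: "emeasure m B = ennreal (\<nu> B)" if "B \<in> \<B>" for B
    using m(2)[OF that] by (simp add: emeasure_eq_measure)
  show ?thesis
  proof (rule antisym)
    have "emeasure m U = (SUP K\<in>{K. compactin X K \<and> K \<subseteq> U}. emeasure m K)"
      using m(1) open_sets[OF U] unfolding regular_borel_prob_def by blast
    also have "\<dots> \<le> open_content U"
    proof (rule SUP_least)
      fix K assume "K \<in> {K. compactin X K \<and> K \<subseteq> U}"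
      then obtain B where B: "B \<in> \<B>" "K \<subseteq> B" "B \<subseteq> U" using compact_clopen_between U by blast
      have "emeasure m K \<le> emeasure m B" using B by (intro emeasure_mono open_sets clopen_open)
      also have "\<dots> \<le> open_content U" using B by (simp add: em open_content_upper)
      finally show "emeasure m K \<le> open_content U" .
    qed
    finally show "emeasure m U \<le> open_content U" .
    show "open_content U \<le> emeasure m U"
      unfolding open_content_def
      by (rule SUP_least) (auto simp: em[symmetric] intro!: emeasure_mono open_sets U)
  qed
qed

theorem regular_extension_unique:
  "\<exists>!m. regular_borel_prob X m \<and> (\<forall>B\<in>\<B>. measure m B = \<nu> B)"
proof (rule ex1I[of _ ext])
  show "regular_borel_prob X ext \<and> (\<forall>B\<in>\<B>. measure ext B = \<nu> B)"
    by (simp add: regular_ext measure_ext_clopen)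
  fix m assume m: "regular_borel_prob X m \<and> (\<forall>B\<in>\<B>. measure m B = \<nu> B)"
  have reg: "emeasure m' E = (INF U\<in>{U. openin X U \<and> E \<subseteq> U}. open_content U)"
    if m': "regular_borel_prob X m' \<and> (\<forall>B\<in>\<B>. measure m' B = \<nu> B)" and E: "E \<in> sets m'" for m' E
  proof -
    have "emeasure m' E = (INF U\<in>{U. openin X U \<and> E \<subseteq> U}. emeasure m' U)"
      using m' E unfolding regular_borel_prob_def by blast
    also have "\<dots> = (INF U\<in>{U. openin X U \<and> E \<subseteq> U}. open_content U)"
      using m' by (intro INF_cong refl regular_extension_open) auto
    finally show ?thesis .
  qed
  have "sets m = sets ext" using m by (simp add: sets_ext regular_borel_prob_def)
  then show "m = ext"
  proof (rule measure_eqI)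
    fix E assume "E \<in> sets m"
    then show "emeasure m E = emeasure ext E"
      using reg[OF m] reg[of ext E] \<open>sets m = sets ext\<close> regular_ext measure_ext_clopen by simp
  qed
qed

end

section \<open>Keisler measures as Borel measures\<close>

lemma type_nbhd_cong_iff:
  assumes "\<phi> \<in> formulas L \<MM> A Y" "\<psi> \<in> formulas L \<MM> A Y"
  shows "type_nbhd L \<MM> A Y \<phi> = type_nbhd L \<MM> A Y \<psi> \<longleftrightarrow> (\<forall>b. assigns \<MM> Y b \<longrightarrow> (sat \<MM> b \<phi> \<longleftrightarrow> sat \<MM> b \<psi>))"
  unfolding set_eq_subset type_nbhd_subset_iff[OF assms] type_nbhd_subset_iff[OF assms(2,1)] by blast

lemma keisler_nonneg:
  assumes "keisler L \<GG> x A \<mu>" "\<phi> \<in> formulas L \<GG> A {x}"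
  shows "0 \<le> \<mu> \<phi>"
proof -
  have "\<forall>\<phi>\<in>formulas L \<GG> A {x}. 0 \<le> \<mu> \<phi>"
    using assms(1) unfolding keisler_def by (elim conjE)
  then show ?thesis using assms(2) by (rule bspec)
qed

lemma keisler_total: "keisler L \<GG> x A \<mu> \<Longrightarrow> \<mu> (Neg Fls) = 1"
  unfolding keisler_def by (elim conjE)

lemma keisler_cong:
  assumes "keisler L \<GG> x A \<mu>" "\<phi> \<in> formulas L \<GG> A {x}" "\<psi> \<in> formulas L \<GG> A {x}"
    and "\<And>b. assigns \<GG> {x} b \<Longrightarrow> sat \<GG> b \<phi> \<longleftrightarrow> sat \<GG> b \<psi>"
  shows "\<mu> \<phi> = \<mu> \<psi>"
proof -
  have "\<forall>\<phi>\<in>formulas L \<GG> A {x}. \<forall>\<psi>\<in>formulas L \<GG> A {x}.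
      (\<forall>b. assigns \<GG> {x} b \<longrightarrow> (sat \<GG> b \<phi> \<longleftrightarrow> sat \<GG> b \<psi>)) \<longrightarrow> \<mu> \<phi> = \<mu> \<psi>"
    using assms(1) unfolding keisler_def by (elim conjE)
  from this[THEN bspec, OF assms(2), THEN bspec, OF assms(3)] show ?thesis
    by (rule mp) (intro allI impI assms(4))
qed

lemma keisler_add:
  assumes "keisler L \<GG> x A \<mu>" "\<phi> \<in> formulas L \<GG> A {x}" "\<psi> \<in> formulas L \<GG> A {x}"
    and "\<And>b. assigns \<GG> {x} b \<Longrightarrow> \<not> (sat \<GG> b \<phi> \<and> sat \<GG> b \<psi>)"
  shows "\<mu> (Disj \<phi> \<psi>) = \<mu> \<phi> + \<mu> \<psi>"
proof -
  have "\<forall>\<phi>\<in>formulas L \<GG> A {x}. \<forall>\<psi>\<in>formulas L \<GG> A {x}.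
      (\<forall>b. assigns \<GG> {x} b \<longrightarrow> \<not> (sat \<GG> b \<phi> \<and> sat \<GG> b \<psi>)) \<longrightarrow> \<mu> (Disj \<phi> \<psi>) = \<mu> \<phi> + \<mu> \<psi>"
    using assms(1) unfolding keisler_def by (elim conjE)
  from this[THEN bspec, OF assms(2), THEN bspec, OF assms(3)] show ?thesis
    by (rule mp) (intro allI impI assms(4))
qed

lemma keisler_Neg:
  assumes \<mu>: "keisler L \<GG> x A \<mu>" and \<phi>: "\<phi> \<in> formulas L \<GG> A {x}"
  shows "\<mu> \<phi> + \<mu> (Neg \<phi>) = 1"
proof -
  have "\<mu> (Disj \<phi> (Neg \<phi>)) = \<mu> \<phi> + \<mu> (Neg \<phi>)"
    by (rule keisler_add[OF \<mu>]) (simp_all add: \<phi>)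
  moreover have "\<mu> (Disj \<phi> (Neg \<phi>)) = \<mu> (Neg Fls)"
    by (rule keisler_cong[OF \<mu>]) (simp_all add: \<phi>)
  ultimately show ?thesis using keisler_total[OF \<mu>] by simp
qed

lemma keisler_restrict:
  assumes "keisler L \<GG> x A \<mu>" "B \<subseteq> A"
  shows "keisler L \<GG> x B \<mu>"
proof -
  have sub: "\<And>\<phi>. \<phi> \<in> formulas L \<GG> B {x} \<Longrightarrow> \<phi> \<in> formulas L \<GG> A {x}"
    using formulas_mono[OF assms(2) order_refl] by blast
  show ?thesis
    unfolding keisler_def
    by (intro conjI ballI impI)
      (blast intro: keisler_nonneg[OF assms(1)] keisler_total[OF assms(1)] keisler_cong[OF assms(1)]
        keisler_add[OF assms(1)] sub)+
qed

lemma keisler_le_1: "keisler L \<GG> x A \<mu> \<Longrightarrow> \<phi> \<in> formulas L \<GG> A {x} \<Longrightarrow> \<mu> \<phi> \<le> 1"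
  using keisler_Neg[of L \<GG> x A \<mu> \<phi>] keisler_nonneg[of L \<GG> x A \<mu> "Neg \<phi>"] by simp

lemma type_measure_exists:
  assumes \<mu>: "keisler L \<GG> x A \<mu>"
  shows "regular_borel_prob (type_top L \<GG> A {x}) (type_measure L \<GG> x A \<mu>)"
    and "\<phi> \<in> formulas L \<GG> A {x} \<Longrightarrow> measure (type_measure L \<GG> x A \<mu>) (type_nbhd L \<GG> A {x} \<phi>) = \<mu> \<phi>"
proof -
  let ?F = "formulas L \<GG> A {x}" and ?N = "type_nbhd L \<GG> A {x}"
  \<comment> \<open>Formulas defining the same clopen set are equivalent, so the choice does not matter.\<close>
  define \<nu> where "\<nu> U = \<mu> (SOME \<phi>. \<phi> \<in> ?F \<and> ?N \<phi> = U)" for U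
  have \<nu>: "\<nu> (?N \<phi>) = \<mu> \<phi>" if \<phi>: "\<phi> \<in> ?F" for \<phi>
  proof -
    have "(SOME \<psi>. \<psi> \<in> ?F \<and> ?N \<psi> = ?N \<phi>) \<in> ?F \<and> ?N (SOME \<psi>. \<psi> \<in> ?F \<and> ?N \<psi> = ?N \<phi>) = ?N \<phi>"
      by (rule someI[of _ \<phi>]) (simp add: \<phi>)
    then show ?thesis
      unfolding \<nu>_def using type_nbhd_cong_iff[of _ L \<GG> A "{x}" \<phi>] \<phi>
      by (intro keisler_cong[OF \<mu>]) auto
  qed
  have empty: "?N Fls = {}" using type_fin_sat fin_satD[of \<GG> "{x}" _ "{Fls}"] by fastforce
  interpret clopen_content "type_top L \<GG> A {x}" "?N ` ?F" \<nu>
  proof (rule clopen_content.intro)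
    show "compact_space (type_top L \<GG> A {x})" by (rule compact_type_top)
    show "algebra (topspace (type_top L \<GG> A {x})) (?N ` ?F)"
      unfolding algebra_iff_Int topspace_type_top
    proof (intro conjI ballI)
      show "?N ` ?F \<subseteq> Pow (type_space L \<GG> A {x})" by blast
      show "{} \<in> ?N ` ?F" using empty by (intro image_eqI[of _ _ Fls]) simp_all
      fix a assume "a \<in> ?N ` ?F"
      then obtain \<phi> where \<phi>: "\<phi> \<in> ?F" "a = ?N \<phi>" by blast
      then show "type_space L \<GG> A {x} - a \<in> ?N ` ?F"
        by (intro image_eqI[of _ _ "Neg \<phi>"]) (simp_all only: type_nbhd_Neg formulas_Neg)
      fix b assume "b \<in> ?N ` ?F"
      then obtain \<psi> where \<psi>: "\<psi> \<in> ?F" "b = ?N \<psi>" by blast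
      then show "a \<inter> b \<in> ?N ` ?F"
        using \<phi> by (intro image_eqI[of _ _ "Conj \<phi> \<psi>"]) (simp_all only: type_nbhd_Conj formulas_Conj simp_thms)
    qed
    show "openin (type_top L \<GG> A {x}) B" if "B \<in> ?N ` ?F" for B
      using that by (auto intro: openin_type_nbhd)
    show "\<exists>B\<in>?N ` ?F. p \<in> B \<and> B \<subseteq> U" if U: "openin (type_top L \<GG> A {x}) U" "p \<in> U" for U p
    proof -
      obtain \<phi> where \<phi>: "\<phi> \<in> ?F" "\<phi> \<in> p" "?N \<phi> \<subseteq> U" by (rule type_top_base[OF U]) (rule that)
      have "p \<in> type_space L \<GG> A {x}" using openin_subset[OF U(1)] U(2) by auto
      then have "p \<in> ?N \<phi>" using \<phi>(2) by simp
      then show ?thesis using \<phi>(1,3) by (intro bexI[of _ "?N \<phi>"] conjI) simp_all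
    qed
    show "0 \<le> \<nu> B" if "B \<in> ?N ` ?F" for B
    proof -
      obtain \<phi> where "\<phi> \<in> ?F" "B = ?N \<phi>" using \<open>B \<in> ?N ` ?F\<close> by (rule imageE)
      then show ?thesis using \<nu> keisler_nonneg[OF \<mu>] by simp
    qed
    show "\<nu> (B \<union> C) = \<nu> B + \<nu> C" if B: "B \<in> ?N ` ?F" and C: "C \<in> ?N ` ?F" and disj: "B \<inter> C = {}" for B C
    proof -
      obtain \<phi> where \<phi>: "\<phi> \<in> ?F" "B = ?N \<phi>" using B by (rule imageE)
      obtain \<psi> where \<psi>: "\<psi> \<in> ?F" "C = ?N \<psi>" using C by (rule imageE)
      have "?N (Disj \<phi> \<psi>) = B \<union> C"
      proof (rule Set.set_eqI)
        fix p
        show "p \<in> ?N (Disj \<phi> \<psi>) \<longleftrightarrow> p \<in> B \<union> C"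
        proof (cases "p \<in> type_space L \<GG> A {x}")
          case True
          note neg = type_Neg[OF True] and conj = type_Conj[OF True]
          have "Disj \<phi> \<psi> \<in> p \<longleftrightarrow> \<phi> \<in> p \<or> \<psi> \<in> p"
            using \<phi>(1) \<psi>(1) by (simp add: neg conj)
          with True show ?thesis by (simp add: \<phi>(2) \<psi>(2))
        qed (simp add: \<phi>(2) \<psi>(2))
      qed
      moreover have "Disj \<phi> \<psi> \<in> ?F" using \<phi> \<psi> by simp
      ultimately have "\<nu> (B \<union> C) = \<mu> (Disj \<phi> \<psi>)" using \<nu>[of "Disj \<phi> \<psi>"] by simp
      also have "\<dots> = \<mu> \<phi> + \<mu> \<psi>"
      proof -
        have "\<not> (sat \<GG> b \<phi> \<and> sat \<GG> b \<psi>)" if b: "assigns \<GG> {x} b" for b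
        proof
          assume "sat \<GG> b \<phi> \<and> sat \<GG> b \<psi>"
          then have "tp L \<GG> A {x} b \<in> B \<inter> C"
            using \<phi> \<psi> tp_type_space[OF b] by (simp add: tp_def)
          then show False using disj by simp
        qed
        then show ?thesis by (intro keisler_add[OF \<mu> \<phi>(1) \<psi>(1)])
      qed
      finally show ?thesis using \<phi> \<psi> \<nu> by simp
    qed
    have "?N (Neg Fls) = topspace (type_top L \<GG> A {x})" by (subst type_nbhd_Neg) (simp_all add: empty)
    then show "\<nu> (topspace (type_top L \<GG> A {x})) = 1"
      using \<nu>[of "Neg Fls"] keisler_total[OF \<mu>] by simp
  qed
  have "\<exists>!m. regular_borel_prob (type_top L \<GG> A {x}) m \<and> (\<forall>\<phi>\<in>?F. measure m (?N \<phi>) = \<mu> \<phi>)"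
    using regular_extension_unique by (simp add: \<nu>)
  from theI'[OF this]
  have "regular_borel_prob (type_top L \<GG> A {x}) (type_measure L \<GG> x A \<mu>) \<and>
      (\<forall>\<phi>\<in>?F. measure (type_measure L \<GG> x A \<mu>) (?N \<phi>) = \<mu> \<phi>)"
    unfolding type_measure_def .
  then show "regular_borel_prob (type_top L \<GG> A {x}) (type_measure L \<GG> x A \<mu>)"
    and "\<phi> \<in> ?F \<Longrightarrow> measure (type_measure L \<GG> x A \<mu>) (?N \<phi>) = \<mu> \<phi>"
    by blast+
qed

section \<open>Partial elementary maps\<close>

text \<open>
  Elementarity and invariance are formulated for formulas without parameters. Trading the parameters
  of \<open>\<phi>\<close> for fresh variables makes these notions applicable to \<open>\<phi>\<close>.
\<close>

lemma abstraction:
  fixes \<phi> :: "('s, 'f, 'r, 'm) fm"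
  assumes \<phi>: "\<phi> \<in> formulas L \<MM> A V" and "finite B"
  obtains \<nu> :: "'m \<Rightarrow> 's var" and \<phi>0 where "inj_on \<nu> (params \<phi>)" "\<And>a. a \<in> params \<phi> \<Longrightarrow> \<nu> a \<notin> B"
    "\<And>a. fst (\<nu> a) = srt \<MM> a" "\<phi>0 \<in> formulas L \<MM> {} (V \<union> \<nu> ` params \<phi>)"
    "\<And>(\<AA> :: ('s, 'f, 'r, 'm) fo_struct) \<rho>. sat \<AA> \<rho> \<phi>0 \<longleftrightarrow> sat \<AA> \<rho> (ren (\<lambda>a. \<rho> (\<nu> a)) \<phi>)"
proof -
  obtain \<nu> :: "'m \<Rightarrow> 's var" where \<nu>: "inj_on \<nu> (params \<phi>)" "\<And>a. a \<in> params \<phi> \<Longrightarrow> \<nu> a \<notin> B"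
    "\<And>a. fst (\<nu> a) = srt \<MM> a"
    by (rule fresh_names[OF finite_params assms(2), of "\<phi>" "srt \<MM>"]) (rule that)
  have wf: "wf_fm L \<MM> \<phi>" and fv: "free_vars \<phi> \<subseteq> V" using \<phi> by (simp_all add: formulas_def)
  obtain \<phi>0 where \<phi>0: "\<phi>0 \<in> formulas L \<MM> {} (V \<union> \<nu> ` params \<phi>)"
    "\<And>(\<AA> :: ('s, 'f, 'r, 'm) fo_struct) \<sigma> \<rho>. sat \<AA> \<rho> (ren \<sigma> \<phi>0) \<longleftrightarrow>
       sat \<AA> (\<lambda>u. eval \<AA> \<rho> (ren_tm \<sigma> (Var u))) (ren (\<lambda>a. eval \<AA> \<rho> (ren_tm \<sigma> (Var (\<nu> a)))) \<phi>)"
  proof (rule capture_free_substitution[OF wf])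
    show "has_sort L \<MM> (Var v) (fst v) \<and> tm_params (Var v :: ('s, 'f, 'm) tm) \<subseteq> {} \<and>
        tm_vars (Var v :: ('s, 'f, 'm) tm) \<subseteq> V \<union> \<nu> ` params \<phi>" if "v \<in> free_vars \<phi>" for v
      using that fv by (auto simp: has_sort_Var)
    show "has_sort L \<MM> (Var (\<nu> a)) (srt \<MM> a) \<and> tm_params (Var (\<nu> a) :: ('s, 'f, 'm) tm) \<subseteq> {} \<and>
        tm_vars (Var (\<nu> a) :: ('s, 'f, 'm) tm) \<subseteq> V \<union> \<nu> ` params \<phi>" if "a \<in> params \<phi>" for a
      using that by (simp add: has_sort_Var \<nu>(3))
  qed (rule that)
  have "sat \<AA> \<rho> \<phi>0 \<longleftrightarrow> sat \<AA> \<rho> (ren (\<lambda>a. \<rho> (\<nu> a)) \<phi>)" for \<AA> :: "('s, 'f, 'r, 'm) fo_struct" and \<rho>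
    using \<phi>0(2)[of \<AA> \<rho> "\<lambda>a. a"] by (simp add: ren_ident)
  with \<phi>0(1) \<nu> show thesis by (intro that)
qed

text \<open>
  Saturation does not provide automorphisms. Conjugate sets of parameters are therefore compared by
  partial elementary maps, acting on formulas by renaming.
\<close>

definition pelem ::
  "('s, 'f, 'r) lang \<Rightarrow> ('s, 'f, 'r, 'm) fo_struct \<Rightarrow> 'm set \<Rightarrow> ('m \<Rightarrow> 'm) \<Rightarrow> bool" where
  "pelem L \<MM> A \<sigma> \<longleftrightarrow> (\<forall>a\<in>A. \<sigma> a \<in> univ \<MM> \<and> srt \<MM> (\<sigma> a) = srt \<MM> a) \<and>
     (\<forall>\<psi>\<in>formulas L \<MM> A {}. \<forall>\<rho>. sat \<MM> \<rho> \<psi> \<longleftrightarrow> sat \<MM> \<rho> (ren \<sigma> \<psi>))"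

lemma pelem_ident:
  assumes "A \<subseteq> univ \<MM>" "\<And>a. a \<in> A \<Longrightarrow> \<sigma> a = a"
  shows "pelem L \<MM> A \<sigma>"
proof -
  have "ren \<sigma> \<psi> = \<psi>" if "\<psi> \<in> formulas L \<MM> A {}" for \<psi>
    using that assms(2) by (intro ren_ident) (auto simp: formulas_def)
  then show ?thesis unfolding pelem_def using assms by auto
qed

lemma pelem_sat: "pelem L \<MM> A \<sigma> \<Longrightarrow> \<psi> \<in> formulas L \<MM> A {} \<Longrightarrow> sat \<MM> \<rho> \<psi> \<longleftrightarrow> sat \<MM> \<rho> (ren \<sigma> \<psi>)"
  unfolding pelem_def by blast

lemma pelem_srt: "pelem L \<MM> A \<sigma> \<Longrightarrow> a \<in> A \<Longrightarrow> srt \<MM> (\<sigma> a) = srt \<MM> a"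
  unfolding pelem_def by blast

lemma pelem_univ: "pelem L \<MM> A \<sigma> \<Longrightarrow> a \<in> A \<Longrightarrow> \<sigma> a \<in> univ \<MM>"
  unfolding pelem_def by blast

lemma pelem_subset: "pelem L \<MM> A \<sigma> \<Longrightarrow> B \<subseteq> A \<Longrightarrow> pelem L \<MM> B \<sigma>"
  using formulas_mono[of B A "{}" "{}" L \<MM>] unfolding pelem_def by (simp add: subset_iff)

lemma pelem_comp:
  assumes "pelem L \<MM> A \<tau>" "pelem L \<MM> (\<tau> ` A) \<sigma>"
  shows "pelem L \<MM> A (\<lambda>a. \<sigma> (\<tau> a))"
  unfolding pelem_def
proof (intro conjI ballI allI)
  fix \<psi> \<rho> assume \<psi>: "\<psi> \<in> formulas L \<MM> A {}"
  have "ren \<tau> \<psi> \<in> formulas L \<MM> (\<tau> ` A) {}" using \<psi> pelem_srt[OF assms(1)] by (rule ren_formulas)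
  then have "sat \<MM> \<rho> (ren \<tau> \<psi>) \<longleftrightarrow> sat \<MM> \<rho> (ren \<sigma> (ren \<tau> \<psi>))" by (rule pelem_sat[OF assms(2)])
  then show "sat \<MM> \<rho> \<psi> \<longleftrightarrow> sat \<MM> \<rho> (ren (\<lambda>a. \<sigma> (\<tau> a)) \<psi>)"
    using pelem_sat[OF assms(1) \<psi>, of \<rho>] by (simp add: ren_ren)
next
  fix a assume a: "a \<in> A"
  then show "\<sigma> (\<tau> a) \<in> univ \<MM>" using pelem_univ[OF assms(2)] by simp
  show "srt \<MM> (\<sigma> (\<tau> a)) = srt \<MM> a"
    using a pelem_srt[OF assms(2), of "\<tau> a"] pelem_srt[OF assms(1) a] by simp
qed

lemma pelem_inj: 
  assumes "pelem L \<MM> A \<sigma>"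
  shows "inj_on \<sigma> A"
proof (rule inj_onI)
  fix a b assume ab: "a \<in> A" "b \<in> A" "\<sigma> a = \<sigma> b"
  then have "srt \<MM> a = srt \<MM> b" using pelem_srt[OF assms] by metis
  then have "wf_fm L \<MM> (Eq (Par a) (Par b))" by (auto intro!: exI[of _ "srt \<MM> a"] has_sort_Par)
  then have "Eq (Par a) (Par b) \<in> formulas L \<MM> A {}"
    using ab by (simp add: formulas_def)
  from pelem_sat[OF assms this] show "a = b" using ab(3) by simp
qed

lemma pelem_inverse:
  assumes "pelem L \<MM> A \<sigma>" "A \<subseteq> univ \<MM>"
  shows "pelem L \<MM> (\<sigma> ` A) (inv_into A \<sigma>)"
  unfolding pelem_def
proof (intro conjI ballI allI)
  have inv: "inv_into A \<sigma> (\<sigma> a) = a" if "a \<in> A" for a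
    using pelem_inj[OF assms(1)] that by (rule inv_into_f_f)
  fix b assume "b \<in> \<sigma> ` A"
  then show "inv_into A \<sigma> b \<in> univ \<MM>" "srt \<MM> (inv_into A \<sigma> b) = srt \<MM> b"
    using assms inv pelem_srt[OF assms(1)] by auto
next
  have inv: "inv_into A \<sigma> (\<sigma> a) = a" if "a \<in> A" for a
    using pelem_inj[OF assms(1)] that by (rule inv_into_f_f)
  fix \<psi> \<rho> assume \<psi>: "\<psi> \<in> formulas L \<MM> (\<sigma> ` A) {}"
  have "ren (inv_into A \<sigma>) \<psi> \<in> formulas L \<MM> (inv_into A \<sigma> ` \<sigma> ` A) {}"
    by (rule ren_formulas[OF \<psi>]) (auto simp: inv pelem_srt[OF assms(1)])
  moreover have "inv_into A \<sigma> ` \<sigma> ` A = A" using inv by force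
  ultimately have "sat \<MM> \<rho> (ren (inv_into A \<sigma>) \<psi>) \<longleftrightarrow> sat \<MM> \<rho> (ren \<sigma> (ren (inv_into A \<sigma>) \<psi>))"
    using pelem_sat[OF assms(1)] by simp
  also have "ren \<sigma> (ren (inv_into A \<sigma>) \<psi>) = \<psi>"
    unfolding ren_ren using \<psi> by (intro ren_ident f_inv_into_f) (auto simp: formulas_def)
  finally show "sat \<MM> \<rho> \<psi> \<longleftrightarrow> sat \<MM> \<rho> (ren (inv_into A \<sigma>) \<psi>)" by simp
qed

text \<open>
  A sentence about \<open>h\<close> and elements of \<open>A\<close> is a formula over \<open>A\<close> evaluated at \<open>h\<close>: replace \<open>h\<close> by a
  variable.
\<close>

lemma pelem_insert:
  fixes L :: "('s, 'f, 'r) lang" and \<MM> :: "('s, 'f, 'r, 'm) fo_struct"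
  assumes \<sigma>: "pelem L \<MM> A \<sigma>" and srt: "srt \<MM> h = fst v" "srt \<MM> g = fst v" and g: "g \<in> univ \<MM>"
    and eq: "\<And>\<psi>. \<psi> \<in> formulas L \<MM> A {v} \<Longrightarrow> sat \<MM> (\<lambda>_. h) \<psi> \<longleftrightarrow> sat \<MM> (\<lambda>_. g) (ren \<sigma> \<psi>)"
  shows "pelem L \<MM> (insert h A) (\<sigma>(h := g))" and "h \<in> A \<Longrightarrow> \<sigma> h = g"
proof -
  show *: "\<sigma> h = g" if "h \<in> A"
  proof -
    have "wf_fm L \<MM> (Eq (Var v) (Par h))" using srt(1) by (auto intro!: exI[of _ "fst v"] has_sort_Par has_sort_Var)
    then have "Eq (Var v) (Par h) \<in> formulas L \<MM> A {v}" using that by (simp add: formulas_def)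
    from eq[OF this] show ?thesis by simp
  qed
  show "pelem L \<MM> (insert h A) (\<sigma>(h := g))"
  proof (cases "h \<in> A")
    case True
    then have "insert h A = A" "\<sigma>(h := g) = \<sigma>" using * by (auto simp: fun_upd_idem)
    then show ?thesis using \<sigma> by simp
  next
    case False
    have "sat \<MM> \<rho> \<psi> \<longleftrightarrow> sat \<MM> \<rho> (ren (\<sigma>(h := g)) \<psi>)" if \<psi>: "\<psi> \<in> formulas L \<MM> (insert h A) {}" for \<psi> \<rho>
    proof -
      define \<pi> :: "'m \<Rightarrow> ('s, 'f, 'm) tm" where "\<pi> = Par(h := Var v)"
      have \<psi>': "wf_fm L \<MM> \<psi>" "free_vars \<psi> = {}" "params \<psi> \<subseteq> insert h A" using \<psi> by (simp_all add: formulas_def)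
      obtain \<psi>0 where \<psi>0: "\<psi>0 \<in> formulas L \<MM> A {v}"
        "\<And>(\<AA> :: ('s, 'f, 'r, 'm) fo_struct) \<sigma> \<rho>. sat \<AA> \<rho> (ren \<sigma> \<psi>0) \<longleftrightarrow>
          sat \<AA> (\<lambda>u. eval \<AA> \<rho> (ren_tm \<sigma> (Var u))) (ren (\<lambda>a. eval \<AA> \<rho> (ren_tm \<sigma> (\<pi> a))) \<psi>)"
      proof (rule capture_free_substitution[OF \<psi>'(1)])
        show "has_sort L \<MM> (\<pi> a) (srt \<MM> a) \<and> tm_params (\<pi> a) \<subseteq> A \<and> tm_vars (\<pi> a) \<subseteq> {v}"
          if "a \<in> params \<psi>" for a
          using that \<psi>'(3) by (auto simp: \<pi>_def has_sort_Var has_sort_Par srt(1))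
      qed (use \<psi>'(2) in simp, rule that)
      from eq[OF \<psi>0(1)] have "sat \<MM> (\<lambda>_. h) (ren (\<lambda>a. a) \<psi>0) \<longleftrightarrow> sat \<MM> (\<lambda>_. g) (ren \<sigma> \<psi>0)"
        by (simp add: ren_ident)
      moreover have "ren (\<lambda>a. eval \<MM> (\<lambda>_. h) (ren_tm (\<lambda>a. a) (\<pi> a))) \<psi> = \<psi>"
        by (rule ren_ident) (simp add: \<pi>_def)
      moreover have "ren (\<lambda>a. eval \<MM> (\<lambda>_. g) (ren_tm \<sigma> (\<pi> a))) \<psi> = ren (\<sigma>(h := g)) \<psi>"
        by (rule ren_cong) (simp add: \<pi>_def)
      ultimately have "sat \<MM> (\<lambda>u. h) \<psi> \<longleftrightarrow> sat \<MM> (\<lambda>u. g) (ren (\<sigma>(h := g)) \<psi>)"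
        unfolding \<psi>0(2) by simp
      then show ?thesis
        using sat_sentence[of \<psi> \<MM> \<rho> "\<lambda>_. h"] sat_sentence[of "ren (\<sigma>(h := g)) \<psi>" \<MM> \<rho> "\<lambda>_. g"] \<psi>'(2) by simp
    qed
    then show ?thesis
      using \<sigma> srt g unfolding pelem_def by auto
  qed
qed

text \<open>
  The definition of invariance speaks of finite tuples listed by variables. With parameters named
  by elements, it says that membership in the type is preserved by elementary renamings.
\<close>

lemma invariant_ren:
  assumes p: "p \<in> type_space L \<MM> (univ \<MM>) {x}" and inv: "invariant L \<MM> x M p" and M: "M \<subseteq> univ \<MM>"
    and \<phi>: "\<phi> \<in> formulas L \<MM> (univ \<MM>) {x}" and \<sigma>: "pelem L \<MM> (M \<union> params \<phi>) \<sigma>"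
    and id: "\<And>m. m \<in> M \<Longrightarrow> \<sigma> m = m"
  shows "\<phi> \<in> p \<longleftrightarrow> ren \<sigma> \<phi> \<in> p"
proof -
  obtain \<nu> \<phi>0 where \<nu>: "inj_on \<nu> (params \<phi>)" "\<And>a. a \<in> params \<phi> \<Longrightarrow> \<nu> a \<notin> {x}"
    "\<And>a. fst (\<nu> a) = srt \<MM> a" and \<phi>0: "\<phi>0 \<in> formulas L \<MM> {} ({x} \<union> \<nu> ` params \<phi>)"
    and sem: "\<And>\<rho>. sat \<MM> \<rho> \<phi>0 \<longleftrightarrow> sat \<MM> \<rho> (ren (\<lambda>a. \<rho> (\<nu> a)) \<phi>)"
    by (rule abstraction[OF \<phi>, of "{x}"]) (simp, rule that)
  define Y where "Y = \<nu> ` params \<phi>"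
  define b where "b = inv_into (params \<phi>) \<nu>"
  define b' where "b' v = \<sigma> (b v)" for v
  have b: "b (\<nu> a) = a" if "a \<in> params \<phi>" for a
    unfolding b_def using \<nu>(1) that by (rule inv_into_f_f)
  have par: "params \<phi> \<subseteq> univ \<MM>" "free_vars \<phi> \<subseteq> {x}" using \<phi> by (simp_all add: formulas_def)
  have Y: "finite Y" "x \<notin> Y" using \<nu>(2) by (auto simp: Y_def)
  have as: "assigns \<MM> Y b" using b \<nu>(3) par(1) by (auto simp: assigns_def Y_def sort_univ_def)
  have as': "assigns \<MM> Y b'"
    using b \<nu>(3) pelem_univ[OF \<sigma>] pelem_srt[OF \<sigma>] by (auto simp: assigns_def Y_def sort_univ_def b'_def)
  have bY: "b ` Y \<subseteq> params \<phi>" using b by (auto simp: Y_def)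
  have "sat \<MM> b \<psi> \<longleftrightarrow> sat \<MM> b' \<psi>" if \<psi>: "\<psi> \<in> formulas L \<MM> M Y" for \<psi>
  proof -
    have fv: "free_vars \<psi> \<subseteq> Y" and pM: "params \<psi> \<subseteq> M" using \<psi> by (simp_all add: formulas_def)
    have "\<psi> \<in> formulas L \<MM> (M \<union> params \<phi>) ({} \<union> Y)" using \<psi> formulas_mono[of M "M \<union> params \<phi>" Y Y] by auto
    then have "inst Y b \<psi> \<in> formulas L \<MM> (M \<union> params \<phi>) {}"
      by (rule inst_formulas[OF _ as]) (use bY in auto)
    then have "sat \<MM> b (inst Y b \<psi>) \<longleftrightarrow> sat \<MM> b (ren \<sigma> (inst Y b \<psi>))" by (rule pelem_sat[OF \<sigma>])
    moreover have "ren \<sigma> (inst Y b \<psi>) = inst Y b' \<psi>"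
      unfolding ren_inst b'_def[symmetric] using pM id by (subst ren_ident) auto
    moreover have "sat \<MM> b (inst Y b \<psi>) \<longleftrightarrow> sat \<MM> b \<psi>" by (simp add: sat_inst)
    moreover have "sat \<MM> b (inst Y b' \<psi>) \<longleftrightarrow> sat \<MM> b' \<psi>"
      unfolding sat_inst using fv by (intro sat_cong) auto
    ultimately show ?thesis by simp
  qed
  then have "tp L \<MM> M Y b = tp L \<MM> M Y b'" unfolding tp_def by blast
  moreover have \<phi>0': "\<phi>0 \<in> formulas L \<MM> {} (insert x Y)" using \<phi>0 by (simp add: Y_def)
  ultimately have iff: "inst Y b \<phi>0 \<in> p \<longleftrightarrow> inst Y b' \<phi>0 \<in> p"
    using inv Y as as' unfolding invariant_def by blast
  have \<phi>0u: "\<phi>0 \<in> formulas L \<MM> (univ \<MM>) ({x} \<union> Y)"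
    using \<phi>0' formulas_mono[of "{}" "univ \<MM>" "insert x Y" "insert x Y"] by auto
  have form: "inst Y c \<phi>0 \<in> formulas L \<MM> (univ \<MM>) {x}" if "assigns \<MM> Y c" for c
    using \<phi>0u that by (rule inst_formulas) (use that in \<open>auto simp: assigns_def sort_univ_def\<close>)
  have sat: "sat \<MM> \<rho> (inst Y c \<phi>0) \<longleftrightarrow> sat \<MM> \<rho> (ren (\<lambda>a. c (\<nu> a)) \<phi>)" for c \<rho>
  proof -
    have "ren (\<lambda>a. if \<nu> a \<in> Y then c (\<nu> a) else \<rho> (\<nu> a)) \<phi> = ren (\<lambda>a. c (\<nu> a)) \<phi>"
      by (rule ren_cong) (simp add: Y_def)
    then show ?thesis
      unfolding sat_inst sem using par(2) Y(2) by (intro trans[OF sat_cong arg_cong[where f = "sat \<MM> \<rho>"]]) auto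
  qed
  have "ren (\<lambda>a. b (\<nu> a)) \<phi> = \<phi>" by (rule ren_ident) (rule b)
  then have 1: "inst Y b \<phi>0 \<in> p \<longleftrightarrow> \<phi> \<in> p"
    by (intro type_cong[OF p form[OF as] \<phi>]) (simp add: sat)
  have "ren (\<lambda>a. b' (\<nu> a)) \<phi> = ren \<sigma> \<phi>" by (rule ren_cong) (simp add: b'_def b)
  moreover have "ren \<sigma> \<phi> \<in> formulas L \<MM> (univ \<MM>) {x}"
  proof -
    have "\<phi> \<in> formulas L \<MM> (params \<phi>) {x}" using \<phi> by (simp add: formulas_def)
    then have "ren \<sigma> \<phi> \<in> formulas L \<MM> (\<sigma> ` params \<phi>) {x}"
      by (rule ren_formulas) (simp add: pelem_srt[OF \<sigma>])
    moreover have "\<sigma> ` params \<phi> \<subseteq> univ \<MM>" using pelem_univ[OF \<sigma>] by auto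
    ultimately show ?thesis using formulas_mono[OF _ order_refl] by blast
  qed
  ultimately have 2: "inst Y b' \<phi>0 \<in> p \<longleftrightarrow> ren \<sigma> \<phi> \<in> p"
    by (intro type_cong[OF p form[OF as']]) (simp_all add: sat)
  show ?thesis using iff 1 2 by simp
qed

text \<open>
  The map sends each entry of \<open>b'\<close> to the corresponding entry of \<open>b\<close>. It is well defined, because the
  type of a tuple over \<open>M\<close> records which entries are equal to each other or to elements of \<open>M\<close>.
\<close>

lemma tp_eq_pelem:
  fixes L :: "('s, 'f, 'r) lang" and \<MM> :: "('s, 'f, 'r, 'm) fo_struct"
  assumes M: "M \<subseteq> univ \<MM>" and as: "assigns \<MM> Y b" "assigns \<MM> Y b'"
    and tp: "tp L \<MM> M Y b = tp L \<MM> M Y b'"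
  obtains \<tau> where "pelem L \<MM> (M \<union> b' ` Y) \<tau>" "\<And>m. m \<in> M \<Longrightarrow> \<tau> m = m" "\<And>v. v \<in> Y \<Longrightarrow> \<tau> (b' v) = b v"
proof -
  have eq: "sat \<MM> b \<psi> \<longleftrightarrow> sat \<MM> b' \<psi>" if "\<psi> \<in> formulas L \<MM> M Y" for \<psi>
    using tp that unfolding tp_def by blast
  \<comment> \<open>The tuple may list an element more than once; \<open>c\<close> picks one of its variables.\<close>
  define c where "c a = (SOME v. v \<in> Y \<and> b' v = a)" for a
  have c: "c (b' v) \<in> Y \<and> b' (c (b' v)) = b' v" if "v \<in> Y" for v
    unfolding c_def by (rule someI[of _ v]) (simp add: that)
  define \<tau> where "\<tau> a = (if a \<in> M then a else b (c a))" for a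
  have srt: "srt \<MM> (b v) = fst v" "srt \<MM> (b' v) = fst v" "b v \<in> univ \<MM>" "b' v \<in> univ \<MM>" if "v \<in> Y" for v
    using that as by (auto simp: assigns_def sort_univ_def)
  have \<tau>b: "\<tau> (b' v) = b v" if v: "v \<in> Y" for v
  proof (cases "b' v \<in> M")
    case True
    have "wf_fm L \<MM> (Eq (Var v) (Par (b' v)))"
      using srt(2)[OF v] by (auto intro!: exI[of _ "fst v"] has_sort_Par has_sort_Var)
    then have "Eq (Var v) (Par (b' v)) \<in> formulas L \<MM> M Y" using v True by (simp add: formulas_def)
    from eq[OF this] show ?thesis using True by (simp add: \<tau>_def)
  next
    case False
    have "fst (c (b' v)) = fst v" using srt(2)[of "c (b' v)"] srt(2)[OF v] c[OF v] by simp
    then have "wf_fm L \<MM> (Eq (Var v) (Var (c (b' v))))"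
      by (auto intro!: exI[of _ "fst v"] has_sort_Var)
    then have "Eq (Var v) (Var (c (b' v))) \<in> formulas L \<MM> M Y" using v c[OF v] by (simp add: formulas_def)
    from eq[OF this] show ?thesis using False c[OF v] by (simp add: \<tau>_def)
  qed
  have "pelem L \<MM> (M \<union> b' ` Y) \<tau>"
    unfolding pelem_def
  proof (intro conjI ballI allI)
    fix a assume "a \<in> M \<union> b' ` Y"
    then consider "a \<in> M" | v where "v \<in> Y" "a = b' v" by blast
    then show "\<tau> a \<in> univ \<MM>" "srt \<MM> (\<tau> a) = srt \<MM> a"
      by (cases; use M \<tau>b srt in \<open>auto simp: \<tau>_def\<close>)+
  next
    fix \<psi> \<rho> assume \<psi>: "\<psi> \<in> formulas L \<MM> (M \<union> b' ` Y) {}"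
    define \<pi> :: "'m \<Rightarrow> ('s, 'f, 'm) tm" where "\<pi> a = (if a \<in> M then Par a else Var (c a))" for a
    have \<psi>': "wf_fm L \<MM> \<psi>" "free_vars \<psi> = {}" "params \<psi> \<subseteq> M \<union> b' ` Y" using \<psi> by (simp_all add: formulas_def)
    have cY: "c a \<in> Y \<and> b' (c a) = a" if a: "a \<in> params \<psi>" "a \<notin> M" for a
    proof -
      obtain v where "v \<in> Y" "a = b' v" using a \<psi>'(3) by blast
      then show ?thesis using c by simp
    qed
    obtain \<psi>0 where \<psi>0: "\<psi>0 \<in> formulas L \<MM> M Y"
      "\<And>(\<AA> :: ('s, 'f, 'r, 'm) fo_struct) \<sigma> \<rho>. sat \<AA> \<rho> (ren \<sigma> \<psi>0) \<longleftrightarrow>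
        sat \<AA> (\<lambda>u. eval \<AA> \<rho> (ren_tm \<sigma> (Var u))) (ren (\<lambda>a. eval \<AA> \<rho> (ren_tm \<sigma> (\<pi> a))) \<psi>)"
    proof (rule capture_free_substitution[OF \<psi>'(1)])
      show "has_sort L \<MM> (\<pi> a) (srt \<MM> a) \<and> tm_params (\<pi> a) \<subseteq> M \<and> tm_vars (\<pi> a) \<subseteq> Y"
        if "a \<in> params \<psi>" for a
      proof (cases "a \<in> M")
        case False
        then have "srt \<MM> a = fst (c a)" using cY[OF that False] srt(2)[of "c a"] by simp
        then show ?thesis using False cY[OF that False] by (simp add: \<pi>_def has_sort_Var)
      qed (simp add: \<pi>_def has_sort_Par)
    qed (use \<psi>'(2) in simp, rule that)
    from eq[OF \<psi>0(1)] have "sat \<MM> b (ren (\<lambda>a. a) \<psi>0) \<longleftrightarrow> sat \<MM> b' (ren (\<lambda>a. a) \<psi>0)"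
      by (simp add: ren_ident)
    moreover have "ren (\<lambda>a. eval \<MM> b' (ren_tm (\<lambda>a. a) (\<pi> a))) \<psi> = \<psi>"
      by (rule ren_ident) (simp add: \<pi>_def cY)
    moreover have "ren (\<lambda>a. eval \<MM> b (ren_tm (\<lambda>a. a) (\<pi> a))) \<psi> = ren \<tau> \<psi>"
      by (rule ren_cong) (simp add: \<pi>_def \<tau>_def)
    ultimately have "sat \<MM> b (ren \<tau> \<psi>) \<longleftrightarrow> sat \<MM> b' \<psi>" unfolding \<psi>0(2) by simp
    then show "sat \<MM> \<rho> \<psi> \<longleftrightarrow> sat \<MM> \<rho> (ren \<tau> \<psi>)"
      using sat_sentence[of \<psi> \<MM> \<rho> b'] sat_sentence[of "ren \<tau> \<psi>" \<MM> \<rho> b] \<psi>'(2) by simp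
  qed
  then show thesis using \<tau>b by (intro that[of \<tau>]) (simp_all add: \<tau>_def)
qed

section \<open>Invariant extensions and products of types\<close>

locale monster_pair =
  fixes L :: "('s, 'f, 'r) lang" and \<GG> \<HH> :: "('s, 'f, 'r, 'm) fo_struct"
    and \<kappa> :: "'k rel" and \<kappa>' :: "'l rel" and mul :: 'f and x :: "'s var"
  assumes mon: "monster L \<kappa> \<GG>" and mon': "monster L \<kappa>' \<HH>"
    and small_univ: "small \<kappa>' (univ \<GG>)" and elem: "elementary L \<GG> \<HH>"
    and mul: "funs L mul = Some ([fst x, fst x], fst x)"
    and grp: "group_on mul x \<GG>"
begin

abbreviation forms :: "'m set \<Rightarrow> ('s, 'f, 'r, 'm) fm set" where
  "forms A \<equiv> formulas L \<GG> A {x}"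

abbreviation types :: "'m set \<Rightarrow> ('s, 'f, 'r, 'm) fm set set" where
  "types A \<equiv> type_space L \<GG> A {x}"

abbreviation grp_elems :: "'m set" where
  "grp_elems \<equiv> sort_univ \<GG> (fst x)"

abbreviation shift :: "'m \<Rightarrow> ('s, 'f, 'r, 'm) fm \<Rightarrow> ('s, 'f, 'r, 'm) fm" where
  "shift \<equiv> translate mul x"

lemma sub: "univ \<GG> \<subseteq> univ \<HH>" and srt_eq: "a \<in> univ \<GG> \<Longrightarrow> srt \<HH> a = srt \<GG> a"
  using elem unfolding elementary_def by auto

lemma sort_univ_iff: "a \<in> sort_univ \<GG> s \<longleftrightarrow> a \<in> sort_univ \<HH> s \<and> a \<in> univ \<GG>"
  using sub srt_eq by (auto simp: sort_univ_def)

lemma formulas_eq: "A \<subseteq> univ \<GG> \<Longrightarrow> formulas L \<HH> A Y = formulas L \<GG> A Y"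
proof -
  assume A: "A \<subseteq> univ \<GG>"
  have "wf_fm L \<HH> \<phi> \<longleftrightarrow> wf_fm L \<GG> \<phi>" if "params \<phi> \<subseteq> A" for \<phi> :: "('s, 'f, 'r, 'm) fm"
  proof -
    have "\<forall>a\<in>params \<phi>. srt \<HH> a = srt \<GG> a" using that A srt_eq by blast
    then show ?thesis
      using wf_ren[of L \<HH> \<phi> \<GG> "\<lambda>a. a"] wf_ren[of L \<GG> \<phi> \<HH> "\<lambda>a. a"] by (auto simp: ren_ident)
  qed
  then show ?thesis unfolding formulas_def by auto
qed

text \<open>
  Parameters become values of fresh variables, and the remaining variables receive arbitrary values
  of the right sort, since elementarity is stated for total assignments.
\<close>

lemma sat_transfer:
  assumes \<phi>: "\<phi> \<in> formulas L \<GG> (univ \<GG>) V" and \<rho>: "\<And>v. v \<in> free_vars \<phi> \<Longrightarrow> \<rho> v \<in> sort_univ \<GG> (fst v)"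
  shows "sat \<GG> \<rho> \<phi> \<longleftrightarrow> sat \<HH> \<rho> \<phi>"
proof -
  obtain \<nu> \<phi>0 where \<nu>: "inj_on \<nu> (params \<phi>)" "\<And>a. a \<in> params \<phi> \<Longrightarrow> \<nu> a \<notin> free_vars \<phi>"
    "\<And>a. fst (\<nu> a) = srt \<GG> a" and \<phi>0: "\<phi>0 \<in> formulas L \<GG> {} (V \<union> \<nu> ` params \<phi>)"
    and sem: "\<And>(\<AA> :: ('s, 'f, 'r, 'm) fo_struct) \<rho>. sat \<AA> \<rho> \<phi>0 \<longleftrightarrow> sat \<AA> \<rho> (ren (\<lambda>a. \<rho> (\<nu> a)) \<phi>)"
    by (rule abstraction[OF \<phi>, of "free_vars \<phi>"]) (simp, rule that)
  define \<rho>' where "\<rho>' v = (if v \<in> \<nu> ` params \<phi> then inv_into (params \<phi>) \<nu> v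
    else if v \<in> free_vars \<phi> then \<rho> v else SOME a. a \<in> sort_univ \<GG> (fst v))" for v
  have \<nu>': "\<rho>' (\<nu> a) = a" if "a \<in> params \<phi>" for a
    using that \<nu>(1) by (simp add: \<rho>'_def)
  have "\<rho>' v \<in> sort_univ \<GG> (fst v)" for v
  proof (cases "v \<in> \<nu> ` params \<phi>")
    case True
    then obtain a where "a \<in> params \<phi>" "v = \<nu> a" by blast
    then show ?thesis using \<nu>' \<nu>(3) \<phi> by (auto simp: sort_univ_def formulas_def)
  next
    case False
    have "sort_univ \<GG> (fst v) \<noteq> {}" using mon by (simp add: monster_def fo_structure_def)
    then have "(SOME a. a \<in> sort_univ \<GG> (fst v)) \<in> sort_univ \<GG> (fst v)" by (simp add: some_in_eq)
    then show ?thesis using False \<rho> by (simp add: \<rho>'_def)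
  qed
  then have as: "assigns \<GG> UNIV \<rho>'" by (simp add: assigns_def)
  have "\<phi>0 \<in> formulas L \<GG> {} UNIV" using \<phi>0 by (simp add: formulas_def)
  then have "sat \<GG> \<rho>' \<phi>0 \<longleftrightarrow> sat \<HH> \<rho>' \<phi>0" using elem as unfolding elementary_def by blast
  moreover have "ren (\<lambda>a. \<rho>' (\<nu> a)) \<phi> = \<phi>" by (rule ren_ident) (rule \<nu>')
  moreover have "sat \<AA> \<rho>' \<phi> \<longleftrightarrow> sat \<AA> \<rho> \<phi>" for \<AA> :: "('s, 'f, 'r, 'm) fo_struct"
    using \<nu>(2) by (intro sat_cong) (auto simp: \<rho>'_def)
  ultimately show ?thesis by (simp add: sem)
qed

lemma pelem_down:
  assumes "pelem L \<HH> A \<sigma>" "A \<subseteq> univ \<GG>" "\<sigma> ` A \<subseteq> univ \<GG>"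
  shows "pelem L \<GG> A \<sigma>"
  unfolding pelem_def
proof (intro conjI ballI allI)
  fix a assume a: "a \<in> A"
  then show "\<sigma> a \<in> univ \<GG>" using assms(3) by blast
  then show "srt \<GG> (\<sigma> a) = srt \<GG> a"
    using pelem_srt[OF assms(1) a] srt_eq[of a] srt_eq[of "\<sigma> a"] a assms(2) by auto
next
  fix \<psi> \<rho> assume \<psi>: "\<psi> \<in> formulas L \<GG> A {}"
  then have \<psi>H: "\<psi> \<in> formulas L \<HH> A {}" by (simp add: formulas_eq[OF assms(2)])
  then have "ren \<sigma> \<psi> \<in> formulas L \<HH> (\<sigma> ` A) {}" using pelem_srt[OF assms(1)] by (rule ren_formulas)
  then have "ren \<sigma> \<psi> \<in> formulas L \<GG> (univ \<GG>) {}"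
    using formulas_eq[OF assms(3)] formulas_mono[OF assms(3) order_refl] by blast
  moreover have "\<psi> \<in> formulas L \<GG> (univ \<GG>) {}" using \<psi> formulas_mono[OF assms(2) order_refl] by blast
  ultimately have "sat \<GG> \<rho> \<psi> \<longleftrightarrow> sat \<HH> \<rho> \<psi>" "sat \<GG> \<rho> (ren \<sigma> \<psi>) \<longleftrightarrow> sat \<HH> \<rho> (ren \<sigma> \<psi>)"
    by (auto intro!: sat_transfer simp: formulas_def)
  then show "sat \<GG> \<rho> \<psi> \<longleftrightarrow> sat \<GG> \<rho> (ren \<sigma> \<psi>)" using pelem_sat[OF assms(1) \<psi>H] by simp
qed

text \<open>
  Each finite part of the type of \<open>h\<close> over \<open>A\<close> has its satisfiability expressed by an existential
  sentence, which \<open>\<sigma>\<close> preserves. So the renamed type is finitely satisfiable in \<open>\<GG>\<close>, and saturation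
  yields \<open>g\<close>.
\<close>

lemma pelem_extend:
  assumes A: "A \<subseteq> univ \<HH>" and \<sigma>: "pelem L \<HH> A \<sigma>" "\<sigma> ` A \<subseteq> univ \<GG>" and sm: "small \<kappa> (\<sigma> ` A)"
    and h: "h \<in> univ \<HH>"
  obtains g where "g \<in> univ \<GG>" "pelem L \<HH> (insert h A) (\<sigma>(h := g))" "h \<in> A \<Longrightarrow> \<sigma> h = g"
proof -
  define v where "v = (srt \<HH> h, 0 :: nat)"
  define \<Sigma> where "\<Sigma> = ren \<sigma> ` {\<psi> \<in> formulas L \<HH> A {v}. sat \<HH> (\<lambda>_. h) \<psi>}"
  have ren_in: "ren \<sigma> \<psi> \<in> formulas L \<GG> (\<sigma> ` A) {v}" if "\<psi> \<in> formulas L \<HH> A {v}" for \<psi>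
    using ren_formulas[OF that, of \<HH> \<sigma>] pelem_srt[OF \<sigma>(1)] by (simp add: formulas_eq[OF \<sigma>(2)])
  have h_sort: "h \<in> sort_univ \<HH> (fst v)" using h by (simp add: v_def sort_univ_def)
  have "fin_sat \<GG> {v} \<Sigma>"
    unfolding fin_sat_def
  proof (intro allI impI)
    fix \<Phi> assume "finite \<Phi> \<and> \<Phi> \<subseteq> \<Sigma>"
    then obtain \<Psi> where \<Psi>: "finite \<Psi>" "\<Psi> \<subseteq> {\<psi> \<in> formulas L \<HH> A {v}. sat \<HH> (\<lambda>_. h) \<psi>}" "\<Phi> = ren \<sigma> ` \<Psi>"
      unfolding \<Sigma>_def by (meson finite_subset_image)
    then have "\<Psi> \<subseteq> formulas L \<HH> A {v}" by blast
    then obtain \<zeta> where \<zeta>: "\<zeta> \<in> formulas L \<HH> A {v}"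
      "\<And>(\<AA> :: ('s, 'f, 'r, 'm) fo_struct) \<tau> \<rho>. sat \<AA> \<rho> (ren \<tau> \<zeta>) \<longleftrightarrow> (\<forall>\<psi>\<in>\<Psi>. sat \<AA> \<rho> (ren \<tau> \<psi>))"
      by (rule finite_conjunction_ren[OF \<Psi>(1)]) (rule that)
    have "sat \<HH> (\<lambda>_. h) \<zeta>"
      using \<zeta>(2)[of \<HH> "\<lambda>_. h" "\<lambda>a. a"] \<Psi>(2) by (auto simp: ren_ident)
    then have "sat \<HH> ((\<lambda>_. h)(v := h)) \<zeta>" by (simp add: fun_upd_idem)
    then have "sat \<HH> (\<lambda>_. h) (Ex v \<zeta>)" using h_sort by auto
    moreover have ex: "Ex v \<zeta> \<in> formulas L \<HH> A {}" using \<zeta>(1) by (auto simp: formulas_def)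
    ultimately have "sat \<HH> (\<lambda>_. h) (ren \<sigma> (Ex v \<zeta>))" using pelem_sat[OF \<sigma>(1)] by blast
    moreover have "Ex v (ren \<sigma> \<zeta>) \<in> formulas L \<GG> (univ \<GG>) {}"
      using ren_in[OF \<zeta>(1)] \<sigma>(2) by (auto simp: formulas_def)
    then have "sat \<GG> (\<lambda>_. h) (Ex v (ren \<sigma> \<zeta>)) \<longleftrightarrow> sat \<HH> (\<lambda>_. h) (Ex v (ren \<sigma> \<zeta>))"
      by (rule sat_transfer) (use \<zeta>(1) in \<open>auto simp: formulas_def\<close>)
    ultimately obtain d where d: "d \<in> sort_univ \<GG> (fst v)" "sat \<GG> ((\<lambda>_. h)(v := d)) (ren \<sigma> \<zeta>)"
      by auto
    have "assigns \<GG> {v} ((\<lambda>_. h)(v := d))" using d(1) by (simp add: assigns_def)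
    then show "\<exists>b. assigns \<GG> {v} b \<and> (\<forall>\<phi>\<in>\<Phi>. sat \<GG> b \<phi>)"
      using d(2) \<zeta>(2) \<Psi>(3) by blast
  qed
  moreover have "\<Sigma> \<subseteq> formulas L \<GG> (\<sigma> ` A) {v}" using ren_in by (auto simp: \<Sigma>_def)
  moreover have "saturated L \<kappa> \<GG>" using mon by (simp add: monster_def)
  ultimately obtain g where g: "realizes \<GG> v \<Sigma> g"
    using saturated_realizes[OF _ \<sigma>(2) sm] by blast
  then have g_sort: "g \<in> sort_univ \<GG> (fst v)" by (simp add: realizes_def)
  then have gG: "g \<in> univ \<GG>" and gs: "srt \<HH> g = fst v" "g \<in> univ \<HH>"
    using sort_univ_iff by (auto simp: sort_univ_def)
  have 1: "sat \<HH> (\<lambda>_. g) (ren \<sigma> \<psi>)" if \<psi>: "\<psi> \<in> formulas L \<HH> A {v}" "sat \<HH> (\<lambda>_. h) \<psi>" for \<psi>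
  proof -
    have "sat \<GG> (\<lambda>_. g) (ren \<sigma> \<psi>)" using g \<psi> by (auto simp: realizes_def \<Sigma>_def)
    moreover have "ren \<sigma> \<psi> \<in> formulas L \<GG> (univ \<GG>) {v}"
      using ren_in[OF \<psi>(1)] formulas_mono[OF \<sigma>(2) order_refl] by blast
    then have "sat \<GG> (\<lambda>_. g) (ren \<sigma> \<psi>) \<longleftrightarrow> sat \<HH> (\<lambda>_. g) (ren \<sigma> \<psi>)"
      by (rule sat_transfer) (use \<psi>(1) g_sort in \<open>auto simp: formulas_def\<close>)
    ultimately show ?thesis by simp
  qed
  have eq: "sat \<HH> (\<lambda>_. h) \<psi> \<longleftrightarrow> sat \<HH> (\<lambda>_. g) (ren \<sigma> \<psi>)" if \<psi>: "\<psi> \<in> formulas L \<HH> A {v}" for \<psi>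
    using 1[OF \<psi>] 1[of "Neg \<psi>"] \<psi> by auto
  have hs: "srt \<HH> h = fst v" by (simp add: v_def)
  show thesis
    by (rule that[OF gG]) (rule pelem_insert[OF \<sigma>(1) hs gs(1) gs(2) eq]; assumption)+
qed

lemma pelem_finite:
  assumes M: "M \<subseteq> univ \<GG>" "small \<kappa> M" and C: "finite C" "C \<subseteq> univ \<HH>"
  shows "\<exists>\<sigma>. pelem L \<HH> (M \<union> C) \<sigma> \<and> (\<forall>m\<in>M. \<sigma> m = m) \<and> \<sigma> ` (M \<union> C) \<subseteq> univ \<GG>"
  using C
proof (induction rule: finite_induct)
  case empty
  have "pelem L \<HH> M (\<lambda>a. a)" using M sub by (intro pelem_ident) auto
  then show ?case using M by auto
next
  case (insert h C)
  then obtain \<sigma> where \<sigma>: "pelem L \<HH> (M \<union> C) \<sigma>" "\<forall>m\<in>M. \<sigma> m = m" "\<sigma> ` (M \<union> C) \<subseteq> univ \<GG>"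
    by auto
  have "\<sigma> ` (M \<union> C) = M \<union> \<sigma> ` C" using \<sigma>(2) by force
  then have "small \<kappa> (\<sigma> ` (M \<union> C))" using small_Un_finite[OF mon M(2), of "\<sigma> ` C"] insert(1) by simp
  moreover have "M \<union> C \<subseteq> univ \<HH>" "h \<in> univ \<HH>" using M sub insert.prems by auto
  ultimately obtain g where g: "g \<in> univ \<GG>" "pelem L \<HH> (insert h (M \<union> C)) (\<sigma>(h := g))" "h \<in> M \<union> C \<Longrightarrow> \<sigma> h = g"
    using pelem_extend[OF _ \<sigma>(1,3)] by metis
  have "\<forall>m\<in>M. (\<sigma>(h := g)) m = m" using \<sigma>(2) g(3) by auto
  moreover have "(\<sigma>(h := g)) ` (M \<union> insert h C) \<subseteq> univ \<GG>" using \<sigma>(3) g(1) by auto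
  ultimately show ?case
    using g(2) by (intro exI[of _ "\<sigma>(h := g)"] conjI) (simp_all only: Un_insert_right)
qed

text \<open>
  The invariant extension of \<open>p\<close>: a formula over \<open>\<HH>\<close> belongs to it if some (equivalently, every)
  elementary renaming over \<open>M\<close> that moves its parameters into \<open>\<GG>\<close> takes it into \<open>p\<close>.
\<close>

definition inv_ext :: "'m set \<Rightarrow> ('s, 'f, 'r, 'm) fm set \<Rightarrow> ('s, 'f, 'r, 'm) fm set" where
  "inv_ext M p = {\<psi> \<in> formulas L \<HH> (univ \<HH>) {x}. \<exists>\<sigma>. pelem L \<HH> (M \<union> params \<psi>) \<sigma> \<and>
     (\<forall>m\<in>M. \<sigma> m = m) \<and> \<sigma> ` (M \<union> params \<psi>) \<subseteq> univ \<GG> \<and> ren \<sigma> \<psi> \<in> p}"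

context
  fixes M p
  assumes M: "M \<subseteq> univ \<GG>" "small \<kappa> M"
    and p: "p \<in> types (univ \<GG>)" and inv: "invariant L \<GG> x M p"
begin

text \<open>
  Two renamings of the parameters of \<open>\<psi>\<close> into \<open>\<GG>\<close> differ by a partial elementary map of \<open>\<GG>\<close> over \<open>M\<close>,
  and \<open>p\<close> is invariant under such maps.
\<close>

lemma inv_ext_iff:
  assumes \<psi>: "\<psi> \<in> formulas L \<HH> (univ \<HH>) {x}" "params \<psi> \<subseteq> C"
    and \<sigma>: "pelem L \<HH> (M \<union> C) \<sigma>" "\<forall>m\<in>M. \<sigma> m = m" "\<sigma> ` (M \<union> C) \<subseteq> univ \<GG>"
  shows "\<psi> \<in> inv_ext M p \<longleftrightarrow> ren \<sigma> \<psi> \<in> p"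
proof
  have \<sigma>': "pelem L \<HH> (M \<union> params \<psi>) \<sigma>" "\<sigma> ` (M \<union> params \<psi>) \<subseteq> univ \<GG>"
    using pelem_subset[OF \<sigma>(1), of "M \<union> params \<psi>"] \<psi>(2) \<sigma>(3) by auto
  show "\<psi> \<in> inv_ext M p" if "ren \<sigma> \<psi> \<in> p"
    unfolding inv_ext_def using \<psi>(1) \<sigma>' \<sigma>(2) that by blast
  assume "\<psi> \<in> inv_ext M p"
  then obtain \<tau> where \<tau>: "pelem L \<HH> (M \<union> params \<psi>) \<tau>" "\<forall>m\<in>M. \<tau> m = m"
    "\<tau> ` (M \<union> params \<psi>) \<subseteq> univ \<GG>" "ren \<tau> \<psi> \<in> p"
    unfolding inv_ext_def by blast
  let ?A = "M \<union> params \<psi>"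
  have A: "?A \<subseteq> univ \<HH>" using M(1) sub \<psi>(1) by (auto simp: formulas_def)
  have inv\<tau>: "inv_into ?A \<tau> (\<tau> a) = a" if "a \<in> ?A" for a
    using pelem_inj[OF \<tau>(1)] that by (rule inv_into_f_f)
  define \<upsilon> where "\<upsilon> a = \<sigma> (inv_into ?A \<tau> a)" for a
  have img: "inv_into ?A \<tau> ` \<tau> ` ?A = ?A" using inv\<tau> by force
  have "pelem L \<HH> (\<tau> ` ?A) \<upsilon>"
    unfolding \<upsilon>_def by (rule pelem_comp[OF pelem_inverse[OF \<tau>(1) A]]) (simp only: img \<sigma>'(1))
  moreover have \<upsilon>: "\<upsilon> (\<tau> a) = \<sigma> a" if "a \<in> ?A" for a using inv\<tau>[OF that] by (simp add: \<upsilon>_def)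
  then have "\<upsilon> ` \<tau> ` ?A \<subseteq> univ \<GG>" using \<sigma>'(2) by auto
  ultimately have "pelem L \<GG> (\<tau> ` ?A) \<upsilon>" by (rule pelem_down[OF _ \<tau>(3)])
  moreover have "\<tau> ` ?A = M \<union> params (ren \<tau> \<psi>)" using \<tau>(2) by (force simp: params_ren)
  moreover have "\<upsilon> m = m" if "m \<in> M" for m using \<upsilon>[of m] that \<tau>(2) \<sigma>(2) by simp
  ultimately have "ren \<tau> \<psi> \<in> p \<longleftrightarrow> ren \<upsilon> (ren \<tau> \<psi>) \<in> p"
    using invariant_ren[OF p inv M(1) type_space_formulas[OF p \<tau>(4)]] by simp
  also have "ren \<upsilon> (ren \<tau> \<psi>) = ren \<sigma> \<psi>" unfolding ren_ren by (rule ren_cong) (simp add: \<upsilon>)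
  finally show "ren \<sigma> \<psi> \<in> p" using \<tau>(4) by simp
qed

lemma inv_ext_extends: "p \<subseteq> inv_ext M p"
proof
  fix \<phi> assume \<phi>: "\<phi> \<in> p"
  then have \<phi>G: "\<phi> \<in> forms (univ \<GG>)" by (rule type_space_formulas[OF p])
  then have "\<phi> \<in> formulas L \<HH> (univ \<GG>) {x}" by (simp add: formulas_eq)
  then have "\<phi> \<in> formulas L \<HH> (univ \<HH>) {x}" using formulas_mono[OF sub order_refl] by blast
  moreover have par: "params \<phi> \<subseteq> univ \<GG>" using \<phi>G by (simp add: formulas_def)
  then have "pelem L \<HH> (M \<union> params \<phi>) (\<lambda>a. a)" using M(1) sub by (intro pelem_ident) auto
  ultimately have "\<phi> \<in> inv_ext M p \<longleftrightarrow> ren (\<lambda>a. a) \<phi> \<in> p"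
    using M(1) par by (intro inv_ext_iff[where C = "params \<phi>"]) auto
  then show "\<phi> \<in> inv_ext M p" using \<phi> by (simp add: ren_ident)
qed

text \<open>
  One renaming moves the parameters of finitely many formulas into \<open>\<GG>\<close>, so consistency and
  completeness are inherited from \<open>p\<close>.
\<close>

lemma inv_ext_type: "inv_ext M p \<in> type_space L \<HH> (univ \<HH>) {x}"
  unfolding type_space_iff
proof (intro conjI ballI)
  show "inv_ext M p \<subseteq> formulas L \<HH> (univ \<HH>) {x}" by (auto simp: inv_ext_def)
  show "\<psi> \<in> inv_ext M p \<or> Neg \<psi> \<in> inv_ext M p" if \<psi>: "\<psi> \<in> formulas L \<HH> (univ \<HH>) {x}" for \<psi>
  proof -
    have par: "params \<psi> \<subseteq> univ \<HH>" using \<psi> by (simp add: formulas_def)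
    obtain \<sigma> where \<sigma>: "pelem L \<HH> (M \<union> params \<psi>) \<sigma>" "\<forall>m\<in>M. \<sigma> m = m" "\<sigma> ` (M \<union> params \<psi>) \<subseteq> univ \<GG>"
      using pelem_finite[OF M finite_params par] by blast
    have "\<psi> \<in> formulas L \<HH> (M \<union> params \<psi>) {x}" using \<psi> by (auto simp: formulas_def)
    then have "ren \<sigma> \<psi> \<in> formulas L \<HH> (\<sigma> ` (M \<union> params \<psi>)) {x}"
      using pelem_srt[OF \<sigma>(1)] by (rule ren_formulas)
    then have "ren \<sigma> \<psi> \<in> forms (univ \<GG>)"
      using formulas_eq[OF \<sigma>(3)] formulas_mono[OF \<sigma>(3) order_refl] by blast
    then have "ren \<sigma> \<psi> \<in> p \<or> ren \<sigma> (Neg \<psi>) \<in> p" using type_complete[OF p] by simp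
    moreover have "\<psi> \<in> inv_ext M p \<longleftrightarrow> ren \<sigma> \<psi> \<in> p"
      by (rule inv_ext_iff[OF \<psi> order_refl \<sigma>])
    moreover have "Neg \<psi> \<in> inv_ext M p \<longleftrightarrow> ren \<sigma> (Neg \<psi>) \<in> p"
      by (rule inv_ext_iff[OF _ _ \<sigma>]) (use \<psi> in simp_all)
    ultimately show ?thesis by blast
  qed
  show "fin_sat \<HH> {x} (inv_ext M p)"
    unfolding fin_sat_def
  proof (intro allI impI)
    fix \<Phi> assume \<Phi>: "finite \<Phi> \<and> \<Phi> \<subseteq> inv_ext M p"
    define C where "C = (\<Union>\<phi>\<in>\<Phi>. params \<phi>)"
    have fH: "\<phi> \<in> formulas L \<HH> (univ \<HH>) {x}" if "\<phi> \<in> \<Phi>" for \<phi> using \<Phi> that by (auto simp: inv_ext_def)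
    have C: "finite C" "C \<subseteq> univ \<HH>" using \<Phi> fH by (auto simp: C_def formulas_def)
    obtain \<sigma> where \<sigma>: "pelem L \<HH> (M \<union> C) \<sigma>" "\<forall>m\<in>M. \<sigma> m = m" "\<sigma> ` (M \<union> C) \<subseteq> univ \<GG>"
      using pelem_finite[OF M C] by blast
    have rp: "ren \<sigma> \<phi> \<in> p" if "\<phi> \<in> \<Phi>" for \<phi>
    proof -
      have "params \<phi> \<subseteq> C" using that by (auto simp: C_def)
      then show ?thesis using inv_ext_iff[OF fH[OF that] _ \<sigma>] \<Phi> that by blast
    qed
    have "\<Phi> \<subseteq> formulas L \<HH> (M \<union> C) {x}" using fH by (auto simp: C_def formulas_def)
    then obtain \<zeta> where \<zeta>: "\<zeta> \<in> formulas L \<HH> (M \<union> C) {x}"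
      "\<And>(\<AA> :: ('s, 'f, 'r, 'm) fo_struct) \<tau> \<rho>. sat \<AA> \<rho> (ren \<tau> \<zeta>) \<longleftrightarrow> (\<forall>\<psi>\<in>\<Phi>. sat \<AA> \<rho> (ren \<tau> \<psi>))"
      by (rule finite_conjunction_ren[OF conjunct1[OF \<Phi>]]) (rule that)
    have "finite (ren \<sigma> ` \<Phi>)" "ren \<sigma> ` \<Phi> \<subseteq> p" using \<Phi> rp by auto
    then obtain d where d: "assigns \<GG> {x} d" "\<forall>\<phi>\<in>ren \<sigma> ` \<Phi>. sat \<GG> d \<phi>"
      using fin_satD[OF type_fin_sat[OF p]] by blast
    have "ren \<sigma> \<zeta> \<in> formulas L \<HH> (\<sigma> ` (M \<union> C)) {x}"
      using \<zeta>(1) pelem_srt[OF \<sigma>(1)] by (rule ren_formulas)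
    then have r\<zeta>: "ren \<sigma> \<zeta> \<in> forms (univ \<GG>)"
      using formulas_eq[OF \<sigma>(3)] formulas_mono[OF \<sigma>(3) order_refl] by blast
    have "sat \<GG> d (ren \<sigma> \<zeta>) \<longleftrightarrow> sat \<HH> d (ren \<sigma> \<zeta>)"
      using r\<zeta> by (rule sat_transfer) (use d(1) r\<zeta> in \<open>auto simp: formulas_def assigns_def\<close>)
    then have "sat \<HH> d (ren \<sigma> \<zeta>)" using \<zeta>(2) d(2) by simp
    moreover have "d x \<in> sort_univ \<HH> (fst x)" using d(1) sort_univ_iff by (simp add: assigns_def)
    ultimately have "sat \<HH> d (ren \<sigma> (Ex x \<zeta>))" by (auto intro!: bexI[of _ "d x"])
    moreover have "Ex x \<zeta> \<in> formulas L \<HH> (M \<union> C) {}" using \<zeta>(1) by (auto simp: formulas_def)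
    ultimately have "sat \<HH> d (Ex x \<zeta>)" using pelem_sat[OF \<sigma>(1)] by blast
    then obtain e where e: "e \<in> sort_univ \<HH> (fst x)" "sat \<HH> (d(x := e)) \<zeta>" by auto
    have "assigns \<HH> {x} (d(x := e))" using e(1) by (simp add: assigns_def)
    moreover have "\<forall>\<phi>\<in>\<Phi>. sat \<HH> (d(x := e)) \<phi>"
      using e(2) \<zeta>(2)[of \<HH> "d(x := e)" "\<lambda>a. a"] by (simp add: ren_ident)
    ultimately show "\<exists>b. assigns \<HH> {x} b \<and> (\<forall>\<phi>\<in>\<Phi>. sat \<HH> b \<phi>)" by blast
  qed
qed

text \<open>
  Two tuples of \<open>\<HH>\<close> with the same type over \<open>M\<close> have a common conjugate in \<open>\<GG>\<close>.
\<close>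

lemma inv_ext_invariant: "invariant L \<HH> x M (inv_ext M p)"
  unfolding invariant_def
proof (intro allI ballI impI)
  fix Y b b' \<phi>
  assume \<phi>: "\<phi> \<in> formulas L \<HH> {} (insert x Y)"
    and H: "finite Y \<and> x \<notin> Y \<and> assigns \<HH> Y b \<and> assigns \<HH> Y b' \<and> tp L \<HH> M Y b = tp L \<HH> M Y b'"
  then have Y: "finite Y" and as: "assigns \<HH> Y b" "assigns \<HH> Y b'" and tp: "tp L \<HH> M Y b = tp L \<HH> M Y b'"
    by auto
  have MH: "M \<subseteq> univ \<HH>" using M(1) sub by blast
  obtain \<tau> where \<tau>: "pelem L \<HH> (M \<union> b' ` Y) \<tau>" "\<And>m. m \<in> M \<Longrightarrow> \<tau> m = m" "\<And>v. v \<in> Y \<Longrightarrow> \<tau> (b' v) = b v"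
    by (rule tp_eq_pelem[OF MH as tp]) (rule that)
  have im: "b ` Y \<subseteq> univ \<HH>" "b' ` Y \<subseteq> univ \<HH>" using as by (auto simp: assigns_def sort_univ_def)
  obtain \<sigma> where \<sigma>: "pelem L \<HH> (M \<union> b ` Y) \<sigma>" "\<forall>m\<in>M. \<sigma> m = m" "\<sigma> ` (M \<union> b ` Y) \<subseteq> univ \<GG>"
    using pelem_finite[OF M _ im(1)] Y by blast
  have \<tau>im: "\<tau> ` (M \<union> b' ` Y) = M \<union> b ` Y" using \<tau>(2,3) by (force simp: image_iff)
  have \<sigma>\<tau>: "pelem L \<HH> (M \<union> b' ` Y) (\<lambda>a. \<sigma> (\<tau> a))"
    by (rule pelem_comp[OF \<tau>(1)]) (simp only: \<tau>im \<sigma>(1))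
  have \<sigma>\<tau>id: "\<forall>m\<in>M. \<sigma> (\<tau> m) = m" using \<sigma>(2) \<tau>(2) by simp
  have \<sigma>\<tau>im: "(\<lambda>a. \<sigma> (\<tau> a)) ` (M \<union> b' ` Y) \<subseteq> univ \<GG>"
    using \<sigma>(3) \<tau>im by (metis image_image)
  have form: "inst Y c \<phi> \<in> formulas L \<HH> (univ \<HH>) {x} \<and> params (inst Y c \<phi>) \<subseteq> c ` Y" if "assigns \<HH> Y c" for c
  proof -
    have "inst Y c \<phi> \<in> formulas L \<HH> (c ` Y) {x}"
      by (rule inst_formulas[OF _ that order_refl]) (use \<phi> in \<open>auto simp: formulas_def\<close>)
    moreover have "c ` Y \<subseteq> univ \<HH>" using that by (auto simp: assigns_def sort_univ_def)
    ultimately show ?thesis by (auto simp: formulas_def)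
  qed
  have r: "ren \<upsilon> \<phi> = \<phi>" for \<upsilon> using \<phi> by (intro ren_ident) (auto simp: formulas_def)
  have "inst Y b \<phi> \<in> inv_ext M p \<longleftrightarrow> ren \<sigma> (inst Y b \<phi>) \<in> p"
    using form[OF as(1)] by (intro inv_ext_iff[OF _ _ \<sigma>]) auto
  moreover have "inst Y b' \<phi> \<in> inv_ext M p \<longleftrightarrow> ren (\<lambda>a. \<sigma> (\<tau> a)) (inst Y b' \<phi>) \<in> p"
    using form[OF as(2)] by (intro inv_ext_iff[OF _ _ \<sigma>\<tau> \<sigma>\<tau>id \<sigma>\<tau>im]) auto
  moreover have "ren \<sigma> (inst Y b \<phi>) = ren (\<lambda>a. \<sigma> (\<tau> a)) (inst Y b' \<phi>)"
    unfolding ren_inst r by (rule inst_cong) (simp add: \<tau>(3))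
  ultimately show "inst Y b \<phi> \<in> inv_ext M p \<longleftrightarrow> inst Y b' \<phi> \<in> inv_ext M p" by simp
qed

end

end

context monster_pair
begin

text \<open>
  That a finite conjunction over \<open>\<GG>\<close> is satisfiable is a sentence over \<open>\<GG>\<close>, hence true in both structures
  or in neither.
\<close>

lemma fin_sat_iff:
  assumes "\<Sigma> \<subseteq> forms (univ \<GG>)"
  shows "fin_sat \<GG> {x} \<Sigma> \<longleftrightarrow> fin_sat \<HH> {x} \<Sigma>"
proof -
  have "(\<exists>b. assigns \<GG> {x} b \<and> (\<forall>\<phi>\<in>\<Phi>. sat \<GG> b \<phi>)) \<longleftrightarrow> (\<exists>b. assigns \<HH> {x} b \<and> (\<forall>\<phi>\<in>\<Phi>. sat \<HH> b \<phi>))"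
    if \<Phi>: "finite \<Phi>" "\<Phi> \<subseteq> \<Sigma>" for \<Phi>
  proof -
    obtain \<zeta> where \<zeta>: "\<zeta> \<in> forms (univ \<GG>)"
      "\<And>(\<AA> :: ('s, 'f, 'r, 'm) fo_struct) \<rho>. sat \<AA> \<rho> \<zeta> \<longleftrightarrow> (\<forall>\<psi>\<in>\<Phi>. sat \<AA> \<rho> \<psi>)"
      by (rule finite_conjunction[OF \<Phi>(1) order_trans[OF \<Phi>(2) assms]]) (rule that)
    have ex: "(\<exists>b. assigns \<AA> {x} b \<and> sat \<AA> b \<zeta>) \<longleftrightarrow> sat \<AA> \<rho> (Ex x \<zeta>)"
      for \<AA> :: "('s, 'f, 'r, 'm) fo_struct" and \<rho>
    proof
      assume "\<exists>b. assigns \<AA> {x} b \<and> sat \<AA> b \<zeta>"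
      then obtain b where b: "b x \<in> sort_univ \<AA> (fst x)" "sat \<AA> b \<zeta>" by (auto simp: assigns_def)
      have "sat \<AA> b \<zeta> \<longleftrightarrow> sat \<AA> (\<rho>(x := b x)) \<zeta>"
        using \<zeta>(1) by (intro sat_cong) (auto simp: formulas_def)
      then show "sat \<AA> \<rho> (Ex x \<zeta>)" using b by auto
    next
      assume "sat \<AA> \<rho> (Ex x \<zeta>)"
      then obtain a where "a \<in> sort_univ \<AA> (fst x)" "sat \<AA> (\<rho>(x := a)) \<zeta>" by auto
      then show "\<exists>b. assigns \<AA> {x} b \<and> sat \<AA> b \<zeta>"
        by (intro exI[of _ "\<rho>(x := a)"]) (simp add: assigns_def)
    qed
    have "Ex x \<zeta> \<in> formulas L \<GG> (univ \<GG>) {}" using \<zeta>(1) by (auto simp: formulas_def)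
    then have "sat \<GG> undefined (Ex x \<zeta>) \<longleftrightarrow> sat \<HH> undefined (Ex x \<zeta>)"
      by (rule sat_transfer) (use \<zeta>(1) in \<open>auto simp: formulas_def\<close>)
    then show ?thesis using ex by (simp only: \<zeta>(2))
  qed
  then show ?thesis unfolding fin_sat_def by blast
qed

lemma type_space_eq: "type_space L \<HH> (univ \<GG>) {x} = types (univ \<GG>)"
proof (rule Set.set_eqI)
  fix p
  show "p \<in> type_space L \<HH> (univ \<GG>) {x} \<longleftrightarrow> p \<in> types (univ \<GG>)"
    unfolding type_space_iff formulas_eq[OF order_refl] using fin_sat_iff[of p] by blast
qed

lemma realization:
  assumes q: "q \<in> types (univ \<GG>)" and A: "A \<subseteq> univ \<GG>" "small \<kappa> A"
  obtains d where "realizes \<GG> x (q \<inter> forms A) d"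
proof -
  have "saturated L \<kappa> \<GG>" using mon by (simp add: monster_def)
  moreover have "q \<inter> forms A \<in> types A" using q A(1) by (rule type_restrict)
  ultimately show thesis using A that unfolding saturated_def by blast
qed

lemma realizes_subset: "realizes \<MM> x p d \<Longrightarrow> q \<subseteq> p \<Longrightarrow> realizes \<MM> x q d"
  unfolding realizes_def by blast

lemma realizes_fewer:
  assumes "realizes \<GG> x (q \<inter> forms B) d" "A \<subseteq> B"
  shows "realizes \<GG> x (q \<inter> forms A) d"
  by (rule realizes_subset[OF assms(1)]) (use formulas_mono[OF assms(2) order_refl] in blast)

lemma sat_transfer_elem:
  assumes "\<phi> \<in> forms (univ \<GG>)" "d \<in> grp_elems"
  shows "sat \<GG> (\<lambda>_. d) \<phi> \<longleftrightarrow> sat \<HH> (\<lambda>_. d) \<phi>"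
  using assms by (intro sat_transfer[OF assms(1)]) (auto simp: formulas_def)

lemma translate_in:
  assumes "\<phi> \<in> forms (univ \<GG>)" "d \<in> grp_elems"
  shows "shift d \<phi> \<in> forms (univ \<GG>)"
proof -
  have "shift d \<phi> \<in> forms (insert d (params \<phi>))"
    using assms by (intro translate_formulas[OF mul]) (auto simp: sort_univ_def)
  moreover have "insert d (params \<phi>) \<subseteq> univ \<GG>" using assms by (auto simp: sort_univ_def formulas_def)
  ultimately show ?thesis using formulas_mono[OF _ order_refl] by blast
qed

definition product_witness :: "'m set \<Rightarrow> ('s, 'f, 'r, 'm) fm set \<Rightarrow> ('s, 'f, 'r, 'm) fm set
    \<Rightarrow> ('s, 'f, 'r, 'm) fm set \<Rightarrow> 'm \<Rightarrow> 'm \<Rightarrow> ('s, 'f, 'r, 'm) fm set \<Rightarrow> bool" where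
  "product_witness M p q p' a b r \<longleftrightarrow>
     submodel L \<GG> M \<and> small \<kappa> M \<and> invariant L \<GG> x M p \<and> invariant L \<GG> x M q \<and>
     p' \<in> type_space L \<HH> (univ \<HH>) {x} \<and> p \<subseteq> p' \<and> invariant L \<HH> x M p' \<and>
     realizes \<HH> x q b \<and> realizes \<HH> x (p' \<inter> formulas L \<HH> (insert b (univ \<GG>)) {x}) a \<and>
     r = tp L \<HH> (univ \<GG>) {x} (\<lambda>_. fint \<HH> mul [a, b])"

lemma submodel_univ: "submodel L \<GG> M \<Longrightarrow> M \<subseteq> univ \<GG>"
  unfolding elementary_def by simp

text \<open>
  Although the product is computed in \<open>\<HH>\<close>, its membership relation can be read off inside \<open>\<GG>\<close>:
  replacing \<open>b\<close> by an element of \<open>\<GG>\<close> with the same type over \<open>M\<close> and the parameters of \<open>\<phi>\<close> does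
  not affect whether \<open>\<phi>(x \<cdot> b)\<close> lies in the invariant extension.
\<close>

lemma product_witness_iff:
  assumes W: "product_witness M p q p' a b r"
    and p: "p \<in> types (univ \<GG>)" and q: "q \<in> types (univ \<GG>)"
    and \<phi>: "\<phi> \<in> forms (univ \<GG>)"
    and d: "realizes \<GG> x (q \<inter> forms (M \<union> params \<phi>)) d"
  shows "\<phi> \<in> r \<longleftrightarrow> shift d \<phi> \<in> p"
proof -
  have M: "M \<subseteq> univ \<GG>" and p': "p' \<in> type_space L \<HH> (univ \<HH>) {x}" "p \<subseteq> p'" "invariant L \<HH> x M p'"
    and b: "realizes \<HH> x q b" and a: "realizes \<HH> x (p' \<inter> formulas L \<HH> (insert b (univ \<GG>)) {x}) a"
    and r: "r = tp L \<HH> (univ \<GG>) {x} (\<lambda>_. fint \<HH> mul [a, b])"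
    using W submodel_univ[of M] unfolding product_witness_def by blast+
  let ?A = "M \<union> params \<phi>"
  have A: "?A \<subseteq> univ \<GG>" using M \<phi> by (auto simp: formulas_def)
  have AH: "?A \<subseteq> univ \<HH>" using A sub by blast
  have d_sort: "d \<in> grp_elems" and b_sort: "b \<in> sort_univ \<HH> (fst x)"
    using d b by (simp_all add: realizes_def)
  then have dH: "d \<in> sort_univ \<HH> (fst x)" using sort_univ_iff by blast
  have \<phi>H: "\<phi> \<in> formulas L \<HH> (univ \<GG>) {x}" using \<phi> by (simp add: formulas_eq)
  have tb: "shift b \<phi> \<in> formulas L \<HH> (insert b (params \<phi>)) {x}"
    using b_sort by (intro translate_formulas[OF mul \<phi>H]) (simp add: sort_univ_def)
  have sub1: "insert b (params \<phi>) \<subseteq> insert b (univ \<GG>)" "insert b (univ \<GG>) \<subseteq> univ \<HH>"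
    using A sub b_sort by (auto simp: sort_univ_def)
  have tb1: "shift b \<phi> \<in> formulas L \<HH> (insert b (univ \<GG>)) {x}"
    using tb formulas_mono[OF sub1(1) order_refl] by blast
  then have tb2: "shift b \<phi> \<in> formulas L \<HH> (univ \<HH>) {x}"
    using formulas_mono[OF sub1(2) order_refl] by blast
  have "\<phi> \<in> r \<longleftrightarrow> sat \<HH> (\<lambda>_. fint \<HH> mul [a, b]) \<phi>"
    using \<phi>H by (simp add: r tp_def)
  also have "\<dots> \<longleftrightarrow> sat \<HH> (\<lambda>_. a) (shift b \<phi>)"
    unfolding sat_translate using \<phi> by (intro sat_cong) (auto simp: formulas_def)
  also have "\<dots> \<longleftrightarrow> shift b \<phi> \<in> p' \<inter> formulas L \<HH> (insert b (univ \<GG>)) {x}"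
    by (rule realizes_iff[OF type_restrict[OF p'(1) sub1(2)] a tb1, symmetric])
  also have "\<dots> \<longleftrightarrow> shift b \<phi> \<in> p'" using tb1 by simp
  also have "\<dots> \<longleftrightarrow> ren ((\<lambda>c. c)(b := d)) (shift b \<phi>) \<in> p'"
  proof -
    have idA: "pelem L \<HH> ?A (\<lambda>c. c)" using AH by (intro pelem_ident) auto
    have eq: "sat \<HH> (\<lambda>_. b) \<psi> \<longleftrightarrow> sat \<HH> (\<lambda>_. d) (ren (\<lambda>c. c) \<psi>)" if \<psi>: "\<psi> \<in> formulas L \<HH> ?A {x}" for \<psi>
    proof -
      have \<psi>G: "\<psi> \<in> forms ?A" using \<psi> by (simp add: formulas_eq[OF A])
      then have \<psi>u: "\<psi> \<in> forms (univ \<GG>)" using formulas_mono[OF A order_refl] by blast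
      then have "sat \<HH> (\<lambda>_. b) \<psi> \<longleftrightarrow> \<psi> \<in> q"
        using realizes_iff[of q L \<HH> "univ \<GG>" x b \<psi>] q b type_space_eq formulas_eq[OF order_refl] by simp
      also have "\<dots> \<longleftrightarrow> \<psi> \<in> q \<inter> forms ?A" using \<psi>G by simp
      also have "\<dots> \<longleftrightarrow> sat \<GG> (\<lambda>_. d) \<psi>" by (rule realizes_iff[OF type_restrict[OF q A] d \<psi>G])
      also have "\<dots> \<longleftrightarrow> sat \<HH> (\<lambda>_. d) \<psi>" by (rule sat_transfer_elem[OF \<psi>u d_sort])
      finally show ?thesis by (simp add: ren_ident)
    qed
    have s: "srt \<HH> b = fst x" "srt \<HH> d = fst x" "d \<in> univ \<HH>" using b_sort dH by (simp_all add: sort_univ_def)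
    have pe: "pelem L \<HH> (insert b ?A) ((\<lambda>c. c)(b := d))" and col: "b \<in> ?A \<Longrightarrow> b = d"
      using pelem_insert[OF idA s eq] by blast+
    have "M \<union> params (shift b \<phi>) \<subseteq> insert b ?A" using tb by (auto simp: formulas_def)
    then have "pelem L \<HH> (M \<union> params (shift b \<phi>)) ((\<lambda>c. c)(b := d))"
      using pe by (rule pelem_subset[rotated])
    moreover have "((\<lambda>c. c)(b := d)) m = m" if "m \<in> M" for m using col that by auto
    moreover have "M \<subseteq> univ \<HH>" using AH by blast
    ultimately show ?thesis by (intro invariant_ren[OF p'(1,3) _ tb2])
  qed
  also have "ren ((\<lambda>c. c)(b := d)) (shift b \<phi>) = shift d \<phi>"
  proof -
    have "((\<lambda>c. c)(b := d)) c = c" if "c \<in> params \<phi>" for c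
    proof (cases "c = b")
      case True
      have "wf_fm L \<GG> (Eq (Var x) (Par b))"
        using that True A b_sort srt_eq[of b] by (auto intro!: exI[of _ "fst x"] has_sort_Var has_sort_Par simp: sort_univ_def)
      then have e: "Eq (Var x) (Par b) \<in> forms ?A" using that True by (simp add: formulas_def)
      then have eu: "Eq (Var x) (Par b) \<in> formulas L \<HH> (univ \<GG>) {x}"
        using formulas_mono[OF A order_refl] formulas_eq[OF order_refl] by blast
      have "Eq (Var x) (Par b) \<in> q"
        using realizes_iff[of q L \<HH> "univ \<GG>" x b, OF _ b eu] q type_space_eq by simp
      then have "sat \<GG> (\<lambda>_. d) (Eq (Var x) (Par b))" using e d unfolding realizes_def by blast
      then show ?thesis using True by simp
    qed simp
    then have "ren ((\<lambda>c. c)(b := d)) \<phi> = \<phi>" by (rule ren_ident)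
    then show ?thesis by (simp add: ren_translate)
  qed
  also have "shift d \<phi> \<in> p' \<longleftrightarrow> shift d \<phi> \<in> p"
  proof -
    have "shift d \<phi> \<in> formulas L \<HH> (univ \<GG>) {x}"
      using translate_in[OF \<phi> d_sort] by (simp add: formulas_eq)
    moreover have "p = p' \<inter> formulas L \<HH> (univ \<GG>) {x}"
    proof (rule type_eqI)
      show "p \<in> type_space L \<HH> (univ \<GG>) {x}" using p by (simp add: type_space_eq)
      show "p' \<inter> formulas L \<HH> (univ \<GG>) {x} \<in> type_space L \<HH> (univ \<GG>) {x}" by (rule type_restrict[OF p'(1) sub])
      show "p \<subseteq> p' \<inter> formulas L \<HH> (univ \<GG>) {x}"
        using p'(2) type_space_formulas[OF p] formulas_eq[OF order_refl] by blast
    qed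
    ultimately show ?thesis by blast
  qed
  finally show ?thesis .
qed

lemma product_witness_exists:
  assumes M: "submodel L \<GG> M" "small \<kappa> M" and inv: "invariant L \<GG> x M p" "invariant L \<GG> x M q"
    and p: "p \<in> types (univ \<GG>)" and q: "q \<in> types (univ \<GG>)"
  obtains p' a b r where "product_witness M p q p' a b r" "r \<in> types (univ \<GG>)"
proof -
  note M' = submodel_univ[OF M(1)] M(2)
  define p' where "p' = inv_ext M p"
  have p': "p' \<in> type_space L \<HH> (univ \<HH>) {x}" "p \<subseteq> p'" "invariant L \<HH> x M p'"
    unfolding p'_def using inv_ext_type[OF M' p inv(1)] inv_ext_extends[OF M' p inv(1)]
      inv_ext_invariant[OF M' p inv(1)] by blast+
  have satH: "saturated L \<kappa>' \<HH>" using mon' by (simp add: monster_def)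
  have qH: "q \<in> type_space L \<HH> (univ \<GG>) {x}" using q by (simp add: type_space_eq)
  have "\<exists>b. realizes \<HH> x q b" using satH sub small_univ qH unfolding saturated_def by blast
  then obtain b where b: "realizes \<HH> x q b" ..
  then have b_sort: "b \<in> sort_univ \<HH> (fst x)" by (simp add: realizes_def)
  then have sb: "insert b (univ \<GG>) \<subseteq> univ \<HH>" using sub by (auto simp: sort_univ_def)
  have "small \<kappa>' (univ \<GG> \<union> {b})" by (rule small_Un_finite[OF mon' small_univ]) simp
  then have sm: "small \<kappa>' (insert b (univ \<GG>))" by simp
  have "p' \<inter> formulas L \<HH> (insert b (univ \<GG>)) {x} \<in> type_space L \<HH> (insert b (univ \<GG>)) {x}"
    by (rule type_restrict[OF p'(1) sb])
  then have "\<exists>a. realizes \<HH> x (p' \<inter> formulas L \<HH> (insert b (univ \<GG>)) {x}) a"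
    using satH sb sm unfolding saturated_def by blast
  then obtain a where a: "realizes \<HH> x (p' \<inter> formulas L \<HH> (insert b (univ \<GG>)) {x}) a" ..
  then have a_sort: "a \<in> sort_univ \<HH> (fst x)" by (simp add: realizes_def)
  have "fo_structure L \<HH>" using mon' by (simp add: monster_def)
  moreover have "list_all2 (\<lambda>a s. a \<in> sort_univ \<HH> s) [a, b] [fst x, fst x]" using a_sort b_sort by simp
  ultimately have ab: "fint \<HH> mul [a, b] \<in> sort_univ \<HH> (fst x)"
    using mul unfolding fo_structure_def by blast
  define r where "r = tp L \<HH> (univ \<GG>) {x} (\<lambda>_. fint \<HH> mul [a, b])"
  have "r \<in> type_space L \<HH> (univ \<GG>) {x}"
    unfolding r_def using ab by (intro tp_type_space) (simp add: assigns_def)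
  then have r: "r \<in> types (univ \<GG>)" by (simp add: type_space_eq)
  have "product_witness M p q p' a b r"
    unfolding product_witness_def using M inv p' a b r_def by blast
  with r show thesis by (rule that[rotated])
qed

abbreviation prd :: "('s, 'f, 'r, 'm) fm set \<Rightarrow> ('s, 'f, 'r, 'm) fm set \<Rightarrow> ('s, 'f, 'r, 'm) fm set" where
  "prd \<equiv> type_prod L mul x \<kappa> \<GG> \<HH>"

text \<open>
  Any two witnesses yield the same type: \<open>d\<close> can be chosen to realize \<open>q\<close> over both models at once,
  and then decides membership of \<open>\<phi>\<close> in either of them.
\<close>

lemma product_iff:
  assumes M: "submodel L \<GG> M" "small \<kappa> M" and inv: "invariant L \<GG> x M p" "invariant L \<GG> x M q"
    and p: "p \<in> types (univ \<GG>)" and q: "q \<in> types (univ \<GG>)"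
  shows "prd p q \<in> types (univ \<GG>)"
    and "\<phi> \<in> forms (univ \<GG>) \<Longrightarrow> realizes \<GG> x (q \<inter> forms (M \<union> params \<phi>)) d \<Longrightarrow>
      \<phi> \<in> prd p q \<longleftrightarrow> shift d \<phi> \<in> p"
proof -
  obtain p' a b r where W: "product_witness M p q p' a b r" and r: "r \<in> types (univ \<GG>)"
    using product_witness_exists[OF M inv p q] by metis
  have "prd p q = (THE r. \<exists>M p' a b. product_witness M p q p' a b r)"
    unfolding type_prod_def product_witness_def ..
  also have "\<dots> = r"
  proof (rule the_equality)
    show "\<exists>M p' a b. product_witness M p q p' a b r" using W by blast
    fix r2 assume "\<exists>M p' a b. product_witness M p q p' a b r2"
    then obtain M2 p2 a2 b2 where W2: "product_witness M2 p q p2 a2 b2 r2" by blast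
    have iff: "\<phi> \<in> r2 \<longleftrightarrow> \<phi> \<in> r" if \<phi>: "\<phi> \<in> forms (univ \<GG>)" for \<phi>
    proof -
      let ?A = "(M \<union> M2) \<union> params \<phi>"
      have M2: "submodel L \<GG> M2" "small \<kappa> M2" using W2 by (simp_all only: product_witness_def)
      have "small \<kappa> (M \<union> M2)" using mon M(2) M2(2) by (intro small_Un) (simp_all add: monster_def)
      then have "small \<kappa> ?A" using small_Un_finite[OF mon _ finite_params] by blast
      moreover have "?A \<subseteq> univ \<GG>"
        using submodel_univ[OF M(1)] submodel_univ[OF M2(1)] \<phi> by (auto simp: formulas_def)
      ultimately obtain d where d: "realizes \<GG> x (q \<inter> forms ?A) d" using realization[OF q] by blast
      have s: "M \<union> params \<phi> \<subseteq> ?A" "M2 \<union> params \<phi> \<subseteq> ?A" by blast+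
      have d1: "realizes \<GG> x (q \<inter> forms (M \<union> params \<phi>)) d"
        by (rule realizes_fewer[OF d s(1)])
      have d2: "realizes \<GG> x (q \<inter> forms (M2 \<union> params \<phi>)) d"
        by (rule realizes_fewer[OF d s(2)])
      show ?thesis
        using product_witness_iff[OF W p q \<phi> d1] product_witness_iff[OF W2 p q \<phi> d2] by simp
    qed
    have "r2 \<subseteq> forms (univ \<GG>)"
      using W2 formulas_eq[OF order_refl] unfolding product_witness_def tp_def by blast
    moreover have "r \<subseteq> forms (univ \<GG>)" using r by (simp add: type_space_iff)
    ultimately show "r2 = r" using iff by blast
  qed
  finally have eq: "prd p q = r" .
  show "prd p q \<in> types (univ \<GG>)" using r eq by simp
  show "\<phi> \<in> prd p q \<longleftrightarrow> shift d \<phi> \<in> p"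
    if "\<phi> \<in> forms (univ \<GG>)" "realizes \<GG> x (q \<inter> forms (M \<union> params \<phi>)) d"
    unfolding eq by (rule product_witness_iff[OF W p q that])
qed

lemma mult_sort:
  assumes "a \<in> grp_elems" "b \<in> grp_elems"
  shows "fint \<GG> mul [a, b] \<in> grp_elems"
proof -
  have "fo_structure L \<GG>" using mon by (simp add: monster_def)
  moreover have "list_all2 (\<lambda>a s. a \<in> sort_univ \<GG> s) [a, b] [fst x, fst x]" using assms by simp
  ultimately show ?thesis using mul unfolding fo_structure_def by blast
qed

lemma mult_assoc:
  assumes "a \<in> grp_elems" "b \<in> grp_elems" "c \<in> grp_elems"
  shows "fint \<GG> mul [fint \<GG> mul [a, b], c] = fint \<GG> mul [a, fint \<GG> mul [b, c]]"
proof -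
  obtain e where "group \<lparr>carrier = grp_elems, monoid.mult = (\<lambda>a b. fint \<GG> mul [a, b]), one = e\<rparr>"
    using grp unfolding group_on_def by blast
  then interpret G: group "\<lparr>carrier = grp_elems, monoid.mult = (\<lambda>a b. fint \<GG> mul [a, b]), one = e\<rparr>" .
  show ?thesis using G.m_assoc[of a b c] assms by simp
qed

text \<open>
  If \<open>d\<close> realizes \<open>r\<close> and \<open>e\<close> realizes \<open>q\<close> over enough parameters including \<open>d\<close>, then \<open>e \<cdot> d\<close>
  realizes \<open>q * r\<close>; associativity of the product of types is then associativity in the group.
\<close>

lemma product_assoc:
  assumes M: "submodel L \<GG> M" "small \<kappa> M"
    and inv: "invariant L \<GG> x M p" "invariant L \<GG> x M q" "invariant L \<GG> x M r"
      "invariant L \<GG> x M (prd p q)" "invariant L \<GG> x M (prd q r)"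
    and p: "p \<in> types (univ \<GG>)" and q: "q \<in> types (univ \<GG>)"
    and r: "r \<in> types (univ \<GG>)"
  shows "prd (prd p q) r = prd p (prd q r)"
proof -
  note pq = product_iff[OF M inv(1,2) p q] and qr = product_iff[OF M inv(2,3) q r]
  note pq_r = product_iff[OF M inv(4,3) pq(1) r] and p_qr = product_iff[OF M inv(1,5) p qr(1)]
  have "\<phi> \<in> prd (prd p q) r \<longleftrightarrow> \<phi> \<in> prd p (prd q r)" if \<phi>: "\<phi> \<in> forms (univ \<GG>)" for \<phi>
  proof -
    let ?A = "M \<union> params \<phi>"
    have A: "?A \<subseteq> univ \<GG>" "small \<kappa> ?A"
      using submodel_univ[OF M(1)] \<phi> small_Un_finite[OF mon M(2) finite_params] by (auto simp: formulas_def)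
    obtain d where d: "realizes \<GG> x (r \<inter> forms ?A) d" using realization[OF r A] .
    then have ds: "d \<in> grp_elems" by (simp add: realizes_def)
    have "?A \<union> {d} \<subseteq> univ \<GG>" "small \<kappa> (?A \<union> {d})"
      using A(1) ds small_Un_finite[OF mon A(2), of "{d}"] by (auto simp: sort_univ_def)
    then obtain e where e: "realizes \<GG> x (q \<inter> forms (?A \<union> {d})) e" using realization[OF q] by blast
    then have es: "e \<in> grp_elems" by (simp add: realizes_def)
    note t\<phi> = translate_in[OF \<phi> ds]
    have tpar: "params (shift d \<psi>) \<subseteq> insert d (params \<psi>)"
      if "\<psi> \<in> forms (univ \<GG>)" for \<psi>
      using translate_formulas[OF mul that, of d] ds by (simp add: formulas_def sort_univ_def)
    have s1: "M \<union> params (shift d \<phi>) \<subseteq> ?A \<union> {d}" using tpar[OF \<phi>] by blast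
    have e1: "realizes \<GG> x (q \<inter> forms (M \<union> params (shift d \<phi>))) e"
      by (rule realizes_fewer[OF e s1])
    have "\<phi> \<in> prd (prd p q) r \<longleftrightarrow> shift d \<phi> \<in> prd p q" by (rule pq_r(2)[OF \<phi> d])
    also have "\<dots> \<longleftrightarrow> shift e (shift d \<phi>) \<in> p" by (rule pq(2)[OF t\<phi> e1])
    also have "\<dots> \<longleftrightarrow> shift (fint \<GG> mul [e, d]) \<phi> \<in> p"
    proof (rule type_cong[OF p])
      show "shift e (shift d \<phi>) \<in> forms (univ \<GG>)"
        by (rule translate_in[OF t\<phi> es])
      show "shift (fint \<GG> mul [e, d]) \<phi> \<in> forms (univ \<GG>)"
        by (rule translate_in[OF \<phi> mult_sort[OF es ds]])
      fix b assume "assigns \<GG> {x} b"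
      then have "b x \<in> grp_elems" by (simp add: assigns_def)
      then show "sat \<GG> b (shift e (shift d \<phi>)) \<longleftrightarrow>
          sat \<GG> b (shift (fint \<GG> mul [e, d]) \<phi>)"
        by (simp add: sat_translate mult_assoc[OF _ es ds])
    qed
    also have "\<dots> \<longleftrightarrow> \<phi> \<in> prd p (prd q r)"
    proof (rule p_qr(2)[OF \<phi>, symmetric])
      show "realizes \<GG> x (prd q r \<inter> forms ?A) (fint \<GG> mul [e, d])"
        unfolding realizes_def
      proof (intro conjI ballI mult_sort[OF es ds])
        fix \<psi> assume \<psi>: "\<psi> \<in> prd q r \<inter> forms ?A"
        then have \<psi>u: "\<psi> \<in> forms (univ \<GG>)" using formulas_mono[OF A(1) order_refl] by blast
        have s2: "M \<union> params \<psi> \<subseteq> ?A" using \<psi> by (auto simp: formulas_def)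
        have "realizes \<GG> x (r \<inter> forms (M \<union> params \<psi>)) d"
          by (rule realizes_fewer[OF d s2])
        then have "shift d \<psi> \<in> q" using qr(2)[OF \<psi>u] \<psi> by blast
        moreover have "shift d \<psi> \<in> forms (?A \<union> {d})"
          using translate_in[OF \<psi>u ds] tpar[OF \<psi>u] s2 by (auto simp: formulas_def)
        ultimately have "sat \<GG> (\<lambda>_. e) (shift d \<psi>)" using e unfolding realizes_def by blast
        moreover have "sat \<GG> (\<lambda>_. e) (shift d \<psi>) \<longleftrightarrow> sat \<GG> (\<lambda>_. fint \<GG> mul [e, d]) \<psi>"
          unfolding sat_translate using \<psi>u by (intro sat_cong) (auto simp: formulas_def)
        ultimately show "sat \<GG> (\<lambda>_. fint \<GG> mul [e, d]) \<psi>" by simp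
      qed
    qed
    finally show ?thesis .
  qed
  then show ?thesis
    using type_space_formulas[OF pq_r(1)] type_space_formulas[OF p_qr(1)] by blast
qed

end

section \<open>Supports of Keisler measures\<close>

lemma support_complement:
  assumes \<mu>: "keisler L \<GG> x A \<mu>"
  shows "type_space L \<GG> A {x} - support L \<GG> x A \<mu> =
    (\<Union>\<phi>\<in>{\<phi>\<in>formulas L \<GG> A {x}. \<mu> \<phi> = 0}. type_nbhd L \<GG> A {x} \<phi>)"
proof (rule Set.set_eqI)
  fix p
  have "(\<exists>\<phi>\<in>p. \<not> \<mu> \<phi> > 0) \<longleftrightarrow> (\<exists>\<phi>\<in>formulas L \<GG> A {x}. \<mu> \<phi> = 0 \<and> \<phi> \<in> p)"
    if p: "p \<in> type_space L \<GG> A {x}"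
  proof -
    have "\<not> \<mu> \<phi> > 0 \<longleftrightarrow> \<mu> \<phi> = 0" if "\<phi> \<in> p" for \<phi>
      using keisler_nonneg[OF \<mu> type_space_formulas[OF p that]] by linarith
    then show ?thesis using type_space_formulas[OF p] by blast
  qed
  then show "p \<in> type_space L \<GG> A {x} - support L \<GG> x A \<mu> \<longleftrightarrow>
      p \<in> (\<Union>\<phi>\<in>{\<phi>\<in>formulas L \<GG> A {x}. \<mu> \<phi> = 0}. type_nbhd L \<GG> A {x} \<phi>)"
    unfolding support_def by blast
qed

lemma support_subset: "support L \<GG> x A \<mu> \<subseteq> type_space L \<GG> A {x}"
  unfolding support_def by blast

lemma closedin_support:
  assumes \<mu>: "keisler L \<GG> x A \<mu>"
  shows "closedin (type_top L \<GG> A {x}) (support L \<GG> x A \<mu>)"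
proof -
  have "openin (type_top L \<GG> A {x}) (\<Union>\<phi>\<in>{\<phi>\<in>formulas L \<GG> A {x}. \<mu> \<phi> = 0}. type_nbhd L \<GG> A {x} \<phi>)"
    by (rule openin_Union) (auto intro: openin_type_nbhd)
  then show ?thesis
    unfolding closedin_def topspace_type_top support_complement[OF \<mu>] by (intro conjI support_subset)
qed

lemma support_restrict:
  assumes "p \<in> support L \<GG> x A \<mu>" "B \<subseteq> A"
  shows "p \<inter> formulas L \<GG> B {x} \<in> support L \<GG> x B \<mu>"
  using assms type_restrict[OF _ assms(2), of p L \<GG> "{x}"] by (simp add: support_def)

text \<open>
  The complement of the support is a union of clopen null sets. The union may be uncountable, but
  finitely many of them cover any compact subset, so the complement is null by inner regularity.
\<close>

lemma measure_Int_support: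
  assumes \<mu>: "keisler L \<GG> x A \<mu>" and \<psi>: "\<psi> \<in> formulas L \<GG> A {x}"
  shows "support L \<GG> x A \<mu> \<in> sets (type_measure L \<GG> x A \<mu>)"
    and "type_nbhd L \<GG> A {x} \<psi> \<inter> support L \<GG> x A \<mu> \<in> sets (type_measure L \<GG> x A \<mu>)"
    and "measure (type_measure L \<GG> x A \<mu>) (type_nbhd L \<GG> A {x} \<psi> \<inter> support L \<GG> x A \<mu>) = \<mu> \<psi>"
proof -
  let ?X = "type_top L \<GG> A {x}" and ?N = "type_nbhd L \<GG> A {x}" and ?S = "support L \<GG> x A \<mu>"
  define m where "m = type_measure L \<GG> x A \<mu>"
  have reg: "regular_borel_prob ?X m" unfolding m_def by (rule type_measure_exists(1)[OF \<mu>])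
  have val: "measure m (?N \<phi>) = \<mu> \<phi>" if "\<phi> \<in> formulas L \<GG> A {x}" for \<phi>
    unfolding m_def by (rule type_measure_exists(2)[OF \<mu> that])
  have sets_m: "sets m = sets (borel_of ?X)" and one: "emeasure m (space m) = 1"
    using reg by (simp_all add: regular_borel_prob_def)
  interpret finite_measure m by (rule finite_measureI) (simp add: one)
  have open_sets: "U \<in> sets m" if "openin ?X U" for U
    unfolding sets_m sets_borel_of using that by (simp add: sigma_sets.Basic)
  have space_m: "space m = type_space L \<GG> A {x}"
    using sets_eq_imp_space_eq[OF sets_m] by (simp add: space_borel_of)
  have compl_open: "openin ?X (type_space L \<GG> A {x} - ?S)"
    using closedin_support[OF \<mu>] by (simp add: closedin_def)
  have S: "?S = space m - (type_space L \<GG> A {x} - ?S)"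
    unfolding space_m using support_subset[of L \<GG> x A \<mu>] by blast
  show Sm: "?S \<in> sets (type_measure L \<GG> x A \<mu>)"
    unfolding m_def[symmetric] by (subst S) (rule sets.compl_sets[OF open_sets[OF compl_open]])
  have Nm: "?N \<psi> \<in> sets m" using \<psi> by (intro open_sets openin_type_nbhd)
  show NSm: "?N \<psi> \<inter> ?S \<in> sets (type_measure L \<GG> x A \<mu>)" using Nm Sm by (simp add: m_def sets.Int)
  have null: "emeasure m (type_space L \<GG> A {x} - ?S) = 0"
  proof -
    have "emeasure m (type_space L \<GG> A {x} - ?S) =
        (SUP K\<in>{K. compactin ?X K \<and> K \<subseteq> type_space L \<GG> A {x} - ?S}. emeasure m K)"
      using reg open_sets[OF compl_open] unfolding regular_borel_prob_def by blast
    also have "\<dots> \<le> 0"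
    proof (rule SUP_least)
      fix K assume "K \<in> {K. compactin ?X K \<and> K \<subseteq> type_space L \<GG> A {x} - ?S}"
      then have K: "compactin ?X K" "K \<subseteq> \<Union>(?N ` {\<phi>\<in>formulas L \<GG> A {x}. \<mu> \<phi> = 0})"
        using support_complement[OF \<mu>] by simp_all
      have "\<exists>\<F>. finite \<F> \<and> \<F> \<subseteq> ?N ` {\<phi>\<in>formulas L \<GG> A {x}. \<mu> \<phi> = 0} \<and> K \<subseteq> \<Union>\<F>"
        by (rule compactinD[OF K(1) _ K(2)]) (use openin_type_nbhd in \<open>auto\<close>)
      then obtain \<F> where \<F>: "finite \<F>" "\<F> \<subseteq> ?N ` {\<phi>\<in>formulas L \<GG> A {x}. \<mu> \<phi> = 0}" "K \<subseteq> \<Union>\<F>"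
        by (elim exE conjE)
      have N0: "U \<in> sets m \<and> emeasure m U = 0" if U: "U \<in> \<F>" for U
      proof -
        obtain \<phi> where \<phi>: "\<phi> \<in> formulas L \<GG> A {x}" "\<mu> \<phi> = 0" "U = ?N \<phi>" using \<F>(2) U by blast
        then show ?thesis
          using val[OF \<phi>(1)] open_sets[OF openin_type_nbhd[OF \<phi>(1)]] by (simp add: emeasure_eq_measure)
      qed
      have "emeasure m K \<le> emeasure m (\<Union>U\<in>\<F>. U)"
        using \<F>(1,3) N0 by (intro emeasure_mono sets.finite_UN) auto
      also have "\<dots> \<le> (\<Sum>U\<in>\<F>. emeasure m U)"
        using \<F>(1) N0 by (intro emeasure_subadditive_finite) auto
      also have "\<dots> = 0" using N0 by simp
      finally show "emeasure m K \<le> 0" .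
    qed
    finally show ?thesis by simp
  qed
  have "measure m (?N \<psi> \<inter> ?S) = measure m (?N \<psi>)"
  proof (rule antisym)
    show "measure m (?N \<psi> \<inter> ?S) \<le> measure m (?N \<psi>)" using Nm by (intro finite_measure_mono) auto
    have "measure m (?N \<psi>) \<le> measure m ((?N \<psi> \<inter> ?S) \<union> (type_space L \<GG> A {x} - ?S))"
      using NSm open_sets[OF compl_open] by (intro finite_measure_mono sets.Un) (auto simp: m_def)
    also have "\<dots> \<le> measure m (?N \<psi> \<inter> ?S) + measure m (type_space L \<GG> A {x} - ?S)"
      using NSm open_sets[OF compl_open] by (intro measure_Un_le) (simp_all add: m_def)
    finally show "measure m (?N \<psi>) \<le> measure m (?N \<psi> \<inter> ?S)" using null by (simp add: measure_def)
  qed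
  then show "measure (type_measure L \<GG> x A \<mu>) (?N \<psi> \<inter> ?S) = \<mu> \<psi>"
    using val[OF \<psi>] by (simp add: m_def)
qed

text \<open>
  The neighbourhood of \<open>\<psi>\<close> contributes at least \<open>e * \<mu> \<psi>\<close> to the integral.
\<close>

lemma integral_support_pos:
  fixes F :: "('s, 'f, 'r, 'm) fm set \<Rightarrow> real"
  assumes \<mu>: "keisler L \<GG> x A \<mu>" and \<psi>: "\<psi> \<in> formulas L \<GG> A {x}" "\<mu> \<psi> > 0"
    and F: "F \<in> borel_measurable (borel_of (subtopology (type_top L \<GG> A {x}) (support L \<GG> x A \<mu>)))"
    and bound: "\<And>r. r \<in> support L \<GG> x A \<mu> \<Longrightarrow> 0 \<le> F r \<and> F r \<le> 1"
    and e: "0 < e" and big: "\<And>r. r \<in> support L \<GG> x A \<mu> \<Longrightarrow> \<psi> \<in> r \<Longrightarrow> e \<le> F r"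
  shows "0 < (\<integral>r. F r \<partial>(restrict_space (type_measure L \<GG> x A \<mu>) (support L \<GG> x A \<mu>)))"
proof -
  let ?X = "type_top L \<GG> A {x}" and ?N = "type_nbhd L \<GG> A {x}" and ?S = "support L \<GG> x A \<mu>"
  define m where "m = type_measure L \<GG> x A \<mu>"
  define k where "k = restrict_space m ?S"
  note meas = measure_Int_support[OF \<mu> \<psi>(1), folded m_def]
  have reg: "regular_borel_prob ?X m" unfolding m_def by (rule type_measure_exists(1)[OF \<mu>])
  have sets_m: "sets m = sets (borel_of ?X)" and one: "emeasure m (space m) = 1"
    using reg by (simp_all add: regular_borel_prob_def)
  interpret m: finite_measure m by (rule finite_measureI) (simp add: one)
  have Sm: "?S \<inter> space m = ?S" using sets.sets_into_space[OF meas(1)] by blast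
  have space_k: "space k = ?S" by (simp add: k_def space_restrict_space Sm)
  have "emeasure k (space k) = emeasure m ?S"
    unfolding k_def space_restrict_space Sm by (rule emeasure_restrict_space) (simp_all add: Sm meas(1))
  then interpret k: finite_measure k by (intro finite_measureI) (simp add: m.emeasure_finite)
  let ?Y = "subtopology ?X ?S"
  have "V \<in> sets k" if "openin ?Y V" for V
  proof -
    obtain U where U: "openin ?X U" "V = U \<inter> ?S" using \<open>openin ?Y V\<close> unfolding openin_subtopology by blast
    have "U \<in> sets m" unfolding sets_m sets_borel_of using U(1) by (simp add: sigma_sets.Basic)
    then show ?thesis unfolding k_def sets_restrict_space using U(2) by (auto simp: Int_commute)
  qed
  moreover have topY: "topspace ?Y = space k" using support_subset[of L \<GG> x A \<mu>] by (auto simp: space_k)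
  ultimately have "sigma_sets (topspace ?Y) {V. openin ?Y V} \<subseteq> sets k"
    unfolding topY by (intro sets.sigma_sets_subset) auto
  then have "sets (borel_of ?Y) \<subseteq> sets k" by (simp only: sets_borel_of)
  moreover have "space (borel_of ?Y) = space k" by (simp only: space_borel_of topY)
  ultimately have Fk: "F \<in> borel_measurable k"
    using F unfolding measurable_def by auto
  have intF: "integrable k F"
  proof (rule k.integrable_const_bound[OF _ Fk])
    show "AE r in k. norm (F r) \<le> 1" by (rule AE_I2) (use bound in \<open>simp add: space_k\<close>)
  qed
  have A: "?N \<psi> \<inter> ?S \<in> sets k"
    unfolding k_def sets_restrict_space using meas(2) by (auto intro!: image_eqI[of _ _ "?N \<psi> \<inter> ?S"])
  have "(\<integral>r. e * indicator (?N \<psi> \<inter> ?S) r \<partial>k) = e * measure k (?N \<psi> \<inter> ?S)"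
    using A sets.sets_into_space[OF A] by (simp add: Int_absorb2)
  also have "measure k (?N \<psi> \<inter> ?S) = \<mu> \<psi>"
    unfolding k_def using meas by (subst measure_restrict_space) (simp_all add: Sm)
  finally have ind: "(\<integral>r. e * indicator (?N \<psi> \<inter> ?S) r \<partial>k) = e * \<mu> \<psi>" .
  have "(\<integral>r. e * indicator (?N \<psi> \<inter> ?S) r \<partial>k) \<le> (\<integral>r. F r \<partial>k)"
  proof (rule integral_mono[OF _ intF])
    show "integrable k (\<lambda>r. e * indicator (?N \<psi> \<inter> ?S) r)"
      using A by (intro integrable_mult_right integrable_real_indicator) (simp_all add: less_top[symmetric])
    fix r assume "r \<in> space k"
    then show "e * indicator (?N \<psi> \<inter> ?S) r \<le> F r"
      using bound big by (auto simp: space_k indicator_def)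
  qed
  moreover have "0 < e * \<mu> \<psi>" using e \<psi>(2) by simp
  ultimately have "0 < (\<integral>r. F r \<partial>k)" unfolding ind by linarith
  then show ?thesis by (simp only: k_def m_def)
qed

section \<open>Definable idempotent measures\<close>

text \<open>
  For a measure definable over \<open>M\<close>, the set of \<open>d\<close> with \<open>\<mu>(\<phi>(x \<cdot> d)) > e\<close> is a union of sets definable
  over \<open>M\<close> and the parameters of \<open>\<phi>\<close>. The formula \<open>\<phi>(x \<cdot> y)\<close> has to be written with variables
  in place of both \<open>d\<close> and the parameters of \<open>\<phi>\<close> before definability applies.
\<close>

lemma definable_open:
  fixes L :: "('s, 'f, 'r) lang" and \<GG> :: "('s, 'f, 'r, 'm) fo_struct"
  assumes \<mu>: "keisler L \<GG> x (univ \<GG>) \<mu>" and mul: "funs L mul = Some ([fst x, fst x], fst x)"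
    and def: "\<And>Y \<phi>. finite Y \<Longrightarrow> x \<notin> Y \<Longrightarrow> \<phi> \<in> formulas L \<GG> M (insert x Y) \<Longrightarrow>
      \<exists>f. continuous_map (type_top L \<GG> M Y) (top_of_set {0..1}) f \<and>
          (\<forall>b. assigns \<GG> Y b \<longrightarrow> \<mu> (inst Y b \<phi>) = f (tp L \<GG> M Y b))"
    and \<phi>: "\<phi> \<in> formulas L \<GG> (univ \<GG>) {x}" and d: "d \<in> sort_univ \<GG> (fst x)"
    and less: "e < \<mu> (translate mul x d \<phi>)"
  obtains \<theta> where "\<theta> \<in> formulas L \<GG> (M \<union> params \<phi>) {x}" "sat \<GG> (\<lambda>_. d) \<theta>"
    "\<And>c. c \<in> sort_univ \<GG> (fst x) \<Longrightarrow> sat \<GG> (\<lambda>_. c) \<theta> \<Longrightarrow> e < \<mu> (translate mul x c \<phi>)"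
proof -
  have \<phi>': "wf_fm L \<GG> \<phi>" "params \<phi> \<subseteq> univ \<GG>" "free_vars \<phi> \<subseteq> {x}" using \<phi> by (simp_all add: formulas_def)
  \<comment> \<open>A second variable of the sort of the group, for the right factor.\<close>
  define y where "y = (fst x, Suc (snd x))"
  have y: "fst y = fst x" "y \<noteq> x" by (simp_all add: y_def prod_eq_iff)
  obtain \<nu> :: "'m \<Rightarrow> 's var" where \<nu>: "inj_on \<nu> (params \<phi>)" "\<And>a. a \<in> params \<phi> \<Longrightarrow> \<nu> a \<notin> {x, y}"
    "\<And>a. fst (\<nu> a) = srt \<GG> a"
    by (rule fresh_names[OF finite_params, of "{x, y}" \<phi> "srt \<GG>"]) (simp, rule that)
  define Y where "Y = insert y (\<nu> ` params \<phi>)"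
  define \<beta> where "\<beta> c v = (if v = y then c else inv_into (params \<phi>) \<nu> v)" for c v
  have \<beta>: "\<beta> c y = c" "a \<in> params \<phi> \<Longrightarrow> \<beta> c (\<nu> a) = a" for c a
    using \<nu>(1,2) by (auto simp: \<beta>_def)
  have Y: "finite Y" "x \<notin> Y" using \<nu>(2) y(2) by (auto simp: Y_def)
  define \<theta> :: "'s var \<Rightarrow> ('s, 'f, 'm) tm" where "\<theta> = Var(x := Fn mul [Var x, Var y])"
  define \<pi> :: "'m \<Rightarrow> ('s, 'f, 'm) tm" where "\<pi> a = Var (\<nu> a)" for a
  obtain \<phi>0 where \<phi>0: "\<phi>0 \<in> formulas L \<GG> {} (insert x Y)"
    "\<And>(\<AA> :: ('s, 'f, 'r, 'm) fo_struct) \<sigma> \<rho>. sat \<AA> \<rho> (ren \<sigma> \<phi>0) \<longleftrightarrow>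
       sat \<AA> (\<lambda>u. eval \<AA> \<rho> (ren_tm \<sigma> (\<theta> u))) (ren (\<lambda>a. eval \<AA> \<rho> (ren_tm \<sigma> (\<pi> a))) \<phi>)"
  proof (rule capture_free_substitution[OF \<phi>'(1)])
    show "has_sort L \<GG> (\<theta> v) (fst v) \<and> tm_params (\<theta> v) \<subseteq> {} \<and> tm_vars (\<theta> v) \<subseteq> insert x Y"
      if "v \<in> free_vars \<phi>" for v
      using that mul y(1) \<phi>'(3) by (auto simp: \<theta>_def Y_def intro!: has_sort.intros(3) has_sort_Var)
    show "has_sort L \<GG> (\<pi> a) (srt \<GG> a) \<and> tm_params (\<pi> a) \<subseteq> {} \<and> tm_vars (\<pi> a) \<subseteq> insert x Y"
      if "a \<in> params \<phi>" for a
      using that by (simp add: \<pi>_def has_sort_Var \<nu>(3) Y_def)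
  qed (rule that)
  have \<phi>0M: "\<phi>0 \<in> formulas L \<GG> M (insert x Y)" and \<phi>0p: "params \<phi>0 = {}"
    using \<phi>0(1) by (simp_all add: formulas_def)
  have as: "assigns \<GG> Y (\<beta> c)" if "c \<in> sort_univ \<GG> (fst x)" for c
    using that \<nu>(3) \<phi>'(2) y(1) by (auto simp: assigns_def Y_def \<beta> sort_univ_def)
  have \<mu>\<beta>: "\<mu> (inst Y (\<beta> c) \<phi>0) = \<mu> (translate mul x c \<phi>)" if c: "c \<in> sort_univ \<GG> (fst x)" for c
  proof (rule keisler_cong[OF \<mu>])
    have "\<phi>0 \<in> formulas L \<GG> (univ \<GG>) ({x} \<union> Y)" using \<phi>0M \<phi>0p by (simp add: formulas_def)
    then show "inst Y (\<beta> c) \<phi>0 \<in> formulas L \<GG> (univ \<GG>) {x}"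
      by (rule inst_formulas[OF _ as[OF c]]) (use as[OF c] in \<open>auto simp: assigns_def sort_univ_def\<close>)
    have "translate mul x c \<phi> \<in> formulas L \<GG> (insert c (params \<phi>)) {x}"
      using c by (intro translate_formulas[OF mul \<phi>]) (simp add: sort_univ_def)
    then show "translate mul x c \<phi> \<in> formulas L \<GG> (univ \<GG>) {x}"
      using c \<phi>'(2) by (auto simp: formulas_def sort_univ_def)
    fix \<rho>
    let ?\<rho> = "\<lambda>v. if v \<in> Y then \<beta> c v else \<rho> v"
    have "ren (\<lambda>a. eval \<GG> ?\<rho> (ren_tm (\<lambda>a. a) (\<pi> a))) \<phi> = \<phi>"
      by (rule ren_ident) (simp add: \<pi>_def Y_def \<beta>)
    then have "sat \<GG> ?\<rho> (ren (\<lambda>a. a) \<phi>0) \<longleftrightarrow> sat \<GG> (\<lambda>u. eval \<GG> ?\<rho> (ren_tm (\<lambda>a. a) (\<theta> u))) \<phi>"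
      unfolding \<phi>0(2) by simp
    also have "\<dots> \<longleftrightarrow> sat \<GG> (\<rho>(x := fint \<GG> mul [\<rho> x, c])) \<phi>"
      using \<phi>'(3) Y(2) by (intro sat_cong) (auto simp: \<theta>_def Y_def \<beta>)
    finally show "sat \<GG> \<rho> (inst Y (\<beta> c) \<phi>0) \<longleftrightarrow> sat \<GG> \<rho> (translate mul x c \<phi>)"
      by (simp add: sat_inst sat_translate ren_ident)
  qed
  obtain f where f: "continuous_map (type_top L \<GG> M Y) (top_of_set {0..1}) f"
    "\<And>b. assigns \<GG> Y b \<Longrightarrow> \<mu> (inst Y b \<phi>0) = f (tp L \<GG> M Y b)"
    using def[OF Y \<phi>0M] by blast
  have f\<beta>: "f (tp L \<GG> M Y (\<beta> c)) = \<mu> (translate mul x c \<phi>)" if "c \<in> sort_univ \<GG> (fst x)" for c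
    using f(2)[OF as[OF that]] \<mu>\<beta>[OF that] by simp
  define U where "U = {t \<in> topspace (type_top L \<GG> M Y). f t \<in> {0..1} \<inter> {e<..}}"
  have "openin (top_of_set {0..1}) ({0..1} \<inter> {e<..})" by (rule openin_open_Int) simp
  then have U: "openin (type_top L \<GG> M Y) U"
    unfolding U_def by (rule openin_continuous_map_preimage[OF f(1)])
  have U_iff: "t \<in> U \<longleftrightarrow> e < f t" if "t \<in> type_space L \<GG> M Y" for t
  proof -
    have "f t \<in> {0..1}" using continuous_map_image_subset_topspace[OF f(1)] that by auto
    then show ?thesis using that by (simp add: U_def)
  qed
  have "tp L \<GG> M Y (\<beta> d) \<in> U"
    using U_iff[OF tp_type_space[OF as[OF d]]] f\<beta>[OF d] less by simp
  then obtain \<theta>0 where \<theta>0: "\<theta>0 \<in> formulas L \<GG> M Y" "\<theta>0 \<in> tp L \<GG> M Y (\<beta> d)" "type_nbhd L \<GG> M Y \<theta>0 \<subseteq> U"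
    by (rule type_top_base[OF U]) (rule that)
  \<comment> \<open>Put the parameters of \<open>\<phi>\<close> back, and let \<open>x\<close> stand for the right factor.\<close>
  define \<theta>' :: "'s var \<Rightarrow> ('s, 'f, 'm) tm" where "\<theta>' v = (if v = y then Var x else Par (inv_into (params \<phi>) \<nu> v))" for v
  have \<theta>0': "wf_fm L \<GG> \<theta>0" "params \<theta>0 \<subseteq> M" "free_vars \<theta>0 \<subseteq> Y" using \<theta>0(1) by (simp_all add: formulas_def)
  have Y_cases: "v = y \<or> (\<exists>a\<in>params \<phi>. v = \<nu> a)" if "v \<in> Y" for v using that by (auto simp: Y_def)
  have inv: "inv_into (params \<phi>) \<nu> (\<nu> a) = a" "\<nu> a \<noteq> y" if "a \<in> params \<phi>" for a
    using \<nu>(1,2) that by auto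
  obtain \<theta>1 where \<theta>1: "\<theta>1 \<in> formulas L \<GG> (M \<union> params \<phi>) {x}"
    "\<And>(\<AA> :: ('s, 'f, 'r, 'm) fo_struct) \<sigma> \<rho>. sat \<AA> \<rho> (ren \<sigma> \<theta>1) \<longleftrightarrow>
       sat \<AA> (\<lambda>u. eval \<AA> \<rho> (ren_tm \<sigma> (\<theta>' u))) (ren (\<lambda>a. eval \<AA> \<rho> (ren_tm \<sigma> (Par a))) \<theta>0)"
  proof (rule capture_free_substitution[OF \<theta>0'(1)])
    show "has_sort L \<GG> (\<theta>' v) (fst v) \<and> tm_params (\<theta>' v) \<subseteq> M \<union> params \<phi> \<and> tm_vars (\<theta>' v) \<subseteq> {x}"
      if "v \<in> free_vars \<theta>0" for v
    proof -
      have "v \<in> Y" using that \<theta>0'(3) by blast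
      from Y_cases[OF this] show ?thesis
        by (elim disjE bexE) (simp_all add: \<theta>'_def inv has_sort_Var has_sort_Par y(1) \<nu>(3))
    qed
    show "has_sort L \<GG> (Par a) (srt \<GG> a) \<and> tm_params (Par a :: ('s, 'f, 'm) tm) \<subseteq> M \<union> params \<phi> \<and>
        tm_vars (Par a :: ('s, 'f, 'm) tm) \<subseteq> {x}" if "a \<in> params \<theta>0" for a
      using that \<theta>0'(2) by (auto simp: has_sort_Par)
  qed (rule that)
  have \<theta>1_sat: "sat \<GG> (\<lambda>_. c) \<theta>1 \<longleftrightarrow> sat \<GG> (\<beta> c) \<theta>0" for c
  proof -
    have "sat \<GG> (\<lambda>_. c) (ren (\<lambda>a. a) \<theta>1) \<longleftrightarrow> sat \<GG> (\<lambda>u. eval \<GG> (\<lambda>_. c) (ren_tm (\<lambda>a. a) (\<theta>' u))) (ren (\<lambda>a. a) \<theta>0)"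
      unfolding \<theta>1(2) by simp
    also have "\<dots> \<longleftrightarrow> sat \<GG> (\<beta> c) (ren (\<lambda>a. a) \<theta>0)"
      by (rule sat_cong) (simp add: \<theta>'_def \<beta>_def)
    finally show ?thesis by (simp add: ren_ident)
  qed
  show thesis
  proof (rule that[OF \<theta>1(1)])
    show "sat \<GG> (\<lambda>_. d) \<theta>1" unfolding \<theta>1_sat using \<theta>0(2) by (simp add: tp_def)
    fix c assume c: "c \<in> sort_univ \<GG> (fst x)" "sat \<GG> (\<lambda>_. c) \<theta>1"
    have t: "tp L \<GG> M Y (\<beta> c) \<in> type_space L \<GG> M Y" by (rule tp_type_space[OF as[OF c(1)]])
    have "\<theta>0 \<in> tp L \<GG> M Y (\<beta> c)" using c(2) \<theta>0(1) by (simp add: \<theta>1_sat tp_def)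
    then have "tp L \<GG> M Y (\<beta> c) \<in> U" using t \<theta>0(3) by blast
    then show "e < \<mu> (translate mul x c \<phi>)" using U_iff[OF t] f\<beta>[OF c(1)] by simp
  qed
qed

context monster_pair
begin

text \<open>
  A compactness argument. If every neighbourhood of \<open>q\<close> contained a point where the integrand is at most
  \<open>e\<close>, then \<open>q\<close> would be consistent with the negations of all formulas that force it above \<open>e\<close>. By
  definability, a realization of all these formulas has an integrand of at most \<open>e\<close>, which contradicts
  that the integrand is constant on the realizations of \<open>q\<close>.
\<close>

lemma integrand_nbhd:
  assumes \<mu>: "keisler L \<GG> x (univ \<GG>) \<mu>"
    and M: "M \<subseteq> univ \<GG>" "small \<kappa> M"
    and def: "\<And>Y \<phi>. finite Y \<Longrightarrow> x \<notin> Y \<Longrightarrow> \<phi> \<in> formulas L \<GG> M (insert x Y) \<Longrightarrow>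
      \<exists>f. continuous_map (type_top L \<GG> M Y) (top_of_set {0..1}) f \<and>
          (\<forall>b. assigns \<GG> Y b \<longrightarrow> \<mu> (inst Y b \<phi>) = f (tp L \<GG> M Y b))"
    and \<phi>: "\<phi> \<in> forms (univ \<GG>)"
    and N: "N \<subseteq> univ \<GG>" "small \<kappa> N" "params \<phi> \<subseteq> N"
    and q: "q \<in> types N"
    and const: "\<And>d d'. realizes \<GG> x q d \<Longrightarrow> realizes \<GG> x q d' \<Longrightarrow>
      \<mu> (shift d \<phi>) = \<mu> (shift d' \<phi>)"
    and d: "realizes \<GG> x q d" and less: "e < \<mu> (shift d \<phi>)"
  obtains \<psi> where "\<psi> \<in> q" "\<And>c. c \<in> grp_elems \<Longrightarrow> sat \<GG> (\<lambda>_. c) \<psi> \<Longrightarrow> e < \<mu> (shift c \<phi>)"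
proof (rule ccontr)
  assume neg: "\<not> thesis"
  have no: "\<exists>c\<in>grp_elems. sat \<GG> (\<lambda>_. c) \<psi> \<and> \<not> e < \<mu> (shift c \<phi>)" if "\<psi> \<in> q" for \<psi>
    using neg that \<open>\<And>\<psi>. \<psi> \<in> q \<Longrightarrow> (\<And>c. c \<in> grp_elems \<Longrightarrow> sat \<GG> (\<lambda>_. c) \<psi> \<Longrightarrow> e < \<mu> (shift c \<phi>)) \<Longrightarrow> thesis\<close>
    by blast
  \<comment> \<open>By definability, \<open>\<mu>(\<phi>(x \<cdot> d')) \<le> e\<close> for every \<open>d'\<close> that satisfies no formula of \<open>\<Theta>\<close>.\<close>
  define \<Theta> where "\<Theta> = {\<theta> \<in> forms (M \<union> params \<phi>).
    \<forall>c\<in>grp_elems. sat \<GG> (\<lambda>_. c) \<theta> \<longrightarrow> e < \<mu> (shift c \<phi>)}"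
  have MN: "M \<union> N \<subseteq> univ \<GG>" using M N by blast
  have sub: "q \<union> Neg ` \<Theta> \<subseteq> forms (M \<union> N)"
  proof -
    have "M \<union> params \<phi> \<subseteq> M \<union> N" using N(3) by blast
    then have "\<Theta> \<subseteq> forms (M \<union> N)"
      using formulas_mono[of "M \<union> params \<phi>" "M \<union> N" "{x}" "{x}" L \<GG>] unfolding \<Theta>_def by blast
    moreover have "q \<subseteq> forms (M \<union> N)"
      using q formulas_mono[of N "M \<union> N" "{x}" "{x}" L \<GG>] unfolding type_space_iff by blast
    ultimately show ?thesis by auto
  qed
  have "fin_sat \<GG> {x} (q \<union> Neg ` \<Theta>)"
    unfolding fin_sat_def
  proof (intro allI impI)
    fix \<Phi> assume \<Phi>: "finite \<Phi> \<and> \<Phi> \<subseteq> q \<union> Neg ` \<Theta>"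
    have \<Phi>q: "finite (\<Phi> \<inter> q)" "\<Phi> \<inter> q \<subseteq> q" using \<Phi> by auto
    have "\<Phi> \<inter> q \<subseteq> forms N" using q by (auto simp: type_space_iff)
    then obtain \<zeta> where \<zeta>: "\<zeta> \<in> forms N"
      "\<And>(\<AA> :: ('s, 'f, 'r, 'm) fo_struct) \<rho>. sat \<AA> \<rho> \<zeta> \<longleftrightarrow> (\<forall>\<psi>\<in>\<Phi> \<inter> q. sat \<AA> \<rho> \<psi>)"
      by (rule finite_conjunction[OF \<Phi>q(1)]) (rule that)
    have "\<zeta> \<in> q" by (rule type_closed[OF q \<Phi>q \<zeta>(1)]) (simp add: \<zeta>(2))
    from no[OF this] obtain c where c: "c \<in> grp_elems" "sat \<GG> (\<lambda>_. c) \<zeta>" "\<not> e < \<mu> (shift c \<phi>)"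
      by blast
    have "sat \<GG> (\<lambda>_. c) \<psi>" if \<psi>: "\<psi> \<in> \<Phi>" for \<psi>
    proof (cases "\<psi> \<in> q")
      case True
      then show ?thesis using \<zeta>(2) c(2) \<psi> by blast
    next
      case False
      then obtain \<theta> where "\<psi> = Neg \<theta>" "\<theta> \<in> \<Theta>" using \<Phi> \<psi> by blast
      then show ?thesis using c(1,3) unfolding \<Theta>_def by auto
    qed
    moreover have "assigns \<GG> {x} (\<lambda>_. c)" using c(1) by (simp add: assigns_def)
    ultimately show "\<exists>b. assigns \<GG> {x} b \<and> (\<forall>\<phi>\<in>\<Phi>. sat \<GG> b \<phi>)" by blast
  qed
  moreover have "saturated L \<kappa> \<GG>" using mon by (simp add: monster_def)
  moreover have "small \<kappa> (M \<union> N)" using small_Un[OF _ _ M(2) N(2)] mon by (simp add: monster_def)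
  ultimately obtain d' where d': "realizes \<GG> x (q \<union> Neg ` \<Theta>) d'"
    using saturated_realizes[OF _ MN _ sub] by blast
  then have s: "d' \<in> grp_elems" by (simp add: realizes_def)
  have "realizes \<GG> x q d'" by (rule realizes_subset[OF d']) blast
  then have less': "e < \<mu> (shift d' \<phi>)" using const[OF d] less by simp
  obtain \<theta> where \<theta>: "\<theta> \<in> forms (M \<union> params \<phi>)" "sat \<GG> (\<lambda>_. d') \<theta>"
    "\<And>c. c \<in> grp_elems \<Longrightarrow> sat \<GG> (\<lambda>_. c) \<theta> \<Longrightarrow> e < \<mu> (shift c \<phi>)"
    by (rule definable_open[OF \<mu> mul def \<phi> s less']) (assumption+, rule that)
  then have "\<theta> \<in> \<Theta>" unfolding \<Theta>_def by blast
  then have "sat \<GG> (\<lambda>_. d') (Neg \<theta>)" using d' unfolding realizes_def by blast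
  then show False using \<theta>(2) by simp
qed

text \<open>
  If \<open>\<phi>\<close> belongs to \<open>p * q\<close>, the integrand of \<open>(\<mu> * \<mu>)(\<phi>)\<close> is positive at the restriction of \<open>q\<close> to
  \<open>N\<close>. It is bounded away from zero near this point of the support, so the integral is positive.
\<close>

lemma support_closed_under_product:
  assumes \<mu>: "keisler L \<GG> x (univ \<GG>) \<mu>" and def: "definable L x \<kappa> \<GG> \<mu>"
    and M: "submodel L \<GG> M" "small \<kappa> M"
    and inv: "\<And>p. p \<in> support L \<GG> x (univ \<GG>) \<mu> \<Longrightarrow> invariant L \<GG> x M p"
    and idem: "star_idempotent L mul x \<kappa> \<GG> \<mu>"
    and p: "p \<in> support L \<GG> x (univ \<GG>) \<mu>" and q: "q \<in> support L \<GG> x (univ \<GG>) \<mu>"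
  shows "prd p q \<in> support L \<GG> x (univ \<GG>) \<mu>"
proof -
  have pt: "p \<in> types (univ \<GG>)" and qt: "q \<in> types (univ \<GG>)"
    using p q by (simp_all add: support_def)
  note prod = product_iff[OF M inv[OF p] inv[OF q] pt qt]
  obtain D where D: "submodel L \<GG> D" "small \<kappa> D" and D': "\<forall>Y. finite Y \<and> x \<notin> Y \<longrightarrow>
      (\<forall>\<phi>\<in>formulas L \<GG> D (insert x Y).
        \<exists>f. continuous_map (type_top L \<GG> D Y) (top_of_set {0..1}) f \<and>
            (\<forall>b. assigns \<GG> Y b \<longrightarrow> \<mu> (inst Y b \<phi>) = f (tp L \<GG> D Y b)))"
    using def unfolding definable_def by (elim exE conjE)
  have defD: "\<exists>f. continuous_map (type_top L \<GG> D Y) (top_of_set {0..1}) f \<and>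
          (\<forall>b. assigns \<GG> Y b \<longrightarrow> \<mu> (inst Y b \<phi>) = f (tp L \<GG> D Y b))"
    if "finite Y" "x \<notin> Y" "\<phi> \<in> formulas L \<GG> D (insert x Y)" for Y \<phi>
    by (rule D'[THEN spec, THEN mp, OF conjI[OF that(1,2)], THEN bspec, OF that(3)])
  have "\<mu> \<phi> > 0" if \<phi>p: "\<phi> \<in> prd p q" for \<phi>
  proof -
    have \<phi>: "\<phi> \<in> forms (univ \<GG>)" using prod(1) \<phi>p by (rule type_space_formulas)
    define N where "N = (SOME N. conv_base L mul x \<kappa> \<GG> \<mu> \<mu> \<phi> N)"
    have "\<exists>N. conv_base L mul x \<kappa> \<GG> \<mu> \<mu> \<phi> N"
      using idem \<phi> unfolding star_idempotent_def star_Borel_def by blast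
    then have cb: "conv_base L mul x \<kappa> \<GG> \<mu> \<mu> \<phi> N" unfolding N_def by (rule someI_ex)
    have N: "N \<subseteq> univ \<GG>" "small \<kappa> N" "params \<phi> \<subseteq> N"
      using cb submodel_univ[of N] unfolding conv_base_def by blast+
    have const: "\<mu> (shift d \<phi>) = \<mu> (shift d' \<phi>)"
      if "r \<in> support L \<GG> x N \<mu>" "realizes \<GG> x r d" "realizes \<GG> x r d'" for r d d'
      using cb that unfolding conv_base_def by blast
    have meas: "conv_integrand mul x \<GG> \<mu> \<phi>
        \<in> borel_measurable (borel_of (subtopology (type_top L \<GG> N {x}) (support L \<GG> x N \<mu>)))"
      using cb unfolding conv_base_def by blast
    have "small \<kappa> (M \<union> N)" using small_Un[OF _ _ M(2) N(2)] mon by (simp add: monster_def)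
    moreover have "M \<union> N \<subseteq> univ \<GG>" using submodel_univ[OF M(1)] N(1) by blast
    ultimately obtain d where d: "realizes \<GG> x (q \<inter> forms (M \<union> N)) d" using realization[OF qt] by blast
    have sN: "M \<union> params \<phi> \<subseteq> M \<union> N" "N \<subseteq> M \<union> N" using N(3) by blast+
    have d1: "realizes \<GG> x (q \<inter> forms (M \<union> params \<phi>)) d"
      by (rule realizes_fewer[OF d sN(1)])
    have d2: "realizes \<GG> x (q \<inter> forms N) d"
      by (rule realizes_fewer[OF d sN(2)])
    \<comment> \<open>Any positive bound strictly below the value at \<open>d\<close> will do.\<close>
    define e where "e = \<mu> (shift d \<phi>) / 2"
    have "shift d \<phi> \<in> p" using prod(2)[OF \<phi> d1] \<phi>p by simp
    then have "0 < \<mu> (shift d \<phi>)" using p unfolding support_def by blast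
    then have e: "0 < e" "e < \<mu> (shift d \<phi>)" by (simp_all add: e_def)
    have qN: "q \<inter> forms N \<in> support L \<GG> x N \<mu>" by (rule support_restrict[OF q N(1)])
    then have qNt: "q \<inter> forms N \<in> types N" by (simp add: support_def)
    obtain \<psi> where \<psi>: "\<psi> \<in> q \<inter> forms N"
      "\<And>c. c \<in> grp_elems \<Longrightarrow> sat \<GG> (\<lambda>_. c) \<psi> \<Longrightarrow> e < \<mu> (shift c \<phi>)"
      by (rule integrand_nbhd[OF \<mu> submodel_univ[OF D(1)] D(2) defD \<phi> N qNt const[OF qN] d2 e(2)]) (assumption+, rule that)
    have \<psi>pos: "\<mu> \<psi> > 0" using \<psi>(1) q unfolding support_def by blast
    have real: "realizes \<GG> x r (SOME d. realizes \<GG> x r d)" if "r \<in> support L \<GG> x N \<mu>" for r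
    proof -
      have "r \<in> types N" using that by (simp add: support_def)
      then have "\<exists>d. realizes \<GG> x r d" using mon N(1,2) unfolding monster_def saturated_def by blast
      then show ?thesis by (rule someI_ex)
    qed
    have "0 < (\<integral>r. conv_integrand mul x \<GG> \<mu> \<phi> r \<partial>(restrict_space (type_measure L \<GG> x N \<mu>) (support L \<GG> x N \<mu>)))"
    proof (rule integral_support_pos[OF keisler_restrict[OF \<mu> N(1)] _ \<psi>pos meas _ e(1)])
      show "\<psi> \<in> forms N" using \<psi>(1) by blast
      fix r assume r: "r \<in> support L \<GG> x N \<mu>"
      define c where "c = (SOME d. realizes \<GG> x r d)"
      have c: "realizes \<GG> x r c" unfolding c_def by (rule real[OF r])
      then have cs: "c \<in> grp_elems" by (simp add: realizes_def)
      have F: "conv_integrand mul x \<GG> \<mu> \<phi> r = \<mu> (shift c \<phi>)" by (simp add: conv_integrand_def c_def)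
      show "0 \<le> conv_integrand mul x \<GG> \<mu> \<phi> r \<and> conv_integrand mul x \<GG> \<mu> \<phi> r \<le> 1"
        unfolding F using keisler_nonneg[OF \<mu> translate_in[OF \<phi> cs]] keisler_le_1[OF \<mu> translate_in[OF \<phi> cs]] by simp
      assume "\<psi> \<in> r"
      then have "sat \<GG> (\<lambda>_. c) \<psi>" using c unfolding realizes_def by blast
      then show "e \<le> conv_integrand mul x \<GG> \<mu> \<phi> r" unfolding F using \<psi>(2)[OF cs] by simp
    qed
    also have "\<dots> = convolution L mul x \<kappa> \<GG> \<mu> \<mu> \<phi>" by (simp add: convolution_def Let_def N_def)
    also have "\<dots> = \<mu> \<phi>" using idem \<phi> unfolding star_idempotent_def by blast
    finally show ?thesis .
  qed
  then show ?thesis using prod(1) unfolding support_def by blast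
qed

text \<open>
  The element \<open>d\<close> serves all \<open>p\<close> at once, so the preimage of the basic set of \<open>\<phi>\<close> is that of \<open>\<phi>(x \<cdot> d)\<close>.
\<close>

lemma product_left_continuous:
  fixes S
  defines "X \<equiv> subtopology (type_top L \<GG> (univ \<GG>) {x}) S"
  assumes M: "submodel L \<GG> M" "small \<kappa> M"
    and S: "S \<subseteq> types (univ \<GG>)" "\<And>p. p \<in> S \<Longrightarrow> invariant L \<GG> x M p"
    and q: "q \<in> S" and closed: "\<And>p. p \<in> S \<Longrightarrow> prd p q \<in> S"
  shows "continuous_map X X (\<lambda>p. prd p q)"
proof -
  let ?T = "type_top L \<GG> (univ \<GG>) {x}" and ?F = "forms (univ \<GG>)"
  have top: "topspace X = S" using S(1) by (auto simp: X_def)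
  have "continuous_map X ?T (\<lambda>p. prd p q)"
    unfolding type_top_def continuous_on_generated_topo_iff
  proof (intro conjI allI impI)
    fix U assume "U \<in> type_nbhd L \<GG> (univ \<GG>) {x} ` ?F"
    then obtain \<phi> where \<phi>: "\<phi> \<in> ?F" "U = type_nbhd L \<GG> (univ \<GG>) {x} \<phi>" by (rule imageE)
    have "M \<union> params \<phi> \<subseteq> univ \<GG>" "small \<kappa> (M \<union> params \<phi>)"
      using submodel_univ[OF M(1)] \<phi>(1) small_Un_finite[OF mon M(2) finite_params] by (auto simp: formulas_def)
    moreover have qt: "q \<in> types (univ \<GG>)" using q S(1) by blast
    ultimately obtain d where d: "realizes \<GG> x (q \<inter> forms (M \<union> params \<phi>)) d"
      using realization by blast
    then have ds: "d \<in> grp_elems" by (simp add: realizes_def)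
    have "(\<lambda>p. prd p q) -` U \<inter> S = type_nbhd L \<GG> (univ \<GG>) {x} (shift d \<phi>) \<inter> S"
    proof (rule Set.set_eqI)
      fix p
      have "prd p q \<in> U \<longleftrightarrow> shift d \<phi> \<in> p" if "p \<in> S"
      proof -
        have pt: "p \<in> types (univ \<GG>)" using that S(1) by blast
        note prod = product_iff[OF M S(2)[OF that] S(2)[OF q] pt qt]
        show ?thesis using prod(1) prod(2)[OF \<phi>(1) d] by (simp add: \<phi>(2))
      qed
      then show "p \<in> (\<lambda>p. prd p q) -` U \<inter> S \<longleftrightarrow>
          p \<in> type_nbhd L \<GG> (univ \<GG>) {x} (shift d \<phi>) \<inter> S"
        using S(1) by auto
    qed
    moreover have "openin ?T (type_nbhd L \<GG> (univ \<GG>) {x} (shift d \<phi>))"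
      by (rule openin_type_nbhd[OF translate_in[OF \<phi>(1) ds]])
    ultimately show "openin X ((\<lambda>p. prd p q) -` U \<inter> topspace X)"
      unfolding top unfolding X_def openin_subtopology
      by (intro exI[of _ "type_nbhd L \<GG> (univ \<GG>) {x} (shift d \<phi>)"] conjI)
  next
    have "(\<lambda>p. prd p q) ` S \<subseteq> topspace ?T" using closed S(1) by auto
    then show "(\<lambda>p. prd p q) ` topspace X \<subseteq> \<Union>(type_nbhd L \<GG> (univ \<GG>) {x} ` ?F)"
      unfolding top type_top_def topology_generated_by_topspace .
  qed
  then show ?thesis
    unfolding X_def using closed by (intro continuous_map_into_subtopology) (use top in \<open>auto simp: X_def\<close>)
qed

end

theorem corollary4p4:
  fixes L :: "('s, 'f, 'r) lang"
    and T :: "('s, 'f, 'r, 'm) fm set"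
    and \<GG> \<HH> :: "('s, 'f, 'r, 'm) fo_struct"
    and \<kappa> :: "'k rel" and \<kappa>' :: "'l rel"
    and mul :: 'f and x :: "'s var"
    and \<mu> :: "('s, 'f, 'r, 'm) fm \<Rightarrow> real"
  defines "S \<equiv> support L \<GG> x (univ \<GG>) \<mu>"
    and "X \<equiv> subtopology (type_top L \<GG> (univ \<GG>) {x}) (support L \<GG> x (univ \<GG>) \<mu>)"
    and "prd \<equiv> type_prod L mul x \<kappa> \<GG> \<HH>"
  assumes "T \<subseteq> formulas L \<GG> {} {}"
    and "expands_group L mul x T"
    and "model L T \<GG>"
    and "monster L \<kappa> \<GG>"
    and "monster L \<kappa>' \<HH>" and "small \<kappa>' (univ \<GG>)" and "elementary L \<GG> \<HH>"
    and "keisler L \<GG> x (univ \<GG>) \<mu>"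
    and "definable L x \<kappa> \<GG> \<mu>"
    and "invariantly_supported L x \<kappa> \<GG> \<mu>"
    and "star_idempotent L mul x \<kappa> \<GG> \<mu>"
  shows "compact_space X \<and> Hausdorff_space X \<and>
    (\<forall>p \<in> S. \<forall>q \<in> S. prd p q \<in> S) \<and>
    (\<forall>p \<in> S. \<forall>q \<in> S. \<forall>r \<in> S. prd (prd p q) r = prd p (prd q r)) \<and>
    (\<forall>q \<in> S. continuous_map X X (\<lambda>p. prd p q))"
proof -
  have mul: "funs L mul = Some ([fst x, fst x], fst x)" and grp: "group_on mul x \<GG>"
    using assms(5,6) unfolding expands_group_def by blast+
  interpret monster_pair L \<GG> \<HH> \<kappa> \<kappa>' mul x
    by (rule monster_pair.intro[OF assms(7-10) mul grp])
  obtain M where M: "submodel L \<GG> M" "small \<kappa> M" and inv: "\<And>p. p \<in> S \<Longrightarrow> invariant L \<GG> x M p"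
    using assms(13) unfolding invariantly_supported_def S_def by blast
  have St: "p \<in> type_space L \<GG> (univ \<GG>) {x}" if "p \<in> S" for p
    using that support_subset unfolding S_def by blast
  have closed: "prd p q \<in> S" if "p \<in> S" "q \<in> S" for p q
    unfolding prd_def S_def
    using support_closed_under_product[OF assms(11,12) M inv[unfolded S_def] assms(14)] that[unfolded S_def] by blast
  have "compact_space X"
    unfolding X_def
    by (intro compact_space_subtopology closedin_compact_space compact_type_top closedin_support assms(11))
  moreover have "Hausdorff_space X"
    unfolding X_def by (rule Hausdorff_space_subtopology[OF Hausdorff_type_top])
  moreover have "prd (prd p q) r = prd p (prd q r)" if "p \<in> S" "q \<in> S" "r \<in> S" for p q r
    using that closed unfolding prd_def by (intro product_assoc[OF M] inv St) (simp_all add: prd_def)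
  moreover have "continuous_map X X (\<lambda>p. prd p q)" if "q \<in> S" for q
    unfolding X_def prd_def S_def[symmetric]
    using closed[OF _ that, unfolded prd_def] that by (intro product_left_continuous[OF M]) (auto intro: inv St)
  ultimately show ?thesis using closed by blast
qed

end
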